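(* Let $T>0$ and assume the following. (i) The SDDE $dx(t)=f(x(t),x(t-\tau(t)))\,dt+g(x(t),x(t-\tau(t)))\,dw(t)$ with initial data $x(t)=\psi(t)$, $t\in[-\tau,0]$, has a unique solution $x(t)$ on $[-\tau,T]$, and $f,g$ are locally Lipschitz: for each $R>0$ there is a constant $L_R$ such that $$|f(x_2,y_2)-f(x_1,y_1)|^2\vee|g(x_2,y_2)-g(x_1,y_1)|^2\le L_R\left(|x_2-x_1|^2+|y_2-y_1|^2\right)$$ for all $x_1,x_2,y_1,y_2\in\mathbb{R}^d$ with $|x_1|\vee|x_2|\vee|y_1|\vee|y_2|\le R$. (ii) There are constants $\eta_1,\eta_2$ such that $\mathbb{E}|\psi(t)-\psi(s)|^2\le\eta_1|t-s|$ for all $s,t\in[-\tau,0]$, and $\tau(\cdot)$ is continuous with $|\tau(t)-\tau(s)|\le\eta_2|t-s|$ for all $s,t\ge0$. (iii) For all (sufficiently small) stepsizes $h>0$, the implicit equation $y_n^*=y_n+hf(y_n^*,\tilde y_n^* )$ of the SSBE method admits a unique solution at every step. (iv) There are constants $p>2$ and $A>0$, independent of $h$, such that $$\mathbb{E}\Big[\sup_{0\le t\le T}|x(t)|^p\Big]\vee\mathbb{E}\Big[\sup_{0\le t\le T}|\bar y(t)|^p\Big]\le A .$$ Then the continuous-time approximate solution $\bar y(t)$ of the SSBE method converges to the true solution in the mean-square sense: $$\mathbb{E}\sup_{0\le t\le T}|\bar y(t)-x(t)|^2\to0\quad\text{as }h\to0.$$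
   Context: $|\cdot|$ denotes the Euclidean norm on $\mathbb{R}^d$ and the trace (Frobenius) norm on $\mathbb{R}^{d\times m}$; $a\vee b=\max\{a,b\}$. Equation. $f:\mathbb{R}^d\times\mathbb{R}^d\to\mathbb{R}^d$, $g:\mathbb{R}^d\times\mathbb{R}^d\to\mathbb{R}^{d\times m}$; $w$ is an $m$-dimensional Wiener process on a complete filtered probability space $(\Omega,\mathcal F,\{\mathcal F_t\}_{t\ge0},\mathbb P)$ satisfying the usual conditions; the SDDE is understood in the It\^o sense. The delay satisfies $\tau(t)\ge0$ and $-\tau:=\inf\{t-\tau(t):t\ge0\}$ (finite). The initial data $\psi$ is an $\mathcal F_0$-measurable random function on $[-\tau,0]$ with continuous paths, independent of $w$. SSBE (split-step backward Euler) method with stepsize $h>0$, $t_n=nh$, $\Delta w_n=w(t_{n+1})-w(t_n)$, $y_0=\psi(0)$: for $n=0,1,2,\dots$ $$y_n^*=y_n+hf(y_n^*,\tilde y_n^* ),\qquad y_{n+1}=y_n^*+g(y_n^*,\tilde y_n^* )\Delta w_n,$$ where $\tilde y_n^*=\psi(t_n-\tau(t_n))$ if $t_n-\tau(t_n)<0$, and $\tilde y_n^*=\mu\,y^*_{n-q_n+1}+(1-\mu)\,y^*_{n-q_n}$ if $0\le t_n-\tau(t_n)\in[t_{n-q_n},t_{n-q_n+1})$ with $q_n\ge1$ an integer. Here $0\le\mu<1$ is either $\mu\equiv0$ (piecewise constant interpolation) or, for each $n$, the number with $t_n-\tau(t_n)=(1-\mu)t_{n-q_n}+\mu t_{n-q_n+1}$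 (piecewise linear interpolation). If $\tau(t_n)=0$, then $\tilde y_n^*=y_n^*$. The random variables $y_n,y_n^*$ are $\mathcal F_{t_n}$-measurable. Continuous-time version: $\bar y(t)=\psi(t)$ for $t\le0$, and $\bar y(t)=y_n+(t-t_n)f(y_n^*,\tilde y_n^* )+g(y_n^*,\tilde y_n^* )(w(t)-w(t_n))$ for $t\in[t_n,t_{n+1})$, $n\ge0$. *)

theory Defs
  imports "HOL-Probability.Probability"
begin

section \<open>Stochastic basis and Wiener process\<close>

text \<open>Time is indexed by \<^typ>\<open>real\<close>. Only \<open>F t\<close> for \<open>t \<ge> 0\<close> is ever used; a filtration given on
  \<open>[0, \<infinity>)\<close> fits the locale by putting \<open>F t = F 0\<close> for \<open>t < 0\<close>.\<close>

locale usual_stochastic_basis = prob_space M + complete_measure M + filtration "space M" F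
  for M :: "'a measure" and F :: "real \<Rightarrow> 'a measure" +
  assumes sets_F_subset: "t \<ge> 0 \<Longrightarrow> sets (F t) \<subseteq> sets M"
    and null_sets_F: "null_sets M \<subseteq> sets (F 0)"
    and right_continuous: "t \<ge> 0 \<Longrightarrow> sets (F t) = (\<Inter>s\<in>{t<..}. sets (F s))"

definition wiener_process ::
  "'a measure \<Rightarrow> (real \<Rightarrow> 'a measure) \<Rightarrow> (real \<Rightarrow> 'a \<Rightarrow> real ^ 'm) \<Rightarrow> bool" where
  "wiener_process M F w \<longleftrightarrow>
     (\<forall>t\<ge>0. w t \<in> borel_measurable (F t)) \<and>
     (AE \<omega> in M. w 0 \<omega> = 0) \<and>
     (AE \<omega> in M. continuous_on {0..} (\<lambda>t. w t \<omega>)) \<and>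
     (\<forall>s t. 0 \<le> s \<and> s < t \<longrightarrow>
        prob_space.indep_set M (sets (F s))
          (sets (vimage_algebra (space M) (\<lambda>\<omega>. w t \<omega> - w s \<omega>) borel)) \<and>
        prob_space.indep_vars M (\<lambda>_. borel) (\<lambda>i \<omega>. (w t \<omega> - w s \<omega>) $ i) UNIV \<and>
        (\<forall>i. distributed M lborel (\<lambda>\<omega>. (w t \<omega> - w s \<omega>) $ i) (normal_density 0 (sqrt (t - s)))))"

text \<open>The sigma-algebra generated by the variables \<open>X t\<close> with \<open>t \<in> J\<close>.\<close>

definition path_events :: "'a measure \<Rightarrow> real set \<Rightarrow> (real \<Rightarrow> 'a \<Rightarrow> 'b::topological_space) \<Rightarrow> 'a set set" where
  "path_events M J X =
     sets (vimage_algebra (space M) (\<lambda>\<omega>. \<lambda>t\<in>J. X t \<omega>) (PiM J (\<lambda>_. borel)))"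

section \<open>Ito integral\<close>

text \<open>The integral of a measurable adapted process with almost surely square-integrable paths
  is the limit in probability of the elementary integrals of bounded adapted step processes
  approximating the integrand. No moment condition is imposed on the integrand.
  The norm on \<^typ>\<open>real ^ 'm ^ 'd\<close> is the Frobenius norm.\<close>

definition step_partition ::
  "'a measure \<Rightarrow> (real \<Rightarrow> 'a measure) \<Rightarrow> real \<Rightarrow> nat \<Rightarrow> (nat \<Rightarrow> real) \<Rightarrow>
   (nat \<Rightarrow> 'a \<Rightarrow> real ^ 'm ^ 'd) \<Rightarrow> bool" where
  "step_partition M F T N p \<xi> \<longleftrightarrow>
     p 0 = 0 \<and> p N = T \<and> (\<forall>i<N. p i < p (Suc i)) \<and>
     (\<forall>i<N. \<xi> i \<in> borel_measurable (F (p i)) \<and> (\<exists>B. \<forall>\<omega>\<in>space M. norm (\<xi> i \<omega>) \<le> B))"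

definition step_process ::
  "nat \<Rightarrow> (nat \<Rightarrow> real) \<Rightarrow> (nat \<Rightarrow> 'a \<Rightarrow> real ^ 'm ^ 'd) \<Rightarrow> real \<Rightarrow> 'a \<Rightarrow> real ^ 'm ^ 'd" where
  "step_process N p \<xi> s \<omega> = (\<Sum>i<N. indicator {p i..<p (Suc i)} s *\<^sub>R \<xi> i \<omega>)"

definition step_integral ::
  "(real \<Rightarrow> 'a \<Rightarrow> real ^ 'm) \<Rightarrow> nat \<Rightarrow> (nat \<Rightarrow> real) \<Rightarrow> (nat \<Rightarrow> 'a \<Rightarrow> real ^ 'm ^ 'd) \<Rightarrow>
   'a \<Rightarrow> real ^ 'd" where
  "step_integral w N p \<xi> \<omega> = (\<Sum>i<N. \<xi> i \<omega> *v (w (p (Suc i)) \<omega> - w (p i) \<omega>))"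

definition null_in_probability :: "'a measure \<Rightarrow> (nat \<Rightarrow> 'a \<Rightarrow> ennreal) \<Rightarrow> bool" where
  "null_in_probability M X \<longleftrightarrow>
     (\<forall>\<epsilon>>0. (\<lambda>k. emeasure M {\<omega> \<in> space M. \<epsilon> < X k \<omega>}) \<longlonglongrightarrow> 0)"

text \<open>\<open>has_ito_integral M F w T G I\<close>: the random variable \<open>I\<close> is a version of the integral of
  \<open>G\<close> with respect to \<open>w\<close> over \<open>[0, T]\<close>.\<close>

definition has_ito_integral ::
  "'a measure \<Rightarrow> (real \<Rightarrow> 'a measure) \<Rightarrow> (real \<Rightarrow> 'a \<Rightarrow> real ^ 'm) \<Rightarrow> real \<Rightarrow>
   (real \<Rightarrow> 'a \<Rightarrow> real ^ 'm ^ 'd) \<Rightarrow> ('a \<Rightarrow> real ^ 'd) \<Rightarrow> bool" where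
  "has_ito_integral M F w T G I \<longleftrightarrow>
     (\<lambda>(s, \<omega>). G s \<omega>) \<in> borel_measurable (restrict_space borel {0..T} \<Otimes>\<^sub>M M) \<and>
     (\<forall>s\<in>{0..T}. G s \<in> borel_measurable (F s)) \<and>
     (AE \<omega> in M. (\<integral>\<^sup>+s\<in>{0..T}. ennreal ((norm (G s \<omega>))\<^sup>2) \<partial>lborel) < \<infinity>) \<and>
     I \<in> borel_measurable M \<and>
     (\<exists>N p \<xi>.
        (\<forall>k. step_partition M F T (N k) (p k) (\<xi> k)) \<and>
        null_in_probability M
          (\<lambda>k \<omega>. \<integral>\<^sup>+s\<in>{0..T}.
             ennreal ((norm (step_process (N k) (p k) (\<xi> k) s \<omega> - G s \<omega>))\<^sup>2) \<partial>lborel) \<and>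
        null_in_probability M
          (\<lambda>k \<omega>. ennreal (norm (step_integral w (N k) (p k) (\<xi> k) \<omega> - I \<omega>))))"

section \<open>Stochastic delay differential equation\<close>

text \<open>The left end point \<open>-\<tau>\<close> of the initial interval.\<close>

definition initial_time :: "(real \<Rightarrow> real) \<Rightarrow> real" where
  "initial_time \<tau> = (INF t\<in>{0..}. t - \<tau> t)"

definition sdde_solution ::
  "'a measure \<Rightarrow> (real \<Rightarrow> 'a measure) \<Rightarrow> (real \<Rightarrow> 'a \<Rightarrow> real ^ 'm) \<Rightarrow>
   (real ^ 'd \<Rightarrow> real ^ 'd \<Rightarrow> real ^ 'd) \<Rightarrow> (real ^ 'd \<Rightarrow> real ^ 'd \<Rightarrow> real ^ 'm ^ 'd) \<Rightarrow>
   (real \<Rightarrow> real) \<Rightarrow> (real \<Rightarrow> 'a \<Rightarrow> real ^ 'd) \<Rightarrow> real \<Rightarrow> (real \<Rightarrow> 'a \<Rightarrow> real ^ 'd) \<Rightarrow> bool" where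
  "sdde_solution M F w f g \<tau> \<psi> T x \<longleftrightarrow>
     (\<forall>\<omega>\<in>space M. continuous_on {initial_time \<tau>..T} (\<lambda>t. x t \<omega>)) \<and>
     (\<forall>t\<in>{0..T}. x t \<in> borel_measurable (F t)) \<and>
     (\<forall>\<omega>\<in>space M. \<forall>t\<in>{initial_time \<tau>..0}. x t \<omega> = \<psi> t \<omega>) \<and>
     (AE \<omega> in M. set_integrable lborel {0..T} (\<lambda>s. f (x s \<omega>) (x (s - \<tau> s) \<omega>))) \<and>
     (\<forall>t\<in>{0..T}. \<exists>I.
        has_ito_integral M F w t (\<lambda>s \<omega>. g (x s \<omega>) (x (s - \<tau> s) \<omega>)) I \<and>
        (AE \<omega> in M. x t \<omega> =
           \<psi> 0 \<omega> + (LINT s:{0..t}|lborel. f (x s \<omega>) (x (s - \<tau> s) \<omega>)) + I \<omega>))"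

definition unique_sdde_solution ::
  "'a measure \<Rightarrow> (real \<Rightarrow> 'a measure) \<Rightarrow> (real \<Rightarrow> 'a \<Rightarrow> real ^ 'm) \<Rightarrow>
   (real ^ 'd \<Rightarrow> real ^ 'd \<Rightarrow> real ^ 'd) \<Rightarrow> (real ^ 'd \<Rightarrow> real ^ 'd \<Rightarrow> real ^ 'm ^ 'd) \<Rightarrow>
   (real \<Rightarrow> real) \<Rightarrow> (real \<Rightarrow> 'a \<Rightarrow> real ^ 'd) \<Rightarrow> real \<Rightarrow> (real \<Rightarrow> 'a \<Rightarrow> real ^ 'd) \<Rightarrow> bool" where
  "unique_sdde_solution M F w f g \<tau> \<psi> T x \<longleftrightarrow>
     sdde_solution M F w f g \<tau> \<psi> T x \<and>
     (\<forall>x'. sdde_solution M F w f g \<tau> \<psi> T x' \<longrightarrow>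
        (AE \<omega> in M. \<forall>t\<in>{initial_time \<tau>..T}. x' t \<omega> = x t \<omega>))"

section \<open>Split-step backward Euler method\<close>

text \<open>All definitions of this section are pathwise: \<open>\<psi>\<close> and \<open>w\<close> are single paths, and
  \<open>y\<close>, \<open>ys\<close> are the sequences of the \<open>y\<^sub>n\<close> and of the intermediate values \<open>y\<^sub>n\<^sup>*\<close>.\<close>

datatype interpolation = Piecewise_Constant | Piecewise_Linear

text \<open>With \<open>s = t\<^sub>n - \<tau>(t\<^sub>n) \<ge> 0\<close> and \<open>k = n - q\<^sub>n\<close>, the condition
  \<open>s \<in> [t\<^sub>n\<^sub>-\<^sub>q, t\<^sub>n\<^sub>-\<^sub>q\<^sub>+\<^sub>1)\<close> says \<open>k = \<lfloor>s / h\<rfloor>\<close>; if \<open>\<tau>(t\<^sub>n) > 0\<close> then \<open>k < n\<close>, i.e. \<open>q\<^sub>n \<ge> 1\<close>.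
  In the linear case the weight solves \<open>s = (1 - \<mu>) k h + \<mu> (k + 1) h\<close>.
  For \<open>k + 1 = n\<close> the value depends on \<open>ys n\<close>, so the step is implicit in this argument as well.\<close>

definition interpolation_weight :: "interpolation \<Rightarrow> real \<Rightarrow> real \<Rightarrow> nat \<Rightarrow> real" where
  "interpolation_weight ip h s k =
     (case ip of Piecewise_Constant \<Rightarrow> 0 | Piecewise_Linear \<Rightarrow> (s - real k * h) / h)"

definition delayed_value ::
  "interpolation \<Rightarrow> (real \<Rightarrow> real) \<Rightarrow> (real \<Rightarrow> real ^ 'd) \<Rightarrow> real \<Rightarrow> (nat \<Rightarrow> real ^ 'd) \<Rightarrow> nat \<Rightarrow>
   real ^ 'd" where
  "delayed_value ip \<tau> \<psi> h ys n =
     (let s = real n * h - \<tau> (real n * h);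
          k = nat \<lfloor>s / h\<rfloor>;
          \<mu> = interpolation_weight ip h s k
      in if \<tau> (real n * h) = 0 then ys n
         else if s < 0 then \<psi> s
         else \<mu> *\<^sub>R ys (k + 1) + (1 - \<mu>) *\<^sub>R ys k)"

definition implicit_step ::
  "interpolation \<Rightarrow> (real ^ 'd \<Rightarrow> real ^ 'd \<Rightarrow> real ^ 'd) \<Rightarrow> (real \<Rightarrow> real) \<Rightarrow> (real \<Rightarrow> real ^ 'd) \<Rightarrow>
   real \<Rightarrow> (nat \<Rightarrow> real ^ 'd) \<Rightarrow> (nat \<Rightarrow> real ^ 'd) \<Rightarrow> nat \<Rightarrow> real ^ 'd \<Rightarrow> bool" where
  "implicit_step ip f \<tau> \<psi> h y ys n z \<longleftrightarrow>
     z = y n + h *\<^sub>R f z (delayed_value ip \<tau> \<psi> h (ys(n := z)) n)"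

definition ssbe_scheme ::
  "interpolation \<Rightarrow> (real ^ 'd \<Rightarrow> real ^ 'd \<Rightarrow> real ^ 'd) \<Rightarrow>
   (real ^ 'd \<Rightarrow> real ^ 'd \<Rightarrow> real ^ 'm ^ 'd) \<Rightarrow> (real \<Rightarrow> real) \<Rightarrow> (real \<Rightarrow> real ^ 'd) \<Rightarrow>
   (real \<Rightarrow> real ^ 'm) \<Rightarrow> real \<Rightarrow> (nat \<Rightarrow> real ^ 'd) \<Rightarrow> (nat \<Rightarrow> real ^ 'd) \<Rightarrow> bool" where
  "ssbe_scheme ip f g \<tau> \<psi> w h y ys \<longleftrightarrow>
     y 0 = \<psi> 0 \<and>
     (\<forall>n. implicit_step ip f \<tau> \<psi> h y ys n (ys n) \<and>
          y (Suc n) = ys n + g (ys n) (delayed_value ip \<tau> \<psi> h ys n) *v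
                             (w (real (Suc n) * h) - w (real n * h)))"

definition ssbe_continuous ::
  "interpolation \<Rightarrow> (real ^ 'd \<Rightarrow> real ^ 'd \<Rightarrow> real ^ 'd) \<Rightarrow>
   (real ^ 'd \<Rightarrow> real ^ 'd \<Rightarrow> real ^ 'm ^ 'd) \<Rightarrow> (real \<Rightarrow> real) \<Rightarrow> (real \<Rightarrow> real ^ 'd) \<Rightarrow>
   (real \<Rightarrow> real ^ 'm) \<Rightarrow> real \<Rightarrow> (nat \<Rightarrow> real ^ 'd) \<Rightarrow> (nat \<Rightarrow> real ^ 'd) \<Rightarrow> real \<Rightarrow> real ^ 'd" where
  "ssbe_continuous ip f g \<tau> \<psi> w h y ys t =
     (if t \<le> 0 then \<psi> t
      else let n = nat \<lfloor>t / h\<rfloor>; d = delayed_value ip \<tau> \<psi> h ys n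
           in y n + (t - real n * h) *\<^sub>R f (ys n) d + g (ys n) d *v (w t - w (real n * h)))"

end

theory Submission
  imports Defs
begin

text \<open>Because of the uniform \<open>p\<close>-th moments with \<open>p > 2\<close>, it suffices that
  \<open>sup |ybar - x|\<close> tends to \<open>0\<close> in probability. On the event that \<open>x\<close> stays in a ball, the
  grid error \<open>e\<^sub>n = y\<^sub>n - x(t\<^sub>n)\<close> satisfies \<open>e\<^sub>n = (\<Sum>j<n. h a\<^sub>j + b\<^sub>j \<Delta>w\<^sub>j) - r\<^sub>n\<close>. As long as the error
  has not left the unit ball, \<open>a\<^sub>j\<close> and \<open>b\<^sub>j\<close> are bounded by \<open>e\<^sub>j\<close> and the errors at the two grid points
  next to the delayed time, by the local Lipschitz condition; the residual \<open>r\<^sub>n\<close> is a Riemann-sum error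
  plus the distance between an Ito integral and an elementary integral. Stopping the recursion at the first step at
  which one of these bounds or \<open>|e\<^sub>n| \<le> \<epsilon>\<close> fails makes a discrete Gronwall argument
  in second moments applicable, and the stopped value dominates the maximal error, so that no
  maximal inequality beyond the isometry is needed. Between grid points the error is controlled pathwise,
  by the moduli of continuity of \<open>w\<close> and \<open>x\<close>.\<close>

text \<open>The definition of the Ito integral yields, for each fixed time, a random variable up to
  a null set. Stochastic integrals are therefore compared only at finitely many grid points, and
  what happens between them is left to the continuity of single paths. The number of grid points
  grows as \<open>h\<close> tends to 0, so every bound on stochastic sums must be free of that
  number. Stopping achieves this, and it is realised without stopping times: the coefficients are
  set to 0 from the first bad step on. No rate in \<open>h\<close> is extracted; statements that
  hold for all small \<open>h\<close>, with a threshold depending on the path, become statements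
  about probabilities by dominated convergence. The residual depends on \<open>x\<close> and
  \<open>w\<close> alone, so the feedback of the scheme enters only through the coefficient errors.
  The order of choices is fixed: the radius of the ball for \<open>x\<close>, then the Lipschitz
  constant on a slightly larger ball, then a tolerance \<kappa> for everything that vanishes with
  \<open>h\<close>, and \<open>h\<close> last.\<close>

lemma borel_measurable_vec_component [measurable (raw)]:
  fixes f :: "'a \<Rightarrow> 'b::real_normed_vector ^ 'n"
  assumes "f \<in> borel_measurable N"
  shows "(\<lambda>x. f x $ i) \<in> borel_measurable N"
  using measurable_compose[OF assms borel_measurable_continuous_onI[of "\<lambda>x. x $ i"]]
  by (simp add: continuous_on_component)

section \<open>Wiener increments: independence of the past and moments\<close>

locale wiener_basis = usual_stochastic_basis M F
  for M :: "'a measure" and F :: "real \<Rightarrow> 'a measure" +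
  fixes w :: "real \<Rightarrow> 'a \<Rightarrow> real ^ 'm"
  assumes wiener: "wiener_process M F w"
begin

lemma measurable_F_mono:
  assumes "X \<in> borel_measurable (F s)" "s \<le> t"
  shows "X \<in> borel_measurable (F t)"
  using assms sets_F_mono[OF assms(2)] space_F[of s] space_F[of t]
  by (auto intro: measurable_mono[THEN subsetD])

lemma measurable_F_M:
  assumes "X \<in> borel_measurable (F s)" "0 \<le> s"
  shows "X \<in> borel_measurable M"
  using assms sets_F_subset[OF assms(2)] space_F[of s]
  by (auto intro: measurable_mono[THEN subsetD])

lemma w_measurable: "0 \<le> s \<Longrightarrow> s \<le> t \<Longrightarrow> w s \<in> borel_measurable (F t)"
  using wiener measurable_F_mono unfolding wiener_process_def by blast

lemma w_measurable_M [measurable]: "0 \<le> s \<Longrightarrow> w s \<in> borel_measurable M"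
  using w_measurable[of s s] measurable_F_M by blast

text \<open>A Wiener process is defined through independence of sigma-algebras. \<open>Z\<close> and
  \<phi> of the increment generate smaller ones, and independence passes down to them. A general
  \<phi> serves both a coordinate of the increment and its square.\<close>

lemma indep_var_increment:
  assumes "0 \<le> s" "s < t" and Z: "Z \<in> borel_measurable (F s)"
    and \<phi>: "\<phi> \<in> borel_measurable borel"
  shows "indep_var borel (Z :: 'a \<Rightarrow> real) borel (\<lambda>\<omega>. \<phi> (w t \<omega> - w s \<omega>) :: real)"
proof -
  let ?D = "\<lambda>\<omega>. w t \<omega> - w s \<omega>"
  have mD: "?D \<in> borel_measurable M" using assms by auto
  have mZ: "Z \<in> borel_measurable M" using Z assms(1) by (rule measurable_F_M)
  have ind: "indep_set (sets (F s)) (sets (vimage_algebra (space M) ?D borel))"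
    using wiener assms unfolding wiener_process_def by blast
  show ?thesis
    unfolding indep_var_eq
  proof (intro conjI)
    show "Z \<in> borel_measurable M" by fact
    show "(\<lambda>\<omega>. \<phi> (?D \<omega>)) \<in> borel_measurable M" using mD \<phi> by measurable
    have A: "sigma_sets (space M) {Z -` A \<inter> space M |A. A \<in> sets borel} \<subseteq> sets (F s)"
      using sets.sigma_sets_subset[of "{Z -` A \<inter> space M |A. A \<in> sets borel}" "F s"]
        measurable_sets[OF Z] space_F[of s] by auto
    have B: "sigma_sets (space M) {(\<lambda>\<omega>. \<phi> (?D \<omega>)) -` A \<inter> space M |A. A \<in> sets borel}
        \<subseteq> sets (vimage_algebra (space M) ?D borel)" (is "sigma_sets _ ?C \<subseteq> sets ?V")
    proof -
      have "(\<lambda>\<omega>. \<phi> (?D \<omega>)) \<in> borel_measurable ?V"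
        using measurable_vimage_algebra1[of ?D "space M" borel] \<phi>
        by (auto intro: measurable_compose)
      then have "?C \<subseteq> sets ?V" using measurable_sets[of _ ?V borel] by auto
      then show ?thesis using sets.sigma_sets_subset[of ?C ?V] by simp
    qed
    show "indep_set (sigma_sets (space M) {Z -` A \<inter> space M |A. A \<in> sets borel})
      (sigma_sets (space M) {(\<lambda>\<omega>. \<phi> (?D \<omega>)) -` A \<inter> space M |A. A \<in> sets borel})"
      using ind A B unfolding indep_sets2_eq by (meson subset_eq)
  qed
qed

lemma increment_moments:
  assumes "0 \<le> s" "s < t"
  shows "integrable M (\<lambda>\<omega>. (w t \<omega> - w s \<omega>) $ l)" "expectation (\<lambda>\<omega>. (w t \<omega> - w s \<omega>) $ l) = 0"
    "integrable M (\<lambda>\<omega>. ((w t \<omega> - w s \<omega>) $ l)\<^sup>2)" "expectation (\<lambda>\<omega>. ((w t \<omega> - w s \<omega>) $ l)\<^sup>2) = t - s"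
proof -
  let ?D = "\<lambda>\<omega>. (w t \<omega> - w s \<omega>) $ l"
  have d: "distributed M lborel ?D (normal_density 0 (sqrt (t - s)))"
    using wiener assms unfolding wiener_process_def by blast
  have p: "0 < sqrt (t - s)" using assms by simp
  show "integrable M ?D"
    using distributed_integrable[OF d, of "\<lambda>x. x"] integrable_normal_moment_nz_1[OF p, of 0] by simp
  show e: "expectation ?D = 0" using normal_distributed_expectation[OF p d] by simp
  show "integrable M (\<lambda>\<omega>. (?D \<omega>)\<^sup>2)"
    using distributed_integrable[OF d, of "\<lambda>x. x\<^sup>2"] integrable_normal_moment[OF p, of 0 2] by simp
  show "expectation (\<lambda>\<omega>. (?D \<omega>)\<^sup>2) = t - s"
    using normal_distributed_variance[OF p d] e assms by simp
qed

text \<open>Orthogonality and variance, the two halves of the Ito isometry. Independence factors the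
  expectation, so integrability of \<open>Z\<close> is enough and \<open>Z\<close> may be
  unbounded.\<close>

lemma increment_mult:
  assumes "0 \<le> s" "s < t" and Z: "Z \<in> borel_measurable (F s)" "integrable M Z"
  shows "integrable M (\<lambda>\<omega>. Z \<omega> * (w t \<omega> - w s \<omega>) $ l)"
    "expectation (\<lambda>\<omega>. Z \<omega> * (w t \<omega> - w s \<omega>) $ l) = 0"
    "integrable M (\<lambda>\<omega>. Z \<omega> * ((w t \<omega> - w s \<omega>) $ l)\<^sup>2)"
    "expectation (\<lambda>\<omega>. Z \<omega> * ((w t \<omega> - w s \<omega>) $ l)\<^sup>2) = (t - s) * expectation Z"
proof -
  have i1: "indep_var borel Z borel (\<lambda>\<omega>. (w t \<omega> - w s \<omega>) $ l)"
    by (rule indep_var_increment[OF assms(1,2) Z(1), of "\<lambda>x. x $ l"]) measurable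
  have i2: "indep_var borel Z borel (\<lambda>\<omega>. ((w t \<omega> - w s \<omega>) $ l)\<^sup>2)"
    by (rule indep_var_increment[OF assms(1,2) Z(1), of "\<lambda>x. (x $ l)\<^sup>2"]) measurable
  note m = increment_moments[OF assms(1,2), of l]
  show "integrable M (\<lambda>\<omega>. Z \<omega> * (w t \<omega> - w s \<omega>) $ l)"
    by (rule indep_var_integrable[OF i1 Z(2) m(1)])
  show "expectation (\<lambda>\<omega>. Z \<omega> * (w t \<omega> - w s \<omega>) $ l) = 0"
    unfolding indep_var_lebesgue_integral[OF i1 Z(2) m(1)] m(2) by simp
  show "integrable M (\<lambda>\<omega>. Z \<omega> * ((w t \<omega> - w s \<omega>) $ l)\<^sup>2)"
    by (rule indep_var_integrable[OF i2 Z(2) m(3)])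
  show "expectation (\<lambda>\<omega>. Z \<omega> * ((w t \<omega> - w s \<omega>) $ l)\<^sup>2) = (t - s) * expectation Z"
    unfolding indep_var_lebesgue_integral[OF i2 Z(2) m(3)] m(4) by simp
qed

end

lemma borel_measurable_matrix_vector_mult [measurable (raw)]:
  assumes "A \<in> borel_measurable N" "v \<in> borel_measurable N"
  shows "(\<lambda>x. (A x :: real ^ 'm ^ 'd) *v (v x :: real ^ 'm)) \<in> borel_measurable N"
proof -
  have "continuous_on UNIV (\<lambda>z :: (real ^ 'm ^ 'd) \<times> (real ^ 'm). fst z *v snd z)"
    unfolding matrix_vector_mult_def by (intro continuous_intros)
  from borel_measurable_continuous_Pair[OF assms this] show ?thesis by simp
qed

text \<open>Cauchy-Schwarz in each row; summing the squares over the rows turns the row norms into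
  the Frobenius norm.\<close>

lemma norm_matrix_vector_mult_le:
  "norm ((A :: real ^ 'm ^ 'd) *v v) \<le> norm A * norm v"
proof -
  have "(norm (A *v v))\<^sup>2 = (\<Sum>i\<in>UNIV. ((A *v v) $ i)\<^sup>2)"
    by (simp only: power2_norm_eq_inner inner_vec_def) (simp add: power2_eq_square)
  also have "\<dots> \<le> (\<Sum>i\<in>UNIV. (norm (A $ i))\<^sup>2 * (norm v)\<^sup>2)"
  proof (rule sum_mono)
    fix i
    have "\<bar>(A *v v) $ i\<bar> \<le> norm (A $ i) * norm v"
      unfolding matrix_vector_mul_component by (rule Cauchy_Schwarz_ineq2)
    then show "((A *v v) $ i)\<^sup>2 \<le> (norm (A $ i))\<^sup>2 * (norm v)\<^sup>2"
      by (metis abs_le_square_iff abs_mult abs_norm_cancel power_mult_distrib)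
  qed
  also have "\<dots> = (norm A * norm v)\<^sup>2"
    by (simp add: norm_vec_def[of A] L2_set_def power_mult_distrib sum_distrib_right sum_nonneg)
  finally show ?thesis by (rule power2_le_imp_le) simp
qed

context wiener_basis
begin

abbreviation "second_moment X \<equiv> expectation (\<lambda>\<omega>. (norm (X \<omega>))\<^sup>2)"

text \<open>In the expanded square the cross term has mean 0, since \<open>U\<close> and \<beta> are
  known at time \<open>s\<close> and the increment is centred. The last square is bounded by the
  product of the squared norms of \<beta> and of the increment instead of being expanded. This
  avoids products of different coordinates of the increment, and the factor \<open>CARD('m)\<close>
  is the price.\<close>

lemma euler_step_second_moment:
  fixes U :: "'a \<Rightarrow> real ^ 'd" and \<beta> :: "'a \<Rightarrow> real ^ 'm ^ 'd" and s t B :: real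
  assumes st: "0 \<le> s" "s < t"
    and U: "U \<in> borel_measurable (F s)" "integrable M (\<lambda>\<omega>. (norm (U \<omega>))\<^sup>2)"
    and \<beta>: "\<beta> \<in> borel_measurable (F s)" "\<And>\<omega>. \<omega> \<in> space M \<Longrightarrow> norm (\<beta> \<omega>) \<le> B"
  defines "V \<equiv> \<lambda>\<omega>. U \<omega> + \<beta> \<omega> *v (w t \<omega> - w s \<omega>)"
  shows "V \<in> borel_measurable (F t)" "integrable M (\<lambda>\<omega>. (norm (V \<omega>))\<^sup>2)"
    "second_moment V
      \<le> second_moment U + CARD('m) * (t - s) * second_moment \<beta>"
proof -
  let ?D = "\<lambda>\<omega>. w t \<omega> - w s \<omega>"
  have mD: "?D \<in> borel_measurable (F t)" using w_measurable st by auto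
  show mV: "V \<in> borel_measurable (F t)"
    unfolding V_def using mD measurable_F_mono[OF U(1)] measurable_F_mono[OF \<beta>(1)] st by auto
  have mVM: "V \<in> borel_measurable M" using measurable_F_M[OF mV] st by simp
  have mU: "U \<in> borel_measurable M" using U(1) st by (intro measurable_F_M)
  have m\<beta>: "\<beta> \<in> borel_measurable M" using \<beta>(1) st by (intro measurable_F_M)
  have i\<beta>: "integrable M (\<lambda>\<omega>. (norm (\<beta> \<omega>))\<^sup>2)"
    using m\<beta> \<beta>(2) by (intro integrable_const_bound[where B = "B\<^sup>2"] AE_I2) (auto intro!: power_mono)
  have B0: "B \<ge> 0" using not_empty \<beta>(2) norm_ge_zero order_trans by (meson ex_in_conv)
  \<comment> \<open>Independence can only be applied once the products are integrable. A coordinate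
    of \<open>U\<close> is at most 1 plus the squared norm of \<open>U\<close>, and \<beta> is
    bounded by \<open>B\<close>, which does not enter the final estimate.\<close>
  have iUb: "integrable M (\<lambda>\<omega>. U \<omega> $ i * \<beta> \<omega> $ i $ l)" for i l
  proof (rule Bochner_Integration.integrable_bound[OF integrable_mult_right[OF Bochner_Integration.integrable_add[OF integrable_const[of 1] U(2)], of B]])
    show "AE x in M. norm (U x $ i * \<beta> x $ i $ l) \<le> norm (B * (1 + (norm (U x))\<^sup>2))"
    proof (rule AE_I2)
      fix x assume x: "x \<in> space M"
      have "\<bar>\<beta> x $ i $ l\<bar> \<le> B"
        using component_le_norm_cart[of "\<beta> x $ i" l] Finite_Cartesian_Product.norm_nth_le[of "\<beta> x" i] \<beta>(2)[OF x]
        by simp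
      moreover have "\<bar>U x $ i\<bar> \<le> 1 + (norm (U x))\<^sup>2"
        using component_le_norm_cart[of "U x" i]
        using zero_le_power2[of "norm (U x) - 1"] norm_ge_zero[of "U x"]
        unfolding power2_diff by simp
      ultimately show "norm (U x $ i * \<beta> x $ i $ l) \<le> norm (B * (1 + (norm (U x))\<^sup>2))"
        using B0 by (simp add: abs_mult mult.commute[of "\<bar>U x $ i\<bar>"] mult_mono)
    qed
  qed (use mU m\<beta> B0 U(2) in measurable)
  have mUb: "(\<lambda>\<omega>. U \<omega> $ i * \<beta> \<omega> $ i $ l) \<in> borel_measurable (F s)" for i l
    using U(1) \<beta>(1) by auto
  note cross = increment_mult[OF st mUb iUb]
  have inner_eq: "inner (U \<omega>) (\<beta> \<omega> *v ?D \<omega>) = (\<Sum>i\<in>UNIV. \<Sum>l\<in>UNIV. (U \<omega> $ i * \<beta> \<omega> $ i $ l) * ?D \<omega> $ l)" for \<omega>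
    by (simp add: inner_vec_def matrix_vector_mult_def sum_distrib_left mult.assoc)
  have ci: "integrable M (\<lambda>\<omega>. inner (U \<omega>) (\<beta> \<omega> *v ?D \<omega>))"
    unfolding inner_eq by (intro Bochner_Integration.integrable_sum cross)
  have ce: "expectation (\<lambda>\<omega>. inner (U \<omega>) (\<beta> \<omega> *v ?D \<omega>)) = 0"
    unfolding inner_eq
    by (subst Bochner_Integration.integral_sum, intro Bochner_Integration.integrable_sum cross)
       (intro sum.neutral ballI, subst Bochner_Integration.integral_sum, rule cross, simp only: cross, simp)
  have m\<beta>2: "(\<lambda>\<omega>. (norm (\<beta> \<omega>))\<^sup>2) \<in> borel_measurable (F s)" using \<beta>(1) by measurable
  note sq = increment_mult[OF st m\<beta>2 i\<beta>]
  define W where "W = (\<lambda>\<omega>. \<Sum>l\<in>UNIV. (norm (\<beta> \<omega>))\<^sup>2 * (?D \<omega> $ l)\<^sup>2)"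
  have iW: "integrable M W" unfolding W_def by (intro Bochner_Integration.integrable_sum sq)
  have eW: "expectation W = CARD('m) * (t - s) * second_moment \<beta>"
    unfolding W_def by (subst Bochner_Integration.integral_sum) (simp_all only: sq, simp)
  have nle: "(norm (\<beta> \<omega> *v ?D \<omega>))\<^sup>2 \<le> W \<omega>" for \<omega>
  proof -
    have "(norm (\<beta> \<omega> *v ?D \<omega>))\<^sup>2 \<le> (norm (\<beta> \<omega>) * norm (?D \<omega>))\<^sup>2"
      by (intro power_mono norm_matrix_vector_mult_le) simp
    also have "\<dots> = W \<omega>"
      unfolding W_def power_mult_distrib power2_norm_eq_inner[of "?D \<omega>"] inner_vec_def
      by (simp add: sum_distrib_left power2_eq_square)
    finally show ?thesis .
  qed
  have Vle: "(norm (V \<omega>))\<^sup>2 \<le> (norm (U \<omega>))\<^sup>2 + 2 * inner (U \<omega>) (\<beta> \<omega> *v ?D \<omega>) + W \<omega>" for \<omega>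
    using nle[of \<omega>] unfolding V_def power2_norm_eq_inner
    by (simp add: inner_add_left inner_add_right inner_commute)
  have iR: "integrable M (\<lambda>\<omega>. (norm (U \<omega>))\<^sup>2 + 2 * inner (U \<omega>) (\<beta> \<omega> *v ?D \<omega>) + W \<omega>)"
    by (intro Bochner_Integration.integrable_add integrable_mult_right U(2) ci iW)
  show iV: "integrable M (\<lambda>\<omega>. (norm (V \<omega>))\<^sup>2)"
    by (rule Bochner_Integration.integrable_bound[OF iR]) (use mVM Vle in \<open>auto intro!: AE_I2 order_trans[OF _ abs_ge_self]\<close>)
  have "second_moment V \<le> expectation (\<lambda>\<omega>. (norm (U \<omega>))\<^sup>2 + 2 * inner (U \<omega>) (\<beta> \<omega> *v ?D \<omega>) + W \<omega>)"
    by (intro integral_mono iV iR Vle)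
  also have "\<dots> = second_moment U + CARD('m) * (t - s) * second_moment \<beta>"
    using U(2) ci ce iW eW by simp
  finally show "second_moment V
      \<le> second_moment U + CARD('m) * (t - s) * second_moment \<beta>" .
qed

end

section \<open>Discrete stochastic integrals: second moments and a maximal inequality\<close>

lemma step_mono:
  fixes p :: "nat \<Rightarrow> real"
  assumes "\<And>i. i < N \<Longrightarrow> p i \<le> p (Suc i)" "i \<le> j" "j \<le> N"
  shows "p i \<le> p j"
  using assms(2,3)
proof (induction j)
  case (Suc j)
  then show ?case using assms(1)[of j] by (cases "i = Suc j") (auto intro: order_trans)
qed simp

context wiener_basis
begin

lemma measurable_F_sum:
  assumes "\<And>j. j < n \<Longrightarrow> f j \<in> borel_measurable (F s)"
  shows "(\<lambda>\<omega>. \<Sum>j<n. f j \<omega> :: 'b :: {second_countable_topology, real_normed_vector}) \<in> borel_measurable (F s)"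
  using assms by (intro borel_measurable_sum) auto

text \<open>Iterates \<open>euler_step_second_moment\<close> with the partial sum as
  \<open>U\<close>. The bounds \<open>B j\<close> may differ from step to step; they are purely
  qualitative and leave no trace in the estimate.\<close>

lemma martingale_transform_second_moment:
  fixes q :: "nat \<Rightarrow> real" and \<beta> :: "nat \<Rightarrow> 'a \<Rightarrow> real ^ 'm ^ 'd"
  assumes q: "0 \<le> q 0" "\<And>j. j < K \<Longrightarrow> q j < q (Suc j)"
    and \<beta>: "\<And>j. j < K \<Longrightarrow> \<beta> j \<in> borel_measurable (F (q j))"
      "\<And>j \<omega>. j < K \<Longrightarrow> \<omega> \<in> space M \<Longrightarrow> norm (\<beta> j \<omega>) \<le> B j"
    and "n \<le> K"
  defines "m \<equiv> \<lambda>n \<omega>. \<Sum>j<n. \<beta> j \<omega> *v (w (q (Suc j)) \<omega> - w (q j) \<omega>)"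
  shows "m n \<in> borel_measurable (F (q n))" "integrable M (\<lambda>\<omega>. (norm (m n \<omega>))\<^sup>2)"
    "second_moment (m n)
      \<le> CARD('m) * (\<Sum>j<n. (q (Suc j) - q j) * second_moment (\<beta> j))"
proof -
  have "m n \<in> borel_measurable (F (q n)) \<and> integrable M (\<lambda>\<omega>. (norm (m n \<omega>))\<^sup>2) \<and>
    second_moment (m n)
      \<le> CARD('m) * (\<Sum>j<n. (q (Suc j) - q j) * second_moment (\<beta> j))"
    using \<open>n \<le> K\<close>
  proof (induction n)
    case 0
    then show ?case by (simp add: m_def)
  next
    case (Suc n)
    then have n: "n < K" by simp
    have q0: "0 \<le> q n" using step_mono[of K q 0 n] q n by (fastforce intro: less_imp_le)
    have eq: "m (Suc n) = (\<lambda>\<omega>. m n \<omega> + \<beta> n \<omega> *v (w (q (Suc n)) \<omega> - w (q n) \<omega>))"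
      by (simp add: m_def fun_eq_iff)
    note st = euler_step_second_moment[OF q0 q(2)[OF n] _ _ \<beta>(1)[OF n] \<beta>(2)[OF n], of "m n"]
    have IH: "m n \<in> borel_measurable (F (q n))" "integrable M (\<lambda>\<omega>. (norm (m n \<omega>))\<^sup>2)"
      "second_moment (m n)
      \<le> CARD('m) * (\<Sum>j<n. (q (Suc j) - q j) * second_moment (\<beta> j))"
      using Suc by auto
    show ?case unfolding eq using st(1,2)[OF IH(1,2)] st(3)[OF IH(1,2)] IH(3)
      by (auto simp: algebra_simps)
  qed
  then show "m n \<in> borel_measurable (F (q n))" "integrable M (\<lambda>\<omega>. (norm (m n \<omega>))\<^sup>2)"
    "second_moment (m n)
      \<le> CARD('m) * (\<Sum>j<n. (q (Suc j) - q j) * second_moment (\<beta> j))"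
    by auto
qed

lemma prob_norm_le_second_moment:
  assumes "Y \<in> borel_measurable M" "integrable M (\<lambda>\<omega>. (norm (Y \<omega>))\<^sup>2)" "0 < \<epsilon>"
  shows "prob {\<omega> \<in> space M. \<epsilon> \<le> norm (Y \<omega> :: 'b :: {second_countable_topology, real_normed_vector})} \<le> second_moment Y / \<epsilon>\<^sup>2"
proof -
  have "prob {\<omega> \<in> space M. \<epsilon> \<le> norm (Y \<omega>)} = prob {\<omega> \<in> space M. \<epsilon>\<^sup>2 \<le> (norm (Y \<omega>))\<^sup>2}"
    using \<open>0 < \<epsilon>\<close> by (intro arg_cong[where f = prob] Collect_cong) (auto intro: power_mono dest: power2_le_imp_le)
  also have "\<dots> \<le> second_moment Y / \<epsilon>\<^sup>2"
    by (rule integral_Markov_inequality_measure[where A = "space M"]) (use assms in auto)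
  finally show ?thesis .
qed

text \<open>Truncating the integrand at the first time at which the bracket exceeds \<open>\<delta>\<close> or the
  transform exceeds \<open>\<epsilon>\<close> gives a maximal inequality without moment conditions.\<close>

lemma martingale_transform_maximal:
  fixes q :: "nat \<Rightarrow> real" and X :: "nat \<Rightarrow> 'a \<Rightarrow> real ^ 'm ^ 'd" and \<epsilon> \<delta> :: real
  assumes q: "0 \<le> q 0" "\<And>j. j < K \<Longrightarrow> q j < q (Suc j)"
    and X: "\<And>j. j < K \<Longrightarrow> X j \<in> borel_measurable (F (q j))"
    and "0 < \<epsilon>" "0 \<le> \<delta>"
  shows "prob {\<omega> \<in> space M. \<exists>n\<le>K. \<epsilon> < norm (\<Sum>j<n. X j \<omega> *v (w (q (Suc j)) \<omega> - w (q j) \<omega>))}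
    \<le> CARD('m) * \<delta> / \<epsilon>\<^sup>2 + prob {\<omega> \<in> space M. \<delta> < (\<Sum>j<K. (q (Suc j) - q j) * (norm (X j \<omega>))\<^sup>2)}"
proof -
  have qpos: "0 \<le> q j" if "j \<le> K" for j using step_mono[of K q 0 j] q that by (fastforce intro: less_imp_le)
  have qm: "q i \<le> q j" if "i \<le> j" "j \<le> K" for i j using step_mono[of K q i j] q(2) that by (simp add: less_imp_le)
  define S where "S = (\<lambda>n \<omega>. \<Sum>j<n. X j \<omega> *v (w (q (Suc j)) \<omega> - w (q j) \<omega>))"
  define V where "V = (\<lambda>n \<omega>. \<Sum>j<n. (q (Suc j) - q j) * (norm (X j \<omega>))\<^sup>2)"
  have mS: "S i \<in> borel_measurable (F (q n))" if "i \<le> n" "n \<le> K" for i n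
    unfolding S_def
  proof (rule measurable_F_sum)
    fix j assume j: "j < i"
    have "X j \<in> borel_measurable (F (q n))"
      using measurable_F_mono[OF X[of j] qm[of j n]] j that by simp
    moreover have "w (q (Suc j)) \<in> borel_measurable (F (q n))" "w (q j) \<in> borel_measurable (F (q n))"
      using w_measurable qpos qm j that by auto
    ultimately show "(\<lambda>\<omega>. X j \<omega> *v (w (q (Suc j)) \<omega> - w (q j) \<omega>)) \<in> borel_measurable (F (q n))"
      by measurable
  qed
  have mV: "V (Suc n) \<in> borel_measurable (F (q n))" if "n < K" for n
    unfolding V_def
  proof (rule measurable_F_sum)
    fix j assume j: "j < Suc n"
    have "X j \<in> borel_measurable (F (q n))"
      using measurable_F_mono[OF X[of j] qm[of j n]] j that by simp
    then show "(\<lambda>\<omega>. (q (Suc j) - q j) * (norm (X j \<omega>))\<^sup>2) \<in> borel_measurable (F (q n))"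
      by measurable
  qed
  \<comment> \<open>\<open>V (Suc j)\<close> involves the coefficients only up to
    \<open>X j\<close>, so it is already known at time \<open>q j\<close>. Testing it instead of
    \<open>V j\<close> keeps the truncated bracket below \<delta> even at the last step that is
    kept.\<close>
  define ok where "ok = (\<lambda>j \<omega>. V (Suc j) \<omega> \<le> \<delta> \<and> (\<forall>i\<in>{..j}. norm (S i \<omega>) \<le> \<epsilon>))"
  define \<beta> where "\<beta> = (\<lambda>j \<omega>. if ok j \<omega> then X j \<omega> else 0)"
  define m where "m = (\<lambda>n \<omega>. \<Sum>j<n. \<beta> j \<omega> *v (w (q (Suc j)) \<omega> - w (q j) \<omega>))"
  have m\<beta>: "\<beta> j \<in> borel_measurable (F (q j))" if "j < K" for j
  proof -
    note [measurable] = mV[OF that] X[OF that]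
    have [measurable]: "S i \<in> borel_measurable (F (q j))" if "i \<in> {..j}" for i using mS that \<open>j < K\<close> by simp
    show ?thesis unfolding \<beta>_def ok_def by measurable
  qed
  have dq: "0 < q (Suc j) - q j" if "j < K" for j using q(2) that by simp
  have Vmono: "V i \<omega> \<le> V j \<omega>" if "i \<le> j" "j \<le> K" for i j \<omega>
    unfolding V_def using that dq by (intro sum_mono2) (auto intro!: mult_nonneg_nonneg simp: less_imp_le)
  have Vb: "(\<Sum>j<n. (q (Suc j) - q j) * (norm (\<beta> j \<omega>))\<^sup>2) \<le> V n \<omega>" if "n \<le> K" for n \<omega>
    unfolding V_def \<beta>_def using that q(2) by (intro sum_mono) (auto simp: less_imp_le)
  have Vd: "(\<Sum>j<n. (q (Suc j) - q j) * (norm (\<beta> j \<omega>))\<^sup>2) \<le> \<delta>" if "n \<le> K" for n \<omega>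
    using that
  proof (induction n)
    case (Suc n)
    show ?case
    proof (cases "ok n \<omega>")
      case True
      then show ?thesis using Vb[OF Suc.prems, of \<omega>] by (simp add: ok_def)
    next
      case False
      then show ?thesis using Suc by (simp add: \<beta>_def)
    qed
  qed (use \<open>0 \<le> \<delta>\<close> in simp)
  \<comment> \<open>The truncation bounds the coefficients by itself: a single term of the bracket
    is at most \<delta>. This is how the second-moment lemma becomes applicable to an
    \<open>X\<close> without moments.\<close>
  have b\<beta>: "norm (\<beta> j \<omega>) \<le> sqrt (\<delta> / (q (Suc j) - q j))" if "j < K" for j \<omega>
  proof -
    have "(q (Suc j) - q j) * (norm (\<beta> j \<omega>))\<^sup>2 \<le> (\<Sum>j<Suc j. (q (Suc j) - q j) * (norm (\<beta> j \<omega>))\<^sup>2)"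
      using that q(2) by (auto intro!: sum_nonneg mult_nonneg_nonneg simp: less_imp_le)
    also have "\<dots> \<le> \<delta>" using Vd[of "Suc j"] that by simp
    finally show ?thesis using dq[OF that]
      by (intro real_le_rsqrt) (simp add: field_simps)
  qed
  have mom: "m K \<in> borel_measurable (F (q K))" "integrable M (\<lambda>\<omega>. (norm (m K \<omega>))\<^sup>2)"
    "second_moment (m K)
      \<le> CARD('m) * (\<Sum>j<K. (q (Suc j) - q j) * second_moment (\<beta> j))"
    unfolding m_def
    by (rule martingale_transform_second_moment[where \<beta> = \<beta> and n = K and K = K, OF q m\<beta> b\<beta> order_refl]; assumption)+
  have mK: "m K \<in> borel_measurable M" using mom(1) qpos[of K] by (simp add: measurable_F_M)
  have i\<beta>: "integrable M (\<lambda>\<omega>. (norm (\<beta> j \<omega>))\<^sup>2)" if "j < K" for j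
  proof -
    have [measurable]: "\<beta> j \<in> borel_measurable M"
      using measurable_F_M[OF m\<beta>[OF that] qpos] that by simp
    show ?thesis using b\<beta>[OF that]
      by (intro integrable_const_bound[where B = "(sqrt (\<delta> / (q (Suc j) - q j)))\<^sup>2"] AE_I2)
         (simp_all only: real_norm_def abs_power2 norm_ge_zero power_mono, measurable)
  qed
  have "(\<Sum>j<K. (q (Suc j) - q j) * second_moment (\<beta> j))
     = expectation (\<lambda>\<omega>. \<Sum>j<K. (q (Suc j) - q j) * (norm (\<beta> j \<omega>))\<^sup>2)"
    using i\<beta> by (subst Bochner_Integration.integral_sum) auto
  also have "\<dots> \<le> expectation (\<lambda>\<omega>. \<delta>)"
    using i\<beta> Vd by (intro integral_mono) auto
  finally have "second_moment (m K) \<le> CARD('m) * \<delta>"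
    using mom(3) by (simp add: prob_space) (meson order_trans mult_left_mono of_nat_0_le_iff)
  then have 1: "prob {\<omega> \<in> space M. \<epsilon> \<le> norm (m K \<omega>)} \<le> CARD('m) * \<delta> / \<epsilon>\<^sup>2"
    using prob_norm_le_second_moment[OF mK _ \<open>0 < \<epsilon>\<close>] mom(2)
    by (meson divide_right_mono order.refl order_trans zero_le_power2)
  have SM: "S i \<in> borel_measurable M" if "i \<le> K" for i
    using mS[OF that order_refl] qpos[of K] measurable_F_M by blast
  have XM: "X j \<in> borel_measurable M" if "j < K" for j
    using X[OF that] qpos[of j] that measurable_F_M by simp
  have VM: "V K \<in> borel_measurable M"
    unfolding V_def using XM by measurable
  have "{\<omega> \<in> space M. \<exists>n\<le>K. \<epsilon> < norm (S n \<omega>)} \<subseteq>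
    {\<omega> \<in> space M. \<epsilon> \<le> norm (m K \<omega>)} \<union> {\<omega> \<in> space M. \<delta> < V K \<omega>}"
  proof safe
    fix \<omega> n0 assume \<omega>: "\<omega> \<in> space M" "n0 \<le> K" "\<epsilon> < norm (S n0 \<omega>)" "\<not> \<delta> < V K \<omega>"
    define n where "n = (LEAST n. \<epsilon> < norm (S n \<omega>))"
    have n: "\<epsilon> < norm (S n \<omega>)" "n \<le> K"
      using LeastI[of "\<lambda>n. \<epsilon> < norm (S n \<omega>)", OF \<omega>(3)] Least_le[of "\<lambda>n. \<epsilon> < norm (S n \<omega>)", OF \<omega>(3)] \<omega>(2)
      by (auto simp: n_def)
    have before: "norm (S i \<omega>) \<le> \<epsilon>" if "i < n" for i
      using not_less_Least[of i "\<lambda>n. \<epsilon> < norm (S n \<omega>)"] that by (auto simp: n_def)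
    \<comment> \<open>As the whole bracket is at most \<delta>, only the size of \<open>S\<close>
      can switch the coefficients off. It does so exactly from the first exceedance \<open>n\<close>
      on, so the truncated sum freezes at the value \<open>S n\<close>.\<close>
    have "ok j \<omega>" if "j < n" for j
      using Vmono[of "Suc j" K \<omega>] before that \<omega>(4) n(2) by (auto simp: ok_def)
    moreover have "\<not> ok j \<omega>" if "n \<le> j" for j
      using n(1) that by (auto simp: ok_def not_le)
    ultimately have "m K \<omega> = (\<Sum>j\<in>{..<K} \<inter> {..<n}. X j \<omega> *v (w (q (Suc j)) \<omega> - w (q j) \<omega>))"
      unfolding m_def \<beta>_def
      by (subst sum.inter_restrict) (auto intro!: sum.cong simp: not_less)
    also have "{..<K} \<inter> {..<n} = {..<n}" using n(2) by auto
    finally have "m K \<omega> = S n \<omega>" by (simp add: S_def)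
    then show "\<epsilon> \<le> norm (m K \<omega>)" using n(1) by simp
  qed
  then have "prob {\<omega> \<in> space M. \<exists>n\<le>K. \<epsilon> < norm (S n \<omega>)} \<le>
    prob ({\<omega> \<in> space M. \<epsilon> \<le> norm (m K \<omega>)} \<union> {\<omega> \<in> space M. \<delta> < V K \<omega>})"
    using mK VM by (intro finite_measure_mono) auto
  also have "\<dots> \<le> prob {\<omega> \<in> space M. \<epsilon> \<le> norm (m K \<omega>)} + prob {\<omega> \<in> space M. \<delta> < V K \<omega>}"
    using mK VM by (intro measure_Un_le) auto
  finally show ?thesis using 1 unfolding S_def V_def by linarith
qed

end

section \<open>Elementary integrals\<close>

text \<open>Cutting the partition points at \<open>t\<close> makes the elementary integral a process
  in \<open>t\<close> over one fixed partition: increments beyond \<open>t\<close> vanish, and the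
  interval containing \<open>t\<close> is shortened.\<close>

definition elem_integral ::
  "(real \<Rightarrow> 'a \<Rightarrow> real ^ 'm) \<Rightarrow> nat \<Rightarrow> (nat \<Rightarrow> real) \<Rightarrow> (nat \<Rightarrow> 'a \<Rightarrow> real ^ 'm ^ 'd) \<Rightarrow> real \<Rightarrow>
   'a \<Rightarrow> real ^ 'd" where
  "elem_integral w N p \<xi> t \<omega> =
     (\<Sum>i<N. \<xi> i \<omega> *v (w (min (p (Suc i)) t) \<omega> - w (min (p i) t) \<omega>))"

definition adapted_step ::
  "(real \<Rightarrow> 'a measure) \<Rightarrow> nat \<Rightarrow> (nat \<Rightarrow> real) \<Rightarrow> (nat \<Rightarrow> 'a \<Rightarrow> real ^ 'm ^ 'd) \<Rightarrow> bool" where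
  "adapted_step F N p \<xi> \<longleftrightarrow>
     0 \<le> p 0 \<and> (\<forall>i<N. p i \<le> p (Suc i) \<and> \<xi> i \<in> borel_measurable (F (p i)))"

definition sq_dist ::
  "real \<Rightarrow> (real \<Rightarrow> 'a \<Rightarrow> 'b :: real_normed_vector) \<Rightarrow> (real \<Rightarrow> 'a \<Rightarrow> 'b) \<Rightarrow> 'a \<Rightarrow> ennreal" where
  "sq_dist T X Y \<omega> = (\<integral>\<^sup>+s\<in>{0..T}. ennreal ((norm (X s \<omega> - Y s \<omega>))\<^sup>2) \<partial>lborel)"

lemma elem_integral_end:
  assumes "\<And>i. i < N \<Longrightarrow> p i \<le> p (Suc i)" "p N = t"
  shows "elem_integral w N p \<xi> t \<omega> = step_integral w N p \<xi> \<omega>"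
proof -
  have "p i \<le> t" if "i \<le> N" for i using step_mono[of N p i N] assms that by auto
  then show ?thesis unfolding elem_integral_def step_integral_def
    by (intro sum.cong) (auto simp: min_def)
qed

text \<open>Used to enumerate the common refinement of two partitions, on which both step processes
  are discrete transforms over the same increments.\<close>

lemma finite_set_grid:
  fixes Q :: "real set"
  assumes "finite Q" "Q \<noteq> {}"
  obtains q :: "nat \<Rightarrow> real" and K where "\<And>j. j < K \<Longrightarrow> q j < q (Suc j)" "q ` {..K} = Q"
proof -
  define xs where "xs = sorted_list_of_set Q"
  have xs: "set xs = Q" "sorted_wrt (<) xs" "length xs = card Q" using assms by (auto simp: xs_def)
  have c: "0 < card Q" using assms by (simp add: card_gt_0_iff)
  have eq: "{..card Q - 1} = {0..<length xs}" using c xs(3) by auto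
  show ?thesis
  proof (rule that[of "card Q - 1" "nth xs"])
    show "xs ! j < xs ! Suc j" if "j < card Q - 1" for j
      using sorted_wrt_nth_less[OF xs(2), of j "Suc j"] that xs(3) by simp
    show "(!) xs ` {..card Q - 1} = Q" unfolding eq using nth_image[of "length xs" xs] xs(1) by simp
  qed
qed

lemma grid_strict_mono:
  fixes q :: "nat \<Rightarrow> real"
  assumes "\<And>j. j < K \<Longrightarrow> q j < q (Suc j)" "i < j" "j \<le> K"
  shows "q i < q j"
proof -
  have "q i < q (Suc i)" using assms by simp
  also have "\<dots> \<le> q j" using step_mono[of K q "Suc i" j] assms by (simp add: less_imp_le)
  finally show ?thesis .
qed

lemma grid_le_iff:
  fixes q :: "nat \<Rightarrow> real"
  assumes "\<And>j. j < K \<Longrightarrow> q j < q (Suc j)" "i \<le> K" "j \<le> K"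
  shows "q i \<le> q j \<longleftrightarrow> i \<le> j"
  using grid_strict_mono[of K q i j] grid_strict_mono[of K q j i] assms by (cases i j rule: linorder_cases) auto

lemma matrix_vector_mult_sum_scaleR:
  "(\<Sum>i<N. c i *\<^sub>R (A i :: real ^ 'm ^ 'd)) *v v = (\<Sum>i<(N::nat). A i *v (c i *\<^sub>R v))"
  by (induction N)
     (simp_all add: matrix_vector_mult_add_rdistrib scaleR_matrix_vector_assoc[symmetric] matrix_vector_mult_scaleR)

lemma matrix_vector_mult_sum_right:
  "(\<Sum>j\<in>S. (A :: real ^ 'm ^ 'd) *v v j) = A *v (\<Sum>j\<in>S. v j)"
  by (induction S rule: infinite_finite_induct) (simp_all add: matrix_vector_right_distrib)

text \<open>Each interval of the coarse partition is a union of cells of \<open>q\<close>, and the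
  increments of \<open>w\<close> over these cells telescope. All comparisons of times are translated
  into comparisons of indices, which is possible because \<open>q\<close> is strictly
  increasing.\<close>

lemma elem_integral_refine:
  assumes q: "\<And>j. j < K \<Longrightarrow> q j < q (Suc j)" and p: "\<And>i. i < N \<Longrightarrow> p i \<le> p (Suc i)"
    and pq: "\<And>i. i \<le> N \<Longrightarrow> p i \<in> q ` {..K}" and a: "a \<le> K"
  shows "elem_integral w N p \<xi> (q a) \<omega> =
    (\<Sum>j<a. step_process N p \<xi> (q j) \<omega> *v (w (q (Suc j)) \<omega> - w (q j) \<omega>))"
proof -
  let ?D = "\<lambda>j. w (q (Suc j)) \<omega> - w (q j) \<omega>"
  have "(\<Sum>j<a. step_process N p \<xi> (q j) \<omega> *v ?D j)
    = (\<Sum>i<N. \<Sum>j<a. \<xi> i \<omega> *v (indicator {p i..<p (Suc i)} (q j) *\<^sub>R ?D j))"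
    unfolding step_process_def matrix_vector_mult_sum_scaleR by (rule sum.swap)
  also have "\<dots> = elem_integral w N p \<xi> (q a) \<omega>"
    unfolding elem_integral_def
  proof (rule sum.cong[OF refl])
    fix i assume "i \<in> {..<N}"
    then have i: "i < N" by simp
    obtain b where b: "b \<le> K" "p i = q b" using pq[of i] i by auto
    obtain c where c: "c \<le> K" "p (Suc i) = q c" using pq[of "Suc i"] i by auto
    have bc: "b \<le> c" using p[OF i] b c grid_le_iff[of K q b c] q by simp
    have mn: "min (q d) (q a) = q (min d a)" if "d \<le> K" for d
      using grid_le_iff[of K q d a] grid_le_iff[of K q a d] q a that by (auto simp: min_def)
    have "(\<Sum>j<a. indicator {p i..<p (Suc i)} (q j) *\<^sub>R ?D j) = (\<Sum>j\<in>{min b a..<min c a}. ?D j)"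
    proof -
      have "(\<Sum>j<a. indicator {p i..<p (Suc i)} (q j) *\<^sub>R ?D j) = (\<Sum>j<a. if j \<in> {b..<c} then ?D j else 0)"
      proof (rule sum.cong[OF refl])
        fix j assume "j \<in> {..<a}"
        then have "j \<le> K" using a by simp
        then show "indicator {p i..<p (Suc i)} (q j) *\<^sub>R ?D j = (if j \<in> {b..<c} then ?D j else 0)"
          using grid_le_iff[of K q b j] grid_le_iff[of K q c j] q b c by (auto simp: indicator_def not_le)
      qed
      also have "\<dots> = (\<Sum>j\<in>{..<a} \<inter> {b..<c}. ?D j)" by (simp add: sum.inter_restrict)
      also have "{..<a} \<inter> {b..<c} = {min b a..<min c a}" by auto
      finally show ?thesis .
    qed
    also have "\<dots> = w (q (min c a)) \<omega> - w (q (min b a)) \<omega>"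
      using bc by (intro sum_Suc_diff'[of "min b a" "min c a" "\<lambda>j. w (q j) \<omega>"]) auto
    finally show "(\<Sum>j<a. \<xi> i \<omega> *v (indicator {p i..<p (Suc i)} (q j) *\<^sub>R ?D j)) =
      \<xi> i \<omega> *v (w (min (p (Suc i)) (q a)) \<omega> - w (min (p i) (q a)) \<omega>)"
      unfolding matrix_vector_mult_sum_right b(2) c(2) mn[OF b(1)] mn[OF c(1)] by simp
  qed
  finally show ?thesis by simp
qed

text \<open>No partition point lies in the interior of a cell, so for \<open>s\<close> in the cell
  the conditions \<open>p i \<le> s\<close> and \<open>p i \<le> q j\<close> are equivalent.\<close>

lemma step_process_refine_const:
  assumes q: "\<And>j. j < K \<Longrightarrow> q j < q (Suc j)"
    and pq: "\<And>i. i \<le> N \<Longrightarrow> p i \<in> q ` {..K}" and j: "j < K" and s: "s \<in> {q j..<q (Suc j)}"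
  shows "step_process N p \<xi> s \<omega> = step_process N p \<xi> (q j) \<omega>"
proof -
  have *: "p i \<le> s \<longleftrightarrow> p i \<le> q j" if "i \<le> N" for i
  proof -
    from pq[OF that] obtain b where b: "b \<le> K" "p i = q b" by auto
    have "b < Suc j" if "q b \<le> s"
      using that s grid_le_iff[of K q "Suc j" b] q b j by fastforce
    then show ?thesis using grid_le_iff[of K q b j] q b j s by (fastforce simp: less_Suc_eq_le)
  qed
  show ?thesis unfolding step_process_def
    by (intro sum.cong arg_cong2[where f = scaleR] refl)
       (use *[OF less_imp_le] *[OF Suc_leI] in \<open>auto simp: indicator_def not_le[symmetric]\<close>)
qed

lemma sum_grid_le_nn_integral:
  fixes X :: "real \<Rightarrow> 'b :: real_normed_vector"
  assumes q: "\<And>j. j < K \<Longrightarrow> q j < q (Suc j)"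
    and X: "\<And>j s. j < K \<Longrightarrow> s \<in> {q j..<q (Suc j)} \<Longrightarrow> X s = X (q j)"
  shows "ennreal (\<Sum>j<K. (q (Suc j) - q j) * (norm (X (q j)))\<^sup>2)
    \<le> (\<integral>\<^sup>+s\<in>{q 0..q K}. ennreal ((norm (X s))\<^sup>2) \<partial>lborel)"
proof -
  have ind: "(\<Sum>j<n. indicator {q j..<q (Suc j)} s) = (indicator {q 0..<q n} s :: ennreal)" if "n \<le> K" for n s
    using that
  proof (induction n)
    case (Suc n)
    have "q 0 \<le> q n" "q n < q (Suc n)" using grid_le_iff[of K q 0 n] q Suc by auto
    with Suc show ?case by (auto simp: indicator_def)
  qed simp
  have "ennreal (\<Sum>j<K. (q (Suc j) - q j) * (norm (X (q j)))\<^sup>2)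
    = (\<Sum>j<K. ennreal ((q (Suc j) - q j) * (norm (X (q j)))\<^sup>2))"
    using q by (intro sum_ennreal[symmetric]) (auto simp: less_imp_le)
  also have "\<dots> = (\<Sum>j<K. \<integral>\<^sup>+s. ennreal ((norm (X (q j)))\<^sup>2) * indicator {q j..<q (Suc j)} s \<partial>lborel)"
    using q by (intro sum.cong refl)
      (subst nn_integral_cmult_indicator, auto simp: ennreal_mult less_imp_le mult.commute)
  also have "\<dots> = (\<integral>\<^sup>+s. (\<Sum>j<K. ennreal ((norm (X (q j)))\<^sup>2) * indicator {q j..<q (Suc j)} s) \<partial>lborel)"
    by (intro nn_integral_sum[symmetric]) auto
  also have "\<dots> \<le> (\<integral>\<^sup>+s\<in>{q 0..q K}. ennreal ((norm (X s))\<^sup>2) \<partial>lborel)"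
  proof (rule nn_integral_mono)
    fix s
    have "(\<Sum>j<K. ennreal ((norm (X (q j)))\<^sup>2) * indicator {q j..<q (Suc j)} s)
      = (\<Sum>j<K. ennreal ((norm (X s))\<^sup>2) * indicator {q j..<q (Suc j)} s)"
      by (intro sum.cong refl) (metis X indicator_simps(2) lessThan_iff mult_zero_right)
    also have "\<dots> = ennreal ((norm (X s))\<^sup>2) * indicator {q 0..<q K} s"
      unfolding sum_distrib_left[symmetric] by (simp add: ind)
    also have "\<dots> \<le> ennreal ((norm (X s))\<^sup>2) * indicator {q 0..q K} s"
      by (auto simp: indicator_def)
    finally show "(\<Sum>j<K. ennreal ((norm (X (q j)))\<^sup>2) * indicator {q j..<q (Suc j)} s)
      \<le> ennreal ((norm (X s))\<^sup>2) * indicator {q 0..q K} s" .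
  qed
  finally show ?thesis .
qed

section \<open>Joint measurability and the square distance of integrands in time\<close>

lemma measurable_restrict_space_pair:
  assumes "(\<lambda>(s, \<omega>). X s \<omega>) \<in> borel_measurable (borel \<Otimes>\<^sub>M M)"
  shows "(\<lambda>(s, \<omega>). X s \<omega>) \<in> borel_measurable (restrict_space borel S \<Otimes>\<^sub>M M)"
proof -
  have "(\<lambda>z. (fst z, snd z)) \<in> measurable (restrict_space borel S \<Otimes>\<^sub>M M) (borel \<Otimes>\<^sub>M M)"
    by (intro measurable_Pair measurable_snd measurable_compose[OF measurable_fst]
        measurable_restrict_space1) simp
  from measurable_compose[OF this assms] show ?thesis by simp
qed

context wiener_basis
begin

definition jointly :: "real \<Rightarrow> (real \<Rightarrow> 'a \<Rightarrow> real ^ 'm ^ 'd) \<Rightarrow> bool" where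
  "jointly T X \<longleftrightarrow> (\<lambda>(s, \<omega>). X s \<omega>) \<in> borel_measurable (restrict_space borel {0..T} \<Otimes>\<^sub>M M)"

lemma jointly_diff_measurable:
  fixes X Y :: "real \<Rightarrow> 'a \<Rightarrow> real ^ 'm ^ 'd"
  assumes "jointly T X" "jointly T Y"
  shows "(\<lambda>(\<omega>, s). ennreal ((norm (X s \<omega> - Y s \<omega>))\<^sup>2))
    \<in> borel_measurable (M \<Otimes>\<^sub>M restrict_space lborel {0..T})"
proof -
  have s: "sets (M \<Otimes>\<^sub>M restrict_space lborel {0..T}) = sets (M \<Otimes>\<^sub>M restrict_space borel {0..T})"
    by (intro sets_pair_measure_cong refl sets_restrict_space_cong) simp
  note A = assms[unfolded jointly_def]
  have "(\<lambda>z. ennreal ((norm ((\<lambda>(s, \<omega>). X s \<omega>) z - (\<lambda>(s, \<omega>). Y s \<omega>) z))\<^sup>2))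
    \<in> borel_measurable (restrict_space borel {0..T} \<Otimes>\<^sub>M M)"
    using A by measurable
  then have "(\<lambda>(s, \<omega>). ennreal ((norm (X s \<omega> - Y s \<omega>))\<^sup>2)) \<in> borel_measurable (restrict_space borel {0..T} \<Otimes>\<^sub>M M)"
    by (simp add: case_prod_beta)
  from measurable_pair_swap[OF this] show ?thesis
    unfolding measurable_cong_sets[OF s refl] by (simp add: case_prod_beta)
qed

lemma sq_dist_alt:
  "sq_dist T X Y \<omega> = (\<integral>\<^sup>+s. ennreal ((norm (X s \<omega> - Y s \<omega>))\<^sup>2) \<partial>restrict_space lborel {0..T})"
  unfolding sq_dist_def by (simp add: nn_integral_restrict_space)

lemma sigma_finite_restrict: "sigma_finite_measure (restrict_space lborel {0..T :: real})"
proof -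
  have "finite_measure (restrict_space lborel {0..T})"
    by (intro finite_measureI) (simp add: emeasure_restrict_space space_restrict_space emeasure_lborel_Icc_eq)
  then show ?thesis by (simp add: finite_measure_def)
qed

lemma sq_dist_measurable:
  fixes X Y :: "real \<Rightarrow> 'a \<Rightarrow> real ^ 'm ^ 'd"
  assumes "jointly T X" "jointly T Y"
  shows "sq_dist T X Y \<in> borel_measurable M"
proof -
  have "(\<lambda>\<omega>. \<integral>\<^sup>+s. ennreal ((norm (X s \<omega> - Y s \<omega>))\<^sup>2) \<partial>restrict_space lborel {0..T}) \<in> borel_measurable M"
    by (rule sigma_finite_measure.borel_measurable_nn_integral[OF sigma_finite_restrict jointly_diff_measurable[OF assms]])
  then show ?thesis by (simp add: sq_dist_alt[abs_def])
qed

lemma norm_diff_sq_le: "(norm (a - b))\<^sup>2 \<le> 2 * (norm (a - c))\<^sup>2 + 2 * (norm (b - c :: 'b :: real_normed_vector))\<^sup>2"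
proof -
  have "norm (a - b) \<le> norm (a - c) + norm (b - c)" using norm_triangle_ineq4[of "a - c" "b - c"] by simp
  then have "(norm (a - b))\<^sup>2 \<le> (norm (a - c) + norm (b - c))\<^sup>2" by (intro power_mono) auto
  also have "\<dots> \<le> 2 * (norm (a - c))\<^sup>2 + 2 * (norm (b - c))\<^sup>2"
    using zero_le_power2[of "norm (a - c) - norm (b - c)"] by (simp add: power2_sum power2_diff)
  finally show ?thesis .
qed

lemma sq_dist_triangle:
  fixes X Y Z :: "real \<Rightarrow> 'a \<Rightarrow> real ^ 'm ^ 'd"
  assumes "jointly T X" "jointly T Y" "jointly T Z" "\<omega> \<in> space M"
  shows "sq_dist T X Y \<omega> \<le> 2 * sq_dist T X Z \<omega> + 2 * sq_dist T Y Z \<omega>"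
proof -
  have m: "(\<lambda>s. ennreal ((norm (A s \<omega> - B s \<omega>))\<^sup>2)) \<in> borel_measurable (restrict_space lborel {0..T})"
    if "jointly T A" "jointly T B" for A B :: "real \<Rightarrow> 'a \<Rightarrow> real ^ 'm ^ 'd"
    using measurable_compose[OF measurable_Pair1'[OF assms(4)] jointly_diff_measurable[OF that]] by simp
  have "sq_dist T X Y \<omega> \<le> (\<integral>\<^sup>+s. 2 * ennreal ((norm (X s \<omega> - Z s \<omega>))\<^sup>2) + 2 * ennreal ((norm (Y s \<omega> - Z s \<omega>))\<^sup>2) \<partial>restrict_space lborel {0..T})"
    unfolding sq_dist_alt
  proof (rule nn_integral_mono)
    fix s
    have "ennreal ((norm (X s \<omega> - Y s \<omega>))\<^sup>2) \<le> ennreal (2 * (norm (X s \<omega> - Z s \<omega>))\<^sup>2 + 2 * (norm (Y s \<omega> - Z s \<omega>))\<^sup>2)"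
      by (intro ennreal_leI norm_diff_sq_le)
    then show "ennreal ((norm (X s \<omega> - Y s \<omega>))\<^sup>2) \<le> 2 * ennreal ((norm (X s \<omega> - Z s \<omega>))\<^sup>2) + 2 * ennreal ((norm (Y s \<omega> - Z s \<omega>))\<^sup>2)"
      by (simp add: ennreal_plus ennreal_mult)
  qed
  also have "\<dots> = 2 * sq_dist T X Z \<omega> + 2 * sq_dist T Y Z \<omega>"
    unfolding sq_dist_alt
    by (subst nn_integral_add) (use m[OF assms(1,3)] m[OF assms(2,3)] in \<open>simp_all add: nn_integral_cmult\<close>)
  finally show ?thesis .
qed

lemma sq_dist_mono: "t \<le> T \<Longrightarrow> sq_dist t X Y \<omega> \<le> sq_dist T X Y \<omega>"
  unfolding sq_dist_def by (intro nn_integral_mono) (auto simp: indicator_def)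

text \<open>\<open>sq_dist\<close> is the square of a metric, so its triangle inequality carries a
  factor 2 on each term; hence \<delta>/4 on the right.\<close>

lemma prob_sq_dist_triangle:
  fixes X Y Z :: "real \<Rightarrow> 'a \<Rightarrow> real ^ 'm ^ 'd"
  assumes "jointly T X" "jointly T Y" "jointly T Z" "0 < \<delta>"
  shows "prob {\<omega> \<in> space M. ennreal \<delta> < sq_dist T X Y \<omega>}
    \<le> prob {\<omega> \<in> space M. ennreal (\<delta> / 4) < sq_dist T X Z \<omega>} + prob {\<omega> \<in> space M. ennreal (\<delta> / 4) < sq_dist T Y Z \<omega>}"
    (is "prob ?A \<le> prob ?B + prob ?C")
proof -
  note [measurable] = sq_dist_measurable[OF assms(1,2)] sq_dist_measurable[OF assms(1,3)] sq_dist_measurable[OF assms(2,3)]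
  have "prob ?A \<le> prob (?B \<union> ?C)"
  proof (intro finite_measure_mono subsetI)
    fix \<omega> assume \<omega>: "\<omega> \<in> ?A"
    show "\<omega> \<in> ?B \<union> ?C"
    proof (rule ccontr)
      assume "\<not> ?thesis"
      then have *: "sq_dist T X Z \<omega> \<le> ennreal (\<delta> / 4)" "sq_dist T Y Z \<omega> \<le> ennreal (\<delta> / 4)"
        using \<omega> by (auto simp: not_less)
      have "sq_dist T X Y \<omega> \<le> 2 * sq_dist T X Z \<omega> + 2 * sq_dist T Y Z \<omega>"
        using sq_dist_triangle[OF assms(1,2,3)] \<omega> by simp
      also have "\<dots> \<le> 2 * ennreal (\<delta> / 4) + 2 * ennreal (\<delta> / 4)"
        by (intro add_mono mult_left_mono *) auto
      also have "\<dots> = ennreal \<delta>"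
        using \<open>0 < \<delta>\<close> ennreal_mult'[of 2 "\<delta> / 4"] ennreal_plus[of "\<delta> / 2" "\<delta> / 2"] by simp
      finally show False using \<omega> by (simp add: not_less[symmetric])
    qed
  qed measurable
  also have "\<dots> \<le> prob ?B + prob ?C"
    by (intro measure_Un_le) measurable
  finally show ?thesis .
qed

lemma adapted_step_nonneg:
  assumes "adapted_step F N p \<xi>" "i \<le> N"
  shows "0 \<le> p i"
  using step_mono[of N p 0 i] assms unfolding adapted_step_def by fastforce

lemma step_process_adapted:
  fixes \<xi> :: "nat \<Rightarrow> 'a \<Rightarrow> real ^ 'm ^ 'd"
  assumes "adapted_step F N p \<xi>"
  shows "step_process N p \<xi> s \<in> borel_measurable (F s)"
proof -
  have "(\<lambda>\<omega>. \<Sum>i<N. indicator {p i..<p (Suc i)} s *\<^sub>R \<xi> i \<omega>) \<in> borel_measurable (F s)"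
  proof (rule measurable_F_sum)
    fix i assume i: "i < N"
    show "(\<lambda>\<omega>. indicator {p i..<p (Suc i)} s *\<^sub>R \<xi> i \<omega>) \<in> borel_measurable (F s)"
    proof (cases "p i \<le> s")
      case True
      have "\<xi> i \<in> borel_measurable (F s)"
        using assms i True unfolding adapted_step_def by (blast intro: measurable_F_mono)
      then show ?thesis by measurable
    qed simp
  qed
  then show ?thesis by (simp add: step_process_def[abs_def])
qed

lemma jointly_step_process:
  fixes \<xi> :: "nat \<Rightarrow> 'a \<Rightarrow> real ^ 'm ^ 'd"
  assumes "adapted_step F N p \<xi>"
  shows "jointly T (step_process N p \<xi>)"
  unfolding jointly_def
proof (rule measurable_restrict_space_pair)
  have [measurable]: "\<xi> i \<in> borel_measurable M" if "i < N" for i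
    using assms adapted_step_nonneg[OF assms, of i] that measurable_F_M unfolding adapted_step_def by auto
  have "(\<lambda>z. \<Sum>i<N. indicator {p i..<p (Suc i)} (fst z) *\<^sub>R \<xi> i (snd z)) \<in> borel_measurable (borel \<Otimes>\<^sub>M M)"
    by (intro borel_measurable_sum) measurable
  then show "(\<lambda>(s, \<omega>). step_process N p \<xi> s \<omega>) \<in> borel_measurable (borel \<Otimes>\<^sub>M M)"
    by (simp add: step_process_def case_prod_beta)
qed

lemma elem_integral_measurable:
  fixes \<xi> :: "nat \<Rightarrow> 'a \<Rightarrow> real ^ 'm ^ 'd"
  assumes "adapted_step F N p \<xi>" "0 \<le> t"
  shows "elem_integral w N p \<xi> t \<in> borel_measurable M"
proof -
  have [measurable]: "\<xi> i \<in> borel_measurable M" "w (min (p (Suc i)) t) \<in> borel_measurable M"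
    "w (min (p i) t) \<in> borel_measurable M" if "i \<in> {..<N}" for i
    using assms adapted_step_nonneg[OF assms(1), of i] adapted_step_nonneg[OF assms(1), of "Suc i"]
      that measurable_F_M w_measurable_M unfolding adapted_step_def by auto
  show ?thesis unfolding elem_integral_def[abs_def] by (intro borel_measurable_sum) measurable
qed

text \<open>On a common refinement containing \<open>P\<close>, the difference of the two integrals
  is one discrete transform, and its bracket is at most \<open>sq_dist\<close>. The maximal
  inequality then gives a bound that does not depend on the number of points of
  \<open>P\<close>.\<close>

lemma elem_integral_diff_maximal:
  fixes \<xi>1 \<xi>2 :: "nat \<Rightarrow> 'a \<Rightarrow> real ^ 'm ^ 'd" and \<epsilon> \<delta> T :: real
  assumes A1: "adapted_step F N1 p1 \<xi>1" and A2: "adapted_step F N2 p2 \<xi>2"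
    and P: "finite P" "P \<subseteq> {0..T}" and T: "0 \<le> T" and "0 < \<epsilon>" "0 < \<delta>"
  shows "prob {\<omega> \<in> space M. \<exists>t\<in>P. \<epsilon> < norm (elem_integral w N1 p1 \<xi>1 t \<omega> - elem_integral w N2 p2 \<xi>2 t \<omega>)}
    \<le> CARD('m) * \<delta> / \<epsilon>\<^sup>2 +
      prob {\<omega> \<in> space M. ennreal \<delta> < sq_dist T (step_process N1 p1 \<xi>1) (step_process N2 p2 \<xi>2) \<omega>}"
    (is "prob ?A \<le> _ + prob ?B")
proof -
  \<comment> \<open>0 and \<open>T\<close> are added so that the bracket up to \<open>T\<close> is
    an integral over exactly \<open>{0..T}\<close>, and \<open>P\<close> so that every time of
    interest is a grid point. Partition points beyond \<open>T\<close> may occur; they are cut off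
    by stopping at the index \<open>A\<close> of \<open>T\<close>.\<close>
  define Q where "Q = {0, T} \<union> P \<union> p1 ` {..N1} \<union> p2 ` {..N2}"
  have "finite Q" "Q \<noteq> {}" using P by (auto simp: Q_def)
  then obtain q :: "nat \<Rightarrow> real" and K where q: "\<And>j. j < K \<Longrightarrow> q j < q (Suc j)" and qQ: "q ` {..K} = Q"
    by (rule finite_set_grid) blast
  have Qpos: "0 \<le> t" if "t \<in> Q" for t
    using that P T adapted_step_nonneg[OF A1] adapted_step_nonneg[OF A2] unfolding Q_def by auto
  have q0: "q 0 = 0"
  proof -
    obtain b where "b \<le> K" "q b = 0" using qQ unfolding Q_def by (metis (no_types, lifting) UnI1 atMost_iff imageE insertI1)
    then have "q 0 \<le> 0" using grid_le_iff[of K q 0 b] q by auto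
    moreover have "0 \<le> q 0" using Qpos qQ by auto
    ultimately show ?thesis by simp
  qed
  obtain A where A: "A \<le> K" "q A = T"
    using qQ unfolding Q_def by (metis (no_types, lifting) UnI1 atMost_iff imageE insertI1 insertI2)
  define X where "X = (\<lambda>s \<omega>. step_process N1 p1 \<xi>1 s \<omega> - step_process N2 p2 \<xi>2 s \<omega>)"
  have p1: "p1 i \<in> q ` {..K}" if "i \<le> N1" for i using that unfolding qQ Q_def by auto
  have p2: "p2 i \<in> q ` {..K}" if "i \<le> N2" for i using that unfolding qQ Q_def by auto
  have m1: "p1 i \<le> p1 (Suc i)" if "i < N1" for i using A1 that unfolding adapted_step_def by auto
  have m2: "p2 i \<le> p2 (Suc i)" if "i < N2" for i using A2 that unfolding adapted_step_def by auto
  have diff: "(\<Sum>j<a. X (q j) \<omega> *v (w (q (Suc j)) \<omega> - w (q j) \<omega>)) =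
    elem_integral w N1 p1 \<xi>1 (q a) \<omega> - elem_integral w N2 p2 \<xi>2 (q a) \<omega>" if "a \<le> K" for a \<omega>
  proof -
    have "elem_integral w N1 p1 \<xi>1 (q a) \<omega> =
      (\<Sum>j<a. step_process N1 p1 \<xi>1 (q j) \<omega> *v (w (q (Suc j)) \<omega> - w (q j) \<omega>))"
      by (rule elem_integral_refine[where K = K]) (use q m1 p1 that in auto)
    moreover have "elem_integral w N2 p2 \<xi>2 (q a) \<omega> =
      (\<Sum>j<a. step_process N2 p2 \<xi>2 (q j) \<omega> *v (w (q (Suc j)) \<omega> - w (q j) \<omega>))"
      by (rule elem_integral_refine[where K = K]) (use q m2 p2 that in auto)
    ultimately show ?thesis
      unfolding X_def by (simp add: sum_subtractf matrix_vector_mult_diff_rdistrib)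
  qed
  have XF: "X (q j) \<in> borel_measurable (F (q j))" for j
    unfolding X_def using step_process_adapted[OF A1] step_process_adapted[OF A2] by measurable
  have Xc: "X s \<omega> = X (q j) \<omega>" if "j < A" "s \<in> {q j..<q (Suc j)}" for j s \<omega>
    unfolding X_def using step_process_refine_const[of K q N1 p1 j s \<xi>1 \<omega>] step_process_refine_const[of K q N2 p2 j s \<xi>2 \<omega>] q p1 p2 that A by auto
  have le: "ennreal (\<Sum>j<A. (q (Suc j) - q j) * (norm (X (q j) \<omega>))\<^sup>2)
    \<le> sq_dist T (step_process N1 p1 \<xi>1) (step_process N2 p2 \<xi>2) \<omega>" for \<omega>
  proof -
    have "ennreal (\<Sum>j<A. (q (Suc j) - q j) * (norm (X (q j) \<omega>))\<^sup>2)
      \<le> (\<integral>\<^sup>+s\<in>{q 0..q A}. ennreal ((norm (X s \<omega>))\<^sup>2) \<partial>lborel)"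
    proof (rule sum_grid_le_nn_integral)
      show "q j < q (Suc j)" if "j < A" for j using q that A by simp
    qed (rule Xc)
    then show ?thesis unfolding sq_dist_def X_def A(2) q0 .
  qed
  note [measurable] = sq_dist_measurable[OF jointly_step_process[OF A1] jointly_step_process[OF A2]]
  have qpos: "0 \<le> q j" if "j \<le> K" for j using Qpos qQ that by auto
  have XM: "X (q j) \<in> borel_measurable M" if "j \<le> K" for j
    using XF qpos[OF that] by (rule measurable_F_M)
  have [measurable]: "(\<lambda>\<omega>. \<Sum>j<n. X (q j) \<omega> *v (w (q (Suc j)) \<omega> - w (q j) \<omega>)) \<in> borel_measurable M" if "n \<in> {..A}" for n
    using that A XM qpos w_measurable_M by (intro borel_measurable_sum) simp
  have "prob ?A
    \<le> prob {\<omega> \<in> space M. \<exists>n\<in>{..A}. \<epsilon> < norm (\<Sum>j<n. X (q j) \<omega> *v (w (q (Suc j)) \<omega> - w (q j) \<omega>))}"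
  proof (intro finite_measure_mono subsetI)
    fix \<omega> assume "\<omega> \<in> ?A"
    then obtain t where t: "\<omega> \<in> space M" "t \<in> P" "\<epsilon> < norm (elem_integral w N1 p1 \<xi>1 t \<omega> - elem_integral w N2 p2 \<xi>2 t \<omega>)"
      by auto
    have "t \<in> q ` {..K}" using t(2) unfolding qQ Q_def by simp
    then obtain a where a: "a \<le> K" "q a = t" by auto
    have "a \<le> A" using grid_le_iff[of K q a A] q a A t(2) P(2) by auto
    then show "\<omega> \<in> {\<omega> \<in> space M. \<exists>n\<in>{..A}. \<epsilon> < norm (\<Sum>j<n. X (q j) \<omega> *v (w (q (Suc j)) \<omega> - w (q j) \<omega>))}"
      using t a diff[OF a(1)] by (auto intro!: bexI[of _ a])
  qed measurable
  also have "\<dots> \<le> CARD('m) * \<delta> / \<epsilon>\<^sup>2 + prob {\<omega> \<in> space M. \<delta> < (\<Sum>j<A. (q (Suc j) - q j) * (norm (X (q j) \<omega>))\<^sup>2)}"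
    using martingale_transform_maximal[of q A "\<lambda>j. X (q j)" \<epsilon> \<delta>] q0 q A XF \<open>0 < \<epsilon>\<close> \<open>0 < \<delta>\<close>
    unfolding atMost_iff Bex_def by simp
  also have "prob {\<omega> \<in> space M. \<delta> < (\<Sum>j<A. (q (Suc j) - q j) * (norm (X (q j) \<omega>))\<^sup>2)}
    \<le> prob ?B"
  proof (intro finite_measure_mono subsetI)
    fix \<omega> assume \<omega>: "\<omega> \<in> {\<omega> \<in> space M. \<delta> < (\<Sum>j<A. (q (Suc j) - q j) * (norm (X (q j) \<omega>))\<^sup>2)}"
    then have "ennreal \<delta> < ennreal (\<Sum>j<A. (q (Suc j) - q j) * (norm (X (q j) \<omega>))\<^sup>2)"
      using \<open>0 < \<delta>\<close> by (intro ennreal_lessI) auto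
    then show "\<omega> \<in> ?B"
      using le[of \<omega>] \<omega> by auto
  qed measurable
  finally show ?thesis by simp
qed

end

section \<open>Approximation of Ito integrals\<close>

context wiener_basis
begin

lemma null_in_probability_prob:
  assumes "null_in_probability M X" "0 < c"
  shows "(\<lambda>k. prob {\<omega> \<in> space M. ennreal c < X k \<omega>}) \<longlonglongrightarrow> 0"
proof -
  have "(\<lambda>k. emeasure M {\<omega> \<in> space M. ennreal c < X k \<omega>}) \<longlonglongrightarrow> 0"
    using assms unfolding null_in_probability_def by simp
  then show ?thesis by (simp add: emeasure_eq_measure ennreal_tendsto_0_iff)
qed

lemma step_partition_adapted:
  assumes "step_partition M F T N p \<xi>"
  shows "adapted_step F N p \<xi>" "p N = T"
  using assms unfolding step_partition_def adapted_step_def by (auto simp: less_imp_le)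

lemma has_ito_integralE:
  fixes G :: "real \<Rightarrow> 'a \<Rightarrow> real ^ 'm ^ 'd"
  assumes "has_ito_integral M F w T G I"
  obtains N p \<xi> where "jointly T G" "I \<in> borel_measurable M"
    "\<And>k. adapted_step F (N k) (p k) (\<xi> k)"
    "\<And>c. 0 < c \<Longrightarrow> (\<lambda>k. prob {\<omega> \<in> space M. ennreal c < sq_dist T (step_process (N k) (p k) (\<xi> k)) G \<omega>}) \<longlonglongrightarrow> 0"
    "\<And>c. 0 < c \<Longrightarrow> (\<lambda>k. prob {\<omega> \<in> space M. c < norm (elem_integral w (N k) (p k) (\<xi> k) T \<omega> - I \<omega>)}) \<longlonglongrightarrow> 0"
proof -
  obtain N p \<xi> where st: "\<And>k. step_partition M F T (N k) (p k) (\<xi> k)"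
    and n1: "null_in_probability M
          (\<lambda>k \<omega>. \<integral>\<^sup>+s\<in>{0..T}.
             ennreal ((norm (step_process (N k) (p k) (\<xi> k) s \<omega> - G s \<omega>))\<^sup>2) \<partial>lborel)"
    and n2: "null_in_probability M
          (\<lambda>k \<omega>. ennreal (norm (step_integral w (N k) (p k) (\<xi> k) \<omega> - I \<omega>)))"
    using assms unfolding has_ito_integral_def by blast
  have eq: "elem_integral w (N k) (p k) (\<xi> k) T \<omega> = step_integral w (N k) (p k) (\<xi> k) \<omega>" for k \<omega>
    using step_partition_adapted[OF st[of k]] by (intro elem_integral_end) (auto simp: adapted_step_def)
  show ?thesis
  proof (rule that[of N p \<xi>])
    show "jointly T G" "I \<in> borel_measurable M" using assms unfolding has_ito_integral_def jointly_def by auto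
    show "adapted_step F (N k) (p k) (\<xi> k)" for k by (rule step_partition_adapted[OF st])
    show "(\<lambda>k. prob {\<omega> \<in> space M. ennreal c < sq_dist T (step_process (N k) (p k) (\<xi> k)) G \<omega>}) \<longlonglongrightarrow> 0" if "0 < c" for c
      using null_in_probability_prob[OF n1 that] by (simp add: sq_dist_def)
    show "(\<lambda>k. prob {\<omega> \<in> space M. c < norm (elem_integral w (N k) (p k) (\<xi> k) T \<omega> - I \<omega>)}) \<longlonglongrightarrow> 0" if "0 < c" for c
      using null_in_probability_prob[OF n2 that] that by (simp add: eq ennreal_less_iff)
  qed
qed

lemma prob_norm_triangle:
  fixes X Y Z :: "'a \<Rightarrow> real ^ 'd"
  assumes [measurable]: "X \<in> borel_measurable M" "Y \<in> borel_measurable M" "Z \<in> borel_measurable M"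
  shows "prob {\<omega> \<in> space M. a + b < norm (X \<omega> - Z \<omega>)}
    \<le> prob {\<omega> \<in> space M. a < norm (X \<omega> - Y \<omega>)} + prob {\<omega> \<in> space M. b < norm (Y \<omega> - Z \<omega>)}"
proof -
  have "prob {\<omega> \<in> space M. a + b < norm (X \<omega> - Z \<omega>)}
    \<le> prob ({\<omega> \<in> space M. a < norm (X \<omega> - Y \<omega>)} \<union> {\<omega> \<in> space M. b < norm (Y \<omega> - Z \<omega>)})"
  proof (intro finite_measure_mono subsetI)
    fix \<omega> assume "\<omega> \<in> {\<omega> \<in> space M. a + b < norm (X \<omega> - Z \<omega>)}"
    then show "\<omega> \<in> {\<omega> \<in> space M. a < norm (X \<omega> - Y \<omega>)} \<union> {\<omega> \<in> space M. b < norm (Y \<omega> - Z \<omega>)}"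
      using norm_triangle_ineq[of "X \<omega> - Y \<omega>" "Y \<omega> - Z \<omega>"] by auto
  qed measurable
  also have "\<dots> \<le> prob {\<omega> \<in> space M. a < norm (X \<omega> - Y \<omega>)} + prob {\<omega> \<in> space M. b < norm (Y \<omega> - Z \<omega>)}"
    by (intro measure_Un_le) measurable
  finally show ?thesis .
qed

text \<open>The Ito integrals over \<open>[0, t]\<close> and \<open>[0, T]\<close> come with unrelated approximating step
  processes; the maximal inequality shows that they are consistent.\<close>

lemma elem_integral_tendsto_ito:
  fixes G :: "real \<Rightarrow> 'a \<Rightarrow> real ^ 'm ^ 'd" and c t T :: real
  assumes G: "jointly T G" and A: "\<And>k. adapted_step F (N k) (p k) (\<xi> k)"
    and lim: "\<And>c. 0 < c \<Longrightarrow> (\<lambda>k. prob {\<omega> \<in> space M. ennreal c < sq_dist T (step_process (N k) (p k) (\<xi> k)) G \<omega>}) \<longlonglongrightarrow> 0"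
    and I: "has_ito_integral M F w t G I" and t: "0 < t" "t \<le> T" and c: "0 < c"
  shows "(\<lambda>k. prob {\<omega> \<in> space M. c < norm (elem_integral w (N k) (p k) (\<xi> k) t \<omega> - I \<omega>)}) \<longlonglongrightarrow> 0"
proof -
  obtain N' p' \<xi>' where Gt: "jointly t G" and mI: "I \<in> borel_measurable M"
    and A': "\<And>k. adapted_step F (N' k) (p' k) (\<xi>' k)"
    and lim1: "\<And>c. 0 < c \<Longrightarrow> (\<lambda>k. prob {\<omega> \<in> space M. ennreal c < sq_dist t (step_process (N' k) (p' k) (\<xi>' k)) G \<omega>}) \<longlonglongrightarrow> 0"
    and lim2: "\<And>c. 0 < c \<Longrightarrow> (\<lambda>k. prob {\<omega> \<in> space M. c < norm (elem_integral w (N' k) (p' k) (\<xi>' k) t \<omega> - I \<omega>)}) \<longlonglongrightarrow> 0"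
    using I by (rule has_ito_integralE) blast
  define Z where "Z = (\<lambda>k. step_process (N k) (p k) (\<xi> k))"
  define Z' where "Z' = (\<lambda>k. step_process (N' k) (p' k) (\<xi>' k))"
  define E where "E = (\<lambda>k. elem_integral w (N k) (p k) (\<xi> k) t)"
  define E' where "E' = (\<lambda>k. elem_integral w (N' k) (p' k) (\<xi>' k) t)"
  have jZ: "jointly s (Z k)" "jointly s (Z' k)" for s k
    unfolding Z_def Z'_def by (intro jointly_step_process A A')+
  have [measurable]: "E k \<in> borel_measurable M" "E' k \<in> borel_measurable M" "I \<in> borel_measurable M" for k
    unfolding E_def E'_def using elem_integral_measurable[OF A, of t] elem_integral_measurable[OF A', of t] t mI by auto
  have bound: "prob {\<omega> \<in> space M. c < norm (E k \<omega> - I \<omega>)} \<le>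
    (CARD('m) * \<delta> / (c / 2)\<^sup>2 + (prob {\<omega> \<in> space M. ennreal (\<delta> / 4) < sq_dist T (Z k) G \<omega>}
      + prob {\<omega> \<in> space M. ennreal (\<delta> / 4) < sq_dist t (Z' k) G \<omega>}))
      + prob {\<omega> \<in> space M. c / 2 < norm (E' k \<omega> - I \<omega>)}" if "0 < \<delta>" for k and \<delta> :: real
  proof -
    have "prob {\<omega> \<in> space M. c < norm (E k \<omega> - I \<omega>)}
      \<le> prob {\<omega> \<in> space M. c / 2 < norm (E k \<omega> - E' k \<omega>)} + prob {\<omega> \<in> space M. c / 2 < norm (E' k \<omega> - I \<omega>)}"
      using prob_norm_triangle[of "E k" "E' k" I "c / 2" "c / 2"] by simp
    moreover have "prob {\<omega> \<in> space M. c / 2 < norm (E k \<omega> - E' k \<omega>)}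
      \<le> CARD('m) * \<delta> / (c / 2)\<^sup>2 + prob {\<omega> \<in> space M. ennreal \<delta> < sq_dist t (Z k) (Z' k) \<omega>}"
      using elem_integral_diff_maximal[OF A[of k] A'[of k], of "{t}" t "c / 2" \<delta>] t c that
      by (simp add: E_def E'_def Z_def Z'_def)
    moreover have "prob {\<omega> \<in> space M. ennreal \<delta> < sq_dist t (Z k) (Z' k) \<omega>}
      \<le> prob {\<omega> \<in> space M. ennreal (\<delta> / 4) < sq_dist t (Z k) G \<omega>} + prob {\<omega> \<in> space M. ennreal (\<delta> / 4) < sq_dist t (Z' k) G \<omega>}"
      by (rule prob_sq_dist_triangle[OF jZ Gt that])
    moreover have "prob {\<omega> \<in> space M. ennreal (\<delta> / 4) < sq_dist t (Z k) G \<omega>} \<le> prob {\<omega> \<in> space M. ennreal (\<delta> / 4) < sq_dist T (Z k) G \<omega>}"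
      using sq_dist_measurable[OF jZ(1) G, of k] sq_dist_mono[OF t(2), of "Z k" G]
      by (intro finite_measure_mono) (auto intro: less_le_trans)
    ultimately show ?thesis by linarith
  qed
  show ?thesis
  proof (rule tendstoI)
    fix \<eta> :: real assume "0 < \<eta>"
    \<comment> \<open>Makes the Chebyshev term equal to \<eta>/4; the other three terms drop below
      \<eta>/4 as \<open>k\<close> grows, with this \<delta> fixed.\<close>
    define \<delta> where "\<delta> = \<eta> * (c / 2)\<^sup>2 / (4 * CARD('m))"
    have \<delta>: "0 < \<delta>" "CARD('m) * \<delta> / (c / 2)\<^sup>2 = \<eta> / 4" using \<open>0 < \<eta>\<close> c by (auto simp: \<delta>_def)
    have "\<forall>\<^sub>F k in sequentially. prob {\<omega> \<in> space M. ennreal (\<delta> / 4) < sq_dist T (Z k) G \<omega>} < \<eta> / 4"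
      using lim[of "\<delta> / 4"] \<delta>(1) \<open>0 < \<eta>\<close> unfolding Z_def by (intro order_tendstoD(2)[where y = 0]) auto
    moreover have "\<forall>\<^sub>F k in sequentially. prob {\<omega> \<in> space M. ennreal (\<delta> / 4) < sq_dist t (Z' k) G \<omega>} < \<eta> / 4"
      using lim1[of "\<delta> / 4"] \<delta>(1) \<open>0 < \<eta>\<close> unfolding Z'_def by (intro order_tendstoD(2)[where y = 0]) auto
    moreover have "\<forall>\<^sub>F k in sequentially. prob {\<omega> \<in> space M. c / 2 < norm (E' k \<omega> - I \<omega>)} < \<eta> / 4"
      using lim2[of "c / 2"] c \<open>0 < \<eta>\<close> unfolding E'_def by (intro order_tendstoD(2)[where y = 0]) auto
    ultimately show "\<forall>\<^sub>F k in sequentially. dist (prob {\<omega> \<in> space M. c < norm (elem_integral w (N k) (p k) (\<xi> k) t \<omega> - I \<omega>)}) 0 < \<eta>"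
    proof eventually_elim
      case (elim k)
      have "prob {\<omega> \<in> space M. c < norm (E k \<omega> - I \<omega>)} < \<eta>"
        using bound[OF \<delta>(1), of k, unfolded \<delta>(2)] elim by linarith
      then show ?case by (simp add: E_def)
    qed
  qed
qed

text \<open>The approximating integrals of \<open>J\<close> are compared with \<open>I t\<close> one
  time at a time and with the step integral at all times at once. The first comparison costs a sum
  over \<open>P\<close>, but \<open>k\<close> tends to infinity while \<open>P\<close> is fixed, so
  that sum disappears and the bound does not see the size of \<open>P\<close>. The factor 4 comes
  from splitting \<epsilon> into halves.\<close>

lemma ito_integral_step_maximal:
  fixes G :: "real \<Rightarrow> 'a \<Rightarrow> real ^ 'm ^ 'd" and \<epsilon> \<delta> T :: real
  assumes J: "has_ito_integral M F w T G J" and T: "0 < T"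
    and P: "finite P" "P \<subseteq> {0<..T}" and I: "\<And>t. t \<in> P \<Longrightarrow> has_ito_integral M F w t G (I t)"
    and D: "adapted_step F N p \<xi>" and "0 < \<epsilon>" "0 < \<delta>"
  shows "prob {\<omega> \<in> space M. \<exists>t\<in>P. \<epsilon> < norm (I t \<omega> - elem_integral w N p \<xi> t \<omega>)}
    \<le> 4 * CARD('m) * \<delta> / \<epsilon>\<^sup>2 + prob {\<omega> \<in> space M. ennreal (\<delta> / 4) < sq_dist T (step_process N p \<xi>) G \<omega>}"
proof -
  obtain N' p' \<xi>' where G: "jointly T G"
    and A': "\<And>k. adapted_step F (N' k) (p' k) (\<xi>' k)"
    and lim: "\<And>c. 0 < c \<Longrightarrow> (\<lambda>k. prob {\<omega> \<in> space M. ennreal c < sq_dist T (step_process (N' k) (p' k) (\<xi>' k)) G \<omega>}) \<longlonglongrightarrow> 0"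
    using J by (rule has_ito_integralE) blast
  define Z where "Z = (\<lambda>k. step_process (N' k) (p' k) (\<xi>' k))"
  define E where "E = (\<lambda>k. elem_integral w (N' k) (p' k) (\<xi>' k))"
  define D0 where "D0 = step_process N p \<xi>"
  define ED where "ED = elem_integral w N p \<xi>"
  define C where "C = prob {\<omega> \<in> space M. ennreal (\<delta> / 4) < sq_dist T D0 G \<omega>}"
  have [measurable]: "I t \<in> borel_measurable M" "E k t \<in> borel_measurable M" "ED t \<in> borel_measurable M" if "t \<in> P" for t k
    using that I P elem_integral_measurable[OF A'] elem_integral_measurable[OF D]
    unfolding E_def ED_def has_ito_integral_def by auto
  have ev: "{\<omega> \<in> space M. c < norm (E k t \<omega> - I t \<omega>)} \<in> events" if "t \<in> P" for t c k
    using that by measurable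
  have ev1: "(\<Union>t\<in>P. {\<omega> \<in> space M. c < norm (E k t \<omega> - I t \<omega>)}) \<in> events" for c k
    by (rule sets.finite_UN[OF P(1) ev])
  have ev2: "{\<omega> \<in> space M. \<exists>t\<in>P. c < norm (E k t \<omega> - ED t \<omega>)} \<in> events" for c k
    by (rule sets.sets_Collect_finite_Ex[OF _ P(1)]) measurable
  have bound: "prob {\<omega> \<in> space M. \<exists>t\<in>P. \<epsilon> < norm (I t \<omega> - ED t \<omega>)} \<le>
    (\<Sum>t\<in>P. prob {\<omega> \<in> space M. \<epsilon> / 2 < norm (E k t \<omega> - I t \<omega>)}) +
    (CARD('m) * \<delta> / (\<epsilon> / 2)\<^sup>2 + (prob {\<omega> \<in> space M. ennreal (\<delta> / 4) < sq_dist T (Z k) G \<omega>} + C))" for k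
  proof -
    have "prob {\<omega> \<in> space M. \<exists>t\<in>P. \<epsilon> < norm (I t \<omega> - ED t \<omega>)} \<le>
      prob ((\<Union>t\<in>P. {\<omega> \<in> space M. \<epsilon> / 2 < norm (E k t \<omega> - I t \<omega>)}) \<union> {\<omega> \<in> space M. \<exists>t\<in>P. \<epsilon> / 2 < norm (E k t \<omega> - ED t \<omega>)})"
    proof (intro finite_measure_mono subsetI)
      fix \<omega> assume "\<omega> \<in> {\<omega> \<in> space M. \<exists>t\<in>P. \<epsilon> < norm (I t \<omega> - ED t \<omega>)}"
      then obtain t where t: "\<omega> \<in> space M" "t \<in> P" "\<epsilon> < norm (I t \<omega> - ED t \<omega>)" by auto
      have "norm (I t \<omega> - ED t \<omega>) \<le> norm (E k t \<omega> - I t \<omega>) + norm (E k t \<omega> - ED t \<omega>)"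
        using norm_triangle_ineq4[of "E k t \<omega> - ED t \<omega>" "E k t \<omega> - I t \<omega>"] by simp
      then have "\<epsilon> / 2 < norm (E k t \<omega> - I t \<omega>) \<or> \<epsilon> / 2 < norm (E k t \<omega> - ED t \<omega>)" using t(3) by linarith
      then show "\<omega> \<in> (\<Union>t\<in>P. {\<omega> \<in> space M. \<epsilon> / 2 < norm (E k t \<omega> - I t \<omega>)}) \<union> {\<omega> \<in> space M. \<exists>t\<in>P. \<epsilon> / 2 < norm (E k t \<omega> - ED t \<omega>)}"
        using t by auto
    qed (intro sets.Un ev1 ev2)
    also have "\<dots> \<le> prob (\<Union>t\<in>P. {\<omega> \<in> space M. \<epsilon> / 2 < norm (E k t \<omega> - I t \<omega>)}) + prob {\<omega> \<in> space M. \<exists>t\<in>P. \<epsilon> / 2 < norm (E k t \<omega> - ED t \<omega>)}"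
      by (intro measure_Un_le ev1 ev2)
    also have "prob (\<Union>t\<in>P. {\<omega> \<in> space M. \<epsilon> / 2 < norm (E k t \<omega> - I t \<omega>)}) \<le> (\<Sum>t\<in>P. prob {\<omega> \<in> space M. \<epsilon> / 2 < norm (E k t \<omega> - I t \<omega>)})"
      using ev by (intro finite_measure_subadditive_finite P(1)) auto
    also have "prob {\<omega> \<in> space M. \<exists>t\<in>P. \<epsilon> / 2 < norm (E k t \<omega> - ED t \<omega>)}
      \<le> CARD('m) * \<delta> / (\<epsilon> / 2)\<^sup>2 + prob {\<omega> \<in> space M. ennreal \<delta> < sq_dist T (Z k) D0 \<omega>}"
      using elem_integral_diff_maximal[OF A'[of k] D P(1), of T "\<epsilon> / 2" \<delta>] P T \<open>0 < \<epsilon>\<close> \<open>0 < \<delta>\<close>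
      unfolding E_def ED_def Z_def D0_def by fastforce
    also have "prob {\<omega> \<in> space M. ennreal \<delta> < sq_dist T (Z k) D0 \<omega>}
      \<le> prob {\<omega> \<in> space M. ennreal (\<delta> / 4) < sq_dist T (Z k) G \<omega>} + C"
      unfolding C_def Z_def D0_def
      by (rule prob_sq_dist_triangle[OF jointly_step_process[OF A'] jointly_step_process[OF D] G \<open>0 < \<delta>\<close>])
    finally show ?thesis by simp
  qed
  have "(\<lambda>k. (\<Sum>t\<in>P. prob {\<omega> \<in> space M. \<epsilon> / 2 < norm (E k t \<omega> - I t \<omega>)}) +
    (CARD('m) * \<delta> / (\<epsilon> / 2)\<^sup>2 + (prob {\<omega> \<in> space M. ennreal (\<delta> / 4) < sq_dist T (Z k) G \<omega>} + C)))
    \<longlonglongrightarrow> (\<Sum>t\<in>P. 0) + (CARD('m) * \<delta> / (\<epsilon> / 2)\<^sup>2 + (0 + C))"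
    unfolding E_def Z_def using P T I \<open>0 < \<epsilon>\<close> \<open>0 < \<delta>\<close>
    by (intro tendsto_add tendsto_sum tendsto_const lim elem_integral_tendsto_ito[OF G A' lim]) auto
  from LIMSEQ_le_const[OF this exI[of _ 0]] bound
  have "prob {\<omega> \<in> space M. \<exists>t\<in>P. \<epsilon> < norm (I t \<omega> - ED t \<omega>)} \<le> (\<Sum>t\<in>P. 0) + (CARD('m) * \<delta> / (\<epsilon> / 2)\<^sup>2 + (0 + C))"
    by blast
  then show ?thesis unfolding C_def ED_def D0_def by (simp add: power_divide mult_ac)
qed

end

section \<open>Second moments of the error recursion\<close>

text \<open>Dominated convergence for indicators along an arbitrary sequence of step sizes. The
  threshold below which \<open>h\<close> is good may depend on \<omega> in any way, so pathwise
  continuity can replace quantitative estimates.\<close>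

lemma (in prob_space) prob_tendsto_0_at_right:
  fixes A :: "real \<Rightarrow> 'a set"
  assumes "\<forall>\<^sub>F h in at_right 0. A h \<in> events"
    and "AE \<omega> in M. \<forall>\<^sub>F h in at_right 0. \<omega> \<notin> A h"
  shows "((\<lambda>h. prob (A h)) \<longlongrightarrow> 0) (at_right 0)"
  unfolding tendsto_at_iff_sequentially comp_def
proof (intro allI impI)
  fix X :: "nat \<Rightarrow> real" assume X: "\<forall>i. X i \<in> {0<..} - {0}" "X \<longlonglongrightarrow> 0"
  have fl: "filterlim X (at_right 0) sequentially"
    unfolding filterlim_at using X by (auto intro!: always_eventually simp: less_imp_neq[THEN not_sym])
  have ev: "\<forall>\<^sub>F i in sequentially. A (X i) \<in> events" using assms(1) fl by (rule eventually_compose_filterlim)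
  \<comment> \<open>\<open>A h\<close> is measurable only for small \<open>h\<close>; the
    exceptional members of the sequence are replaced by the empty set, which does not affect the
    limit.\<close>
  define B where "B = (\<lambda>i. if A (X i) \<in> events then A (X i) else {})"
  have [measurable]: "B i \<in> events" for i by (auto simp: B_def)
  have "(\<lambda>i. \<integral>\<omega>. indicator (B i) \<omega> \<partial>M) \<longlonglongrightarrow> (\<integral>\<omega>. (0::real) \<partial>M)"
  proof (rule integral_dominated_convergence[where w = "\<lambda>_. 1"])
    show "AE \<omega> in M. (\<lambda>i. indicator (B i) \<omega>) \<longlonglongrightarrow> (0::real)"
      using assms(2)
    proof eventually_elim
      case (elim \<omega>)
      from eventually_compose_filterlim[OF elim fl]
      have "\<forall>\<^sub>F i in sequentially. indicator (B i) \<omega> = (0::real)"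
        by eventually_elim (auto simp: B_def)
      then show ?case by (rule tendsto_eventually)
    qed
  qed (auto simp: indicator_def)
  then have "(\<lambda>i. prob (B i)) \<longlonglongrightarrow> 0" by simp
  moreover have "\<forall>\<^sub>F i in sequentially. prob (B i) = prob (A (X i))"
    using ev by eventually_elim (simp add: B_def)
  ultimately show "(\<lambda>i. prob (A (X i))) \<longlonglongrightarrow> 0" by (rule Lim_transform_eventually)
qed

context wiener_basis
begin

text \<open>The coefficient bounds look back at the indices \<open>k n\<close> and
  \<open>k' n\<close>, so the claimed bound is chosen increasing in \<open>n\<close> and the
  induction is a strong one. With \<open>P\<close> the bound at step \<open>n\<close>, each of the
  three second moments and \<kappa>^2 itself is at most \<open>P\<close>, which gives 4
  \<open>C\<close> \<open>P\<close> for either coefficient. In \<open>c\<close> the summand 1 comes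
  from the cross term of the drift, 2 times 4 \<open>C\<close> from the drift and
  \<open>CARD('m)\<close> times 4 \<open>C\<close> from the noise.\<close>

lemma discrete_gronwall_second_moment:
  fixes \<alpha> :: "nat \<Rightarrow> 'a \<Rightarrow> real ^ 'd" and \<beta> :: "nat \<Rightarrow> 'a \<Rightarrow> real ^ 'm ^ 'd" and h C \<kappa> B :: real
  defines "m \<equiv> \<lambda>n \<omega>. \<Sum>j<n. h *\<^sub>R \<alpha> j \<omega> + \<beta> j \<omega> *v (w (real (Suc j) * h) \<omega> - w (real j * h) \<omega>)"
    and "c \<equiv> 1 + 4 * (2 + CARD('m)) * C"
  assumes h: "0 < h" "h \<le> 1" and C: "0 \<le> C" and k: "\<And>n. k n \<le> n" "\<And>n. k' n \<le> n"
    and \<alpha>: "\<And>n. n < N \<Longrightarrow> \<alpha> n \<in> borel_measurable (F (real n * h))"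
      "\<And>n \<omega>. n < N \<Longrightarrow> \<omega> \<in> space M \<Longrightarrow> norm (\<alpha> n \<omega>) \<le> B"
      "\<And>n \<omega>. n < N \<Longrightarrow> \<omega> \<in> space M \<Longrightarrow> (norm (\<alpha> n \<omega>))\<^sup>2 \<le>
        C * ((norm (m n \<omega>))\<^sup>2 + (norm (m (k n) \<omega>))\<^sup>2 + (norm (m (k' n) \<omega>))\<^sup>2 + \<kappa>\<^sup>2)"
    and \<beta>: "\<And>n. n < N \<Longrightarrow> \<beta> n \<in> borel_measurable (F (real n * h))"
      "\<And>n \<omega>. n < N \<Longrightarrow> \<omega> \<in> space M \<Longrightarrow> norm (\<beta> n \<omega>) \<le> B"
      "\<And>n \<omega>. n < N \<Longrightarrow> \<omega> \<in> space M \<Longrightarrow> (norm (\<beta> n \<omega>))\<^sup>2 \<le>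
        C * ((norm (m n \<omega>))\<^sup>2 + (norm (m (k n) \<omega>))\<^sup>2 + (norm (m (k' n) \<omega>))\<^sup>2 + \<kappa>\<^sup>2)"
    and "n \<le> N"
  shows "m n \<in> borel_measurable (F (real n * h))" "integrable M (\<lambda>\<omega>. (norm (m n \<omega>))\<^sup>2)"
    "second_moment (m n) \<le> \<kappa>\<^sup>2 * (1 + c * h) ^ n"
proof -
  have c0: "1 \<le> c" using C by (simp add: c_def)
  have pow_mono: "(1 + c * h) ^ i \<le> (1 + c * h) ^ n" if "i \<le> n" for i n
    using that c0 h by (intro power_increasing) auto
  have "m n \<in> borel_measurable (F (real n * h)) \<and> integrable M (\<lambda>\<omega>. (norm (m n \<omega>))\<^sup>2) \<and>
    second_moment (m n) \<le> \<kappa>\<^sup>2 * (1 + c * h) ^ n"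
    using \<open>n \<le> N\<close>
  proof (induction n rule: less_induct)
    case (less n0)
    show ?case
    proof (cases n0)
      case 0
      then show ?thesis by (simp add: m_def)
    next
      case (Suc n)
      then have n: "n < N" using less.prems by simp
      have mm: "m i \<in> borel_measurable (F (real i * h))" and im: "integrable M (\<lambda>\<omega>. (norm (m i \<omega>))\<^sup>2)"
        and em: "second_moment (m i) \<le> \<kappa>\<^sup>2 * (1 + c * h) ^ n" if "i \<le> n" for i
        using less.IH[of i] that n Suc pow_mono[OF that] mult_left_mono[OF pow_mono[OF that], of "\<kappa>\<^sup>2"] by auto
      define U where "U = (\<lambda>\<omega>. m n \<omega> + h *\<^sub>R \<alpha> n \<omega>)"
      define Q where "Q = (\<lambda>\<omega>. C * ((norm (m n \<omega>))\<^sup>2 + (norm (m (k n) \<omega>))\<^sup>2 + (norm (m (k' n) \<omega>))\<^sup>2 + \<kappa>\<^sup>2))"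
      have iQ: "integrable M Q" unfolding Q_def using im[of n] im[OF k(1)] im[OF k(2)] by simp
      define P where "P = \<kappa>\<^sup>2 * (1 + c * h) ^ n"
      have "1 \<le> (1 + c * h) ^ n" using c0 h by (intro one_le_power) simp
      then have P: "\<kappa>\<^sup>2 \<le> P" unfolding P_def using mult_left_mono[of 1 "(1 + c * h) ^ n" "\<kappa>\<^sup>2"] by simp
      have eQ: "expectation Q \<le> C * (4 * P)"
      proof -
        have "expectation Q = C * (second_moment (m n) + second_moment (m (k n))
            + second_moment (m (k' n)) + \<kappa>\<^sup>2)"
          unfolding Q_def using im[of n] im[OF k(1)] im[OF k(2)] by (simp add: prob_space)
        also have "\<dots> \<le> C * (P + P + P + P)"
          using em[of n] em[OF k(1)] em[OF k(2)] P C unfolding P_def[symmetric]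
          by (intro mult_left_mono add_mono) auto
        finally show ?thesis by (simp add: algebra_simps)
      qed
      have t: "0 \<le> real n * h" "real n * h < real (Suc n) * h" using h by auto
      have mU: "U \<in> borel_measurable (F (real n * h))" unfolding U_def using mm[of n] \<alpha>(1)[OF n] by simp
      \<comment> \<open>The cross term is split by 2ab <= a^2 + b^2 with weight \<open>h\<close>,
        and \<open>h \<le> 1\<close> lowers the quadratic drift term to order \<open>h\<close>;
        together they produce the 2 \<open>h\<close> in front of \<open>Q\<close>.\<close>
      have Ule: "(norm (U \<omega>))\<^sup>2 \<le> (1 + h) * (norm (m n \<omega>))\<^sup>2 + 2 * h * Q \<omega>" if "\<omega> \<in> space M" for \<omega>
      proof -
        have "2 * h * (norm (m n \<omega>) * norm (\<alpha> n \<omega>)) \<le> h * ((norm (m n \<omega>))\<^sup>2 + (norm (\<alpha> n \<omega>))\<^sup>2)"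
          using mult_left_mono[OF zero_le_power2[of "norm (m n \<omega>) - norm (\<alpha> n \<omega>)"], of h] h
          by (simp add: power2_diff algebra_simps)
        moreover have "h * inner (m n \<omega>) (\<alpha> n \<omega>) \<le> h * (norm (m n \<omega>) * norm (\<alpha> n \<omega>))"
          using h by (intro mult_left_mono norm_cauchy_schwarz) auto
        moreover have "h * (h * (norm (\<alpha> n \<omega>))\<^sup>2) \<le> h * (1 * (norm (\<alpha> n \<omega>))\<^sup>2)"
          using h by (intro mult_left_mono mult_right_mono) auto
        moreover have "(norm (U \<omega>))\<^sup>2 = (norm (m n \<omega>))\<^sup>2 + 2 * (h * inner (m n \<omega>) (\<alpha> n \<omega>)) + h * (h * (norm (\<alpha> n \<omega>))\<^sup>2)"
          unfolding U_def power2_norm_eq_inner by (simp add: inner_add_left inner_add_right inner_commute algebra_simps)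
        ultimately have "(norm (U \<omega>))\<^sup>2 \<le> (1 + h) * (norm (m n \<omega>))\<^sup>2 + 2 * (h * (norm (\<alpha> n \<omega>))\<^sup>2)"
          by (simp add: algebra_simps)
        moreover have "h * (norm (\<alpha> n \<omega>))\<^sup>2 \<le> h * Q \<omega>"
          unfolding Q_def using \<alpha>(3)[OF n that] h by (intro mult_left_mono) auto
        ultimately show ?thesis by simp
      qed
      have i1: "integrable M (\<lambda>\<omega>. (1 + h) * (norm (m n \<omega>))\<^sup>2 + 2 * h * Q \<omega>)" using im[of n] iQ by simp
      have iU: "integrable M (\<lambda>\<omega>. (norm (U \<omega>))\<^sup>2)"
        by (rule Bochner_Integration.integrable_bound[OF i1])
           (use measurable_F_M[OF mU t(1)] Ule in \<open>auto intro!: AE_I2 order_trans[OF _ abs_ge_self]\<close>)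
      have eU: "second_moment U \<le> (1 + h) * P + 2 * h * (C * (4 * P))"
      proof -
        have "second_moment U \<le> expectation (\<lambda>\<omega>. (1 + h) * (norm (m n \<omega>))\<^sup>2 + 2 * h * Q \<omega>)"
          by (intro integral_mono iU i1 Ule)
        also have "\<dots> = (1 + h) * second_moment (m n) + 2 * h * expectation Q"
          using im[of n] iQ by simp
        also have "\<dots> \<le> (1 + h) * P + 2 * h * (C * (4 * P))"
          using em[of n] eQ h unfolding P_def[symmetric] by (intro add_mono mult_left_mono) auto
        finally show ?thesis .
      qed
      have i\<beta>: "integrable M (\<lambda>\<omega>. (norm (\<beta> n \<omega>))\<^sup>2)"
        by (rule Bochner_Integration.integrable_bound[OF iQ])
           (use measurable_F_M[OF \<beta>(1)[OF n] t(1)] \<beta>(3)[OF n] in \<open>auto simp: Q_def intro!: AE_I2 order_trans[OF _ abs_ge_self]\<close>)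
      have e\<beta>: "second_moment (\<beta> n) \<le> C * (4 * P)"
        using integral_mono[OF i\<beta> iQ] \<beta>(3)[OF n] eQ unfolding Q_def by (meson order_trans)
      have eq: "m n0 = (\<lambda>\<omega>. U \<omega> + \<beta> n \<omega> *v (w (real (Suc n) * h) \<omega> - w (real n * h) \<omega>))"
        by (simp add: m_def U_def Suc fun_eq_iff)
      note st = euler_step_second_moment[OF t mU iU \<beta>(1,2)[OF n]]
      have "second_moment (m n0) \<le> second_moment U + CARD('m) * h * second_moment (\<beta> n)"
        unfolding eq using st(3) by (simp add: algebra_simps)
      also have "\<dots> \<le> (1 + h) * P + 2 * h * (C * (4 * P)) + CARD('m) * h * (C * (4 * P))"
        using eU e\<beta> h by (intro add_mono mult_left_mono) auto
      also have "\<dots> = \<kappa>\<^sup>2 * (1 + c * h) ^ n0"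
        unfolding P_def c_def Suc by (simp add: algebra_simps)
      finally have "second_moment (m n0) \<le> \<kappa>\<^sup>2 * (1 + c * h) ^ n0" .
      moreover have "m n0 \<in> borel_measurable (F (real (Suc n) * h))"
        unfolding eq by (rule st(1))
      then have "m n0 \<in> borel_measurable (F (real n0 * h))" by (simp only: Suc)
      moreover have "integrable M (\<lambda>\<omega>. (norm (m n0 \<omega>))\<^sup>2)"
        unfolding eq by (rule st(2))
      ultimately show ?thesis by blast
    qed
  qed
  then show "m n \<in> borel_measurable (F (real n * h))" "integrable M (\<lambda>\<omega>. (norm (m n \<omega>))\<^sup>2)"
    "second_moment (m n) \<le> \<kappa>\<^sup>2 * (1 + c * h) ^ n" by auto
qed

end

section \<open>Delayed values and the implicit equation along a single path\<close>

lemma delayed_value_cases: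
  fixes \<psi> :: "real \<Rightarrow> real ^ 'd"
  assumes h: "0 < h" and \<tau>: "0 \<le> \<tau> (real n * h)"
  defines "s \<equiv> real n * h - \<tau> (real n * h)"
  defines "k \<equiv> nat \<lfloor>s / h\<rfloor>"
  obtains (undelayed) "s = real n * h" "\<And>u. delayed_value ip \<tau> \<psi> h u n = u n"
  | (initial) "s < 0" "\<And>u. delayed_value ip \<tau> \<psi> h u n = \<psi> s"
  | (interpolated) \<mu> where "0 \<le> s" "k < n" "real k * h \<le> s" "s < real (Suc k) * h" "0 \<le> \<mu>" "\<mu> \<le> 1"
      "\<And>u. delayed_value ip \<tau> \<psi> h u n = \<mu> *\<^sub>R u (Suc k) + (1 - \<mu>) *\<^sub>R u k"
proof -
  consider "\<tau> (real n * h) = 0" | "\<tau> (real n * h) \<noteq> 0" "s < 0" | "\<tau> (real n * h) \<noteq> 0" "0 \<le> s" by linarith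
  then show thesis
  proof cases
    case 1
    then show thesis by (intro undelayed) (simp_all add: delayed_value_def s_def)
  next
    case 2
    then show thesis by (intro initial) (simp_all add: delayed_value_def s_def Let_def)
  next
    case 3
    define \<mu> where "\<mu> = interpolation_weight ip h s k"
    have rk: "real k = of_int \<lfloor>s / h\<rfloor>" using 3 h by (simp add: k_def)
    have a: "real k * h \<le> s" unfolding rk using h of_int_floor_le[of "s / h"] pos_le_divide_eq[of h] by blast
    have b: "s < real (Suc k) * h"
    proof -
      have "s / h < real k + 1" unfolding rk by linarith
      then show ?thesis using h by (simp add: pos_divide_less_eq add.commute)
    qed
    \<comment> \<open>The delay is strictly positive in this case, so the right interpolation node
      \<open>Suc k\<close> is at most \<open>n\<close>. It may equal \<open>n\<close>, and then the
      step is implicit in the delayed argument as well.\<close>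
    have "real k * h < real n * h" using a 3 \<tau> by (simp add: s_def)
    then have kn: "k < n" using h by simp
    have \<mu>: "0 \<le> \<mu>" "\<mu> \<le> 1" using a b h
      by (cases ip; simp add: \<mu>_def interpolation_weight_def field_simps)+
    show thesis
      by (rule interpolated[OF 3(2) kn a b \<mu>])
         (use 3 in \<open>simp add: delayed_value_def Let_def s_def k_def \<mu>_def\<close>)
  qed
qed

lemma norm_convex_le:
  fixes a b :: "'b :: real_normed_vector"
  assumes "0 \<le> \<mu>" "\<mu> \<le> 1" "norm a \<le> A" "norm b \<le> B"
  shows "norm (\<mu> *\<^sub>R a + (1 - \<mu>) *\<^sub>R b) \<le> \<mu> * A + (1 - \<mu>) * B"
proof -
  have "norm (\<mu> *\<^sub>R a + (1 - \<mu>) *\<^sub>R b) \<le> \<mu> * norm a + (1 - \<mu>) * norm b"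
    using norm_triangle_ineq[of "\<mu> *\<^sub>R a" "(1 - \<mu>) *\<^sub>R b"] assms by simp
  also have "\<dots> \<le> \<mu> * A + (1 - \<mu>) * B" using assms by (intro add_mono mult_left_mono) auto
  finally show ?thesis .
qed

lemma delayed_value_norm_le:
  fixes \<psi> :: "real \<Rightarrow> real ^ 'd"
  assumes h: "0 < h" and \<tau>: "0 \<le> \<tau> (real n * h)"
    and \<psi>: "real n * h - \<tau> (real n * h) < 0 \<Longrightarrow> norm (\<psi> (real n * h - \<tau> (real n * h))) \<le> B"
    and u: "\<And>l. l \<le> n \<Longrightarrow> norm (u l) \<le> B"
  shows "norm (delayed_value ip \<tau> \<psi> h u n) \<le> B"
proof (rule delayed_value_cases[of h \<tau> n ip \<psi>, OF h \<tau>])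
  fix \<mu> :: real
  let ?k = "nat \<lfloor>(real n * h - \<tau> (real n * h)) / h\<rfloor>"
  assume *: "?k < n" "0 \<le> \<mu>" "\<mu> \<le> 1" "\<And>u. delayed_value ip \<tau> \<psi> h u n = \<mu> *\<^sub>R u (Suc ?k) + (1 - \<mu>) *\<^sub>R u ?k"
  have "norm (\<mu> *\<^sub>R u (Suc ?k) + (1 - \<mu>) *\<^sub>R u ?k) \<le> \<mu> * B + (1 - \<mu>) * B"
    using * by (intro norm_convex_le u) auto
  then show ?thesis unfolding *(4) by (simp add: algebra_simps)
qed (use \<psi> u in auto)

text \<open>As a function of the unknown \<open>z\<close> the delayed value is \<open>z\<close>
  itself, constant, or affine; the last occurs when the right interpolation node is
  \<open>n\<close>. Brouwer requires this continuity.\<close>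

lemma delayed_value_continuous:
  fixes \<psi> :: "real \<Rightarrow> real ^ 'd"
  assumes h: "0 < h" and \<tau>: "0 \<le> \<tau> (real n * h)"
  shows "continuous_on S (\<lambda>z. delayed_value ip \<tau> \<psi> h (u(n := z)) n)"
proof (rule delayed_value_cases[of h \<tau> n ip \<psi>, OF h \<tau>])
  fix \<mu> :: real
  let ?k = "nat \<lfloor>(real n * h - \<tau> (real n * h)) / h\<rfloor>"
  assume *: "?k < n" "\<And>u. delayed_value ip \<tau> \<psi> h u n = \<mu> *\<^sub>R u (Suc ?k) + (1 - \<mu>) *\<^sub>R u ?k"
  show ?thesis unfolding *(2) using *(1)
    by (cases "Suc ?k = n") (auto intro!: continuous_intros)
qed auto

text \<open>Brouwer gives a solution of the implicit equation near \<open>y n\<close>; by uniqueness it is \<open>ys n\<close>.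
  This localises \<open>ys\<close> without any growth condition on \<open>f\<close>.\<close>

lemma implicit_solution_close:
  fixes f :: "real ^ 'd \<Rightarrow> real ^ 'd \<Rightarrow> real ^ 'd" and \<psi> :: "real \<Rightarrow> real ^ 'd"
  assumes f: "continuous_on UNIV (\<lambda>(a, b). f a b)"
    and K: "\<And>a b. norm a \<le> R + 1 \<Longrightarrow> norm b \<le> R + 1 \<Longrightarrow> norm (f a b) \<le> K"
    and h: "0 < h" "h * K \<le> 1" and \<tau>: "\<And>t. 0 \<le> t \<Longrightarrow> 0 \<le> \<tau> t"
    and ys: "\<And>n. implicit_step ip f \<tau> \<psi> h y ys n (ys n)"
    and ex1: "\<And>n. \<exists>!z. implicit_step ip f \<tau> \<psi> h y ys n z"
    and \<psi>: "\<And>t. 0 \<le> t \<Longrightarrow> t - \<tau> t \<le> 0 \<Longrightarrow> norm (\<psi> (t - \<tau> t)) \<le> R"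
    and y: "\<And>i. i \<le> n \<Longrightarrow> norm (y i) \<le> R"
  shows "norm (ys n - y n) \<le> h * K"
  using y
proof (induction n rule: less_induct)
  case (less n)
  have K0: "0 \<le> K" if "0 \<le> R" using K[of 0 0] that order_trans[OF norm_ge_zero[of "f 0 0"], of K] by auto
  have R0: "0 \<le> R" using less.prems[of 0] norm_ge_zero[of "y 0"] by linarith
  define d where "d = (\<lambda>z. delayed_value ip \<tau> \<psi> h (ys(n := z)) n)"
  define \<Phi> where "\<Phi> = (\<lambda>z. y n + h *\<^sub>R f z (d z))"
  have t0: "0 \<le> real n * h" using h by simp
  have nz: "norm z \<le> R + 1" if "z \<in> cball (y n) 1" for z
    using that less.prems[of n] norm_triangle_ineq[of "y n" "z - y n"] by (auto simp: dist_norm norm_minus_commute)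
  \<comment> \<open>The delayed value may involve earlier intermediate values. By induction these
    lie within \<open>h * K \<le> 1\<close> of the corresponding \<open>y\<close>, hence in the ball
    on which \<open>K\<close> bounds \<open>f\<close>.\<close>
  have prev: "norm (ys l) \<le> R + 1" if "l < n" for l
    using less.IH[OF that] less.prems that h(2) norm_triangle_ineq[of "y l" "ys l - y l"] less.prems[of l] by fastforce
  have nd: "norm (d z) \<le> R + 1" if "z \<in> cball (y n) 1" for z
    unfolding d_def
  proof (rule delayed_value_norm_le[OF h(1)])
    show "norm (\<psi> (real n * h - \<tau> (real n * h))) \<le> R + 1" if "real n * h - \<tau> (real n * h) < 0"
      using \<psi>[OF t0] that by simp
    show "norm ((ys(n := z)) l) \<le> R + 1" if "l \<le> n" for l
      using prev[of l] nz[OF \<open>z \<in> _\<close>] that by auto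
  qed (use \<tau> t0 in auto)
  have fK: "norm (f z (d z)) \<le> K" if "z \<in> cball (y n) 1" for z
    using K nz[OF that] nd[OF that] by blast
  have "continuous_on (cball (y n) 1) (\<lambda>z. (z, d z))"
    unfolding d_def by (intro continuous_intros delayed_value_continuous h \<tau> t0)
  from continuous_on_compose2[OF f this] have cf: "continuous_on (cball (y n) 1) (\<lambda>z. f z (d z))" by simp
  have c\<Phi>: "continuous_on (cball (y n) 1) \<Phi>" unfolding \<Phi>_def by (intro continuous_intros cf)
  have close: "norm (\<Phi> z - y n) \<le> h * K" if "z \<in> cball (y n) 1" for z
    using fK[OF that] h unfolding \<Phi>_def by simp
  \<comment> \<open>\<open>h * K \<le> 1\<close> makes the unit ball about \<open>y n\<close>
    invariant. The fixed point is then an image under the map, which improves its distance from 1 to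
    \<open>h * K\<close>.\<close>
  have maps: "\<Phi> \<in> cball (y n) 1 \<rightarrow> cball (y n) 1"
    using close h(2) by (force simp: dist_norm norm_minus_commute)
  obtain z where z: "z \<in> cball (y n) 1" "\<Phi> z = z"
    by (rule brouwer[OF compact_cball convex_cball _ c\<Phi> maps]) auto
  have "implicit_step ip f \<tau> \<psi> h y ys n z"
    using z(2) unfolding implicit_step_def \<Phi>_def d_def by simp
  then have "ys n = z" using ex1[of n] ys[of n] by blast
  then show ?case using close[OF z(1)] z(2) by simp
qed

section \<open>Uniform grids: Riemann sums and step approximations of continuous paths\<close>

lemma grid_index:
  assumes "0 < h" "0 \<le> t"
  shows "real (nat \<lfloor>t / h\<rfloor>) * h \<le> t" "t < real (Suc (nat \<lfloor>t / h\<rfloor>)) * h"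
proof -
  have rk: "real (nat \<lfloor>t / h\<rfloor>) = of_int \<lfloor>t / h\<rfloor>" using assms by simp
  show "real (nat \<lfloor>t / h\<rfloor>) * h \<le> t"
    unfolding rk using assms of_int_floor_le[of "t / h"] pos_le_divide_eq[of h] by blast
  have "t / h < real (nat \<lfloor>t / h\<rfloor>) + 1" unfolding rk by linarith
  then show "t < real (Suc (nat \<lfloor>t / h\<rfloor>)) * h" using assms by (simp add: pos_divide_less_eq add.commute)
qed

lemma grid_index_eqI:
  assumes "0 < h" "real n * h \<le> t" "t < real (Suc n) * h"
  shows "nat \<lfloor>t / h\<rfloor> = n"
proof -
  have "real n \<le> t / h" "t / h < real n + 1"
    using assms by (simp_all add: pos_le_divide_eq pos_divide_less_eq add.commute)
  then have "\<lfloor>t / h\<rfloor> = int n" by (intro floor_unique) auto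
  then show ?thesis by simp
qed

text \<open>Uniform continuity phrased as an eventuality in \<open>h\<close>, so that the moduli of
  several paths can be combined with further smallness conditions on \<open>h\<close>.\<close>

lemma continuous_on_Icc_modulus:
  fixes u :: "real \<Rightarrow> 'b :: metric_space"
  assumes "continuous_on {0..T} u" "0 < \<kappa>"
  shows "\<forall>\<^sub>F h in at_right 0. \<forall>r\<in>{0..T}. \<forall>r'\<in>{0..T}. \<bar>r - r'\<bar> \<le> h \<longrightarrow> dist (u r) (u r') \<le> \<kappa>"
proof -
  have "uniformly_continuous_on {0..T} u" using assms(1) by (intro compact_uniformly_continuous) auto
  then obtain d where d: "0 < d" "\<And>r r'. r \<in> {0..T} \<Longrightarrow> r' \<in> {0..T} \<Longrightarrow> dist r' r < d \<Longrightarrow> dist (u r') (u r) < \<kappa>"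
    using assms(2) unfolding uniformly_continuous_on_def by metis
  have "\<forall>\<^sub>F h in at_right 0. h < d" using d(1) by (intro eventually_at_rightI[of 0 d]) auto
  then show ?thesis
  proof eventually_elim
    case (elim h)
    then show ?case using d(2) by (force simp: dist_real_def less_imp_le)
  qed
qed

text \<open>If the path oscillates by at most \<kappa>/\<open>T\<close> over a length
  \<open>h\<close>, each cell contributes at most \<open>h\<close> \<kappa>/\<open>T\<close>. The
  sum over \<open>n\<close> cells is at most \<kappa> for all admissible \<open>n\<close> at once,
  because \<open>n\<close> \<open>h\<close> is at most \<open>T\<close>.\<close>

lemma riemann_sum_eventually:
  fixes u :: "real \<Rightarrow> real ^ 'd"
  assumes u: "continuous_on {0..T} u" and "0 < \<kappa>" "0 < T"
  shows "\<forall>\<^sub>F h in at_right 0. \<forall>n. real n * h \<le> T \<longrightarrow>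
    norm ((LINT s:{0..real n * h}|lborel. u s) - (\<Sum>j<n. h *\<^sub>R u (real j * h))) \<le> \<kappa>"
proof -
  have "\<forall>\<^sub>F h in at_right 0. 0 < (h::real)" by (simp add: eventually_at_right_less)
  moreover have "\<forall>\<^sub>F h in at_right 0. \<forall>r\<in>{0..T}. \<forall>r'\<in>{0..T}. \<bar>r - r'\<bar> \<le> h \<longrightarrow> dist (u r) (u r') \<le> \<kappa> / T"
    using assms by (intro continuous_on_Icc_modulus) auto
  ultimately show ?thesis
  proof eventually_elim
    case (elim h)
    have A: "norm (integral {0..real n * h} u - (\<Sum>j<n. h *\<^sub>R u (real j * h))) \<le> real n * h * (\<kappa> / T)"
      if "real n * h \<le> T" for n
      using that
    proof (induction n)
      case (Suc n)
      let ?a = "real n * h" and ?b = "real (Suc n) * h"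
      have ab: "0 \<le> ?a" "?a \<le> ?b" "?b \<le> T" "0 \<le> ?b" using elim(1) Suc.prems by auto
      have cu: "continuous_on S u" if "S \<subseteq> {0..T}" for S using continuous_on_subset[OF u that] .
      have "integral {0..?b} u = integral {0..?a} u + integral {?a..?b} u"
        using ab by (intro Henstock_Kurzweil_Integration.integral_combine[symmetric] integrable_continuous_real cu) auto
      moreover have "integral {?a..?b} (\<lambda>s. u s - u ?a) = integral {?a..?b} u - h *\<^sub>R u ?a"
      proof -
        have "u integrable_on {?a..?b}" using ab by (intro integrable_continuous_real cu) (auto simp del: of_nat_Suc)
        moreover have "?b - ?a = h" by (simp add: algebra_simps)
        ultimately show ?thesis using ab
          by (subst Henstock_Kurzweil_Integration.integral_diff) (simp_all add: integrable_const_ivl del: of_nat_Suc)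
      qed
      moreover have "norm (integral {?a..?b} (\<lambda>s. u s - u ?a)) \<le> \<kappa> / T * (?b - ?a)"
      proof (rule integral_bound)
        show "continuous_on {?a..?b} (\<lambda>s. u s - u ?a)" using ab by (intro continuous_intros cu) auto
        show "norm (u s - u ?a) \<le> \<kappa> / T" if "s \<in> {?a..?b}" for s
        proof -
          have "\<bar>s - ?a\<bar> \<le> h" using that by (auto simp: algebra_simps)
          moreover have "s \<in> {0..T}" "?a \<in> {0..T}" using that ab by auto
          ultimately show ?thesis using elim(2) unfolding dist_norm by blast
        qed
      qed (use ab in auto)
      moreover have "norm (integral {0..?a} u - (\<Sum>j<n. h *\<^sub>R u (real j * h))) \<le> ?a * (\<kappa> / T)"
        using Suc ab by auto
      ultimately have le: "norm ((integral {0..?a} u - (\<Sum>j<n. h *\<^sub>R u (real j * h))) + integral {?a..?b} (\<lambda>s. u s - u ?a))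
          \<le> ?a * (\<kappa> / T) + \<kappa> / T * (?b - ?a)"
        by (intro norm_triangle_mono)
      have eqn: "(integral {0..?a} u - (\<Sum>j<n. h *\<^sub>R u (real j * h))) + integral {?a..?b} (\<lambda>s. u s - u ?a)
        = integral {0..?b} u - (\<Sum>j<Suc n. h *\<^sub>R u (real j * h))"
        using \<open>integral {0..?b} u = _\<close> \<open>integral {?a..?b} (\<lambda>s. u s - u ?a) = _\<close> by simp
      have rhs: "?a * (\<kappa> / T) + \<kappa> / T * (?b - ?a) = ?b * (\<kappa> / T)" by (simp add: algebra_simps)
      show ?case using le unfolding eqn rhs .
    qed simp
    have B: "real n * h * (\<kappa> / T) \<le> \<kappa>" if "real n * h \<le> T" for n
    proof -
      have "real n * h * (\<kappa> / T) \<le> T * (\<kappa> / T)" using that assms by (intro mult_right_mono) auto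
      then show ?thesis using assms by simp
    qed
    have C: "(LINT s:{0..real n * h}|lborel. u s) = integral {0..real n * h} u" if "real n * h \<le> T" for n
      using continuous_on_subset[OF u] that
      by (intro set_borel_integral_eq_integral borel_integrable_atLeastAtMost') auto
    show ?case
    proof (intro allI impI)
      fix n assume n: "real n * h \<le> T"
      show "norm ((LINT s:{0..real n * h}|lborel. u s) - (\<Sum>j<n. h *\<^sub>R u (real j * h))) \<le> \<kappa>"
        unfolding C[OF n] using order_trans[OF A[OF n] B[OF n]] .
    qed
  qed
qed

lemma step_process_uniform_grid:
  assumes "0 < h" "0 \<le> s" "s < real N * h"
  shows "step_process N (\<lambda>j. real j * h) D s \<omega> = D (nat \<lfloor>s / h\<rfloor>) \<omega>"
proof -
  define n where "n = nat \<lfloor>s / h\<rfloor>"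
  have n: "real n * h \<le> s" "s < real (Suc n) * h" unfolding n_def using grid_index[OF assms(1,2)] by auto
  have "real n * h < real N * h" using n assms by linarith
  then have nN: "n < N" using assms(1) by simp
  have "s \<in> {real i * h..<real (Suc i) * h} \<longleftrightarrow> i = n" for i
    using n grid_index_eqI[OF assms(1), of i s] by (metis atLeastLessThan_iff n_def)
  then have "indicator {real i * h..<real (Suc i) * h} s *\<^sub>R D i \<omega> = (if i = n then D i \<omega> else 0)" for i
    by (simp add: indicator_def del: of_nat_Suc atLeastLessThan_iff)
  then show ?thesis using nN unfolding step_process_def n_def[symmetric] by (simp del: of_nat_Suc)
qed

text \<open>The grid has one cell more than the integer part of \<open>T / h\<close>, so that it
  covers \<open>T\<close>. An oscillation of at most the square root of \<delta>/\<open>T\<close>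
  gives a squared error of \<delta>/\<open>T\<close>, integrated over a length
  \<open>T\<close>.\<close>

lemma sq_dist_step_eventually:
  fixes G :: "real \<Rightarrow> 'a \<Rightarrow> real ^ 'm ^ 'd"
  assumes G: "continuous_on {0..T} (\<lambda>s. G s \<omega>)" and "0 < \<delta>" "0 < T"
  shows "\<forall>\<^sub>F h in at_right 0. sq_dist T (step_process (Suc (nat \<lfloor>T / h\<rfloor>)) (\<lambda>j. real j * h) (\<lambda>j. G (real j * h))) G \<omega> \<le> ennreal \<delta>"
proof -
  define \<kappa> where "\<kappa> = sqrt (\<delta> / T)"
  have \<kappa>: "0 < \<kappa>" "\<kappa>\<^sup>2 * T = \<delta>" using assms by (auto simp: \<kappa>_def)
  have "\<forall>\<^sub>F h in at_right 0. 0 < (h::real)" by (simp add: eventually_at_right_less)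
  moreover have "\<forall>\<^sub>F h in at_right 0. \<forall>r\<in>{0..T}. \<forall>r'\<in>{0..T}. \<bar>r - r'\<bar> \<le> h \<longrightarrow> dist (G r \<omega>) (G r' \<omega>) \<le> \<kappa>"
    using continuous_on_Icc_modulus[OF G \<kappa>(1)] .
  ultimately show ?thesis
  proof eventually_elim
    case (elim h)
    have "sq_dist T (step_process (Suc (nat \<lfloor>T / h\<rfloor>)) (\<lambda>j. real j * h) (\<lambda>j. G (real j * h))) G \<omega>
      \<le> (\<integral>\<^sup>+s. ennreal (\<kappa>\<^sup>2) * indicator {0..T} s \<partial>lborel)"
      unfolding sq_dist_def
    proof (rule nn_integral_mono)
      fix s
      show "ennreal ((norm (step_process (Suc (nat \<lfloor>T / h\<rfloor>)) (\<lambda>j. real j * h) (\<lambda>j. G (real j * h)) s \<omega> - G s \<omega>))\<^sup>2) * indicator {0..T} s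
        \<le> ennreal (\<kappa>\<^sup>2) * indicator {0..T} s"
      proof (cases "s \<in> {0..T}")
        case True
        define n where "n = nat \<lfloor>s / h\<rfloor>"
        have n: "real n * h \<le> s" "s < real (Suc n) * h" using grid_index[OF elim(1), of s] True by (auto simp: n_def)
        have "s < real (Suc (nat \<lfloor>T / h\<rfloor>)) * h" using grid_index(2)[OF elim(1), of T] True assms by auto
        then have "step_process (Suc (nat \<lfloor>T / h\<rfloor>)) (\<lambda>j. real j * h) (\<lambda>j. G (real j * h)) s \<omega> = G (real n * h) \<omega>"
          using step_process_uniform_grid[OF elim(1), of s "Suc (nat \<lfloor>T / h\<rfloor>)" "\<lambda>j. G (real j * h)" \<omega>] True by (simp add: n_def)
        moreover have "dist (G (real n * h) \<omega>) (G s \<omega>) \<le> \<kappa>"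
        proof -
          have "real n * h \<in> {0..T}" "\<bar>real n * h - s\<bar> \<le> h" using n True elim(1) by (auto simp: algebra_simps)
          then show ?thesis using elim(2) True by blast
        qed
        ultimately show ?thesis using True by (auto intro!: ennreal_leI power_mono simp: dist_norm)
      qed simp
    qed
    also have "\<dots> = ennreal \<delta>"
      using assms \<kappa> by (simp add: nn_integral_cmult_indicator flip: ennreal_mult)
    finally show ?case .
  qed
qed

text \<open>A delayed value is the current intermediate value, an exact initial value, or a convex
  combination over two nodes within \<open>h\<close> of the delayed time. A node costs its own
  error, the displacement \<delta> of \<open>u\<close> from \<open>y\<close>, and the modulus \<rho>
  of \<open>x\<close>. Adding all three errors gives one bound for all cases.\<close>

lemma delayed_value_error:
  fixes \<psi> x :: "real \<Rightarrow> real ^ 'd"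
  assumes h: "0 < h" and \<tau>: "0 \<le> \<tau> (real n * h)"
    and \<psi>: "real n * h - \<tau> (real n * h) < 0 \<Longrightarrow> \<psi> (real n * h - \<tau> (real n * h)) = x (real n * h - \<tau> (real n * h))"
    and u: "\<And>l. l \<le> n \<Longrightarrow> norm (u l - y l) \<le> \<delta>"
    and x: "\<And>r r'. r \<in> {0..real n * h} \<Longrightarrow> r' \<in> {0..real n * h} \<Longrightarrow> \<bar>r - r'\<bar> \<le> h \<Longrightarrow> norm (x r - x r') \<le> \<rho>"
  defines "e \<equiv> \<lambda>l. norm (y l - x (real l * h))"
    and "k \<equiv> nat \<lfloor>(real n * h - \<tau> (real n * h)) / h\<rfloor>"
  shows "norm (delayed_value ip \<tau> \<psi> h u n - x (real n * h - \<tau> (real n * h)))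
    \<le> e n + e (min n k) + e (min n (Suc k)) + \<delta> + \<rho>"
proof -
  define s where "s = real n * h - \<tau> (real n * h)"
  have ks: "k = nat \<lfloor>s / h\<rfloor>" by (simp add: k_def s_def)
  have e0: "0 \<le> e l" for l by (simp add: e_def)
  have \<delta>0: "0 \<le> \<delta>" using u[of n] norm_ge_zero order_trans by blast
  have "norm (x 0 - x 0) \<le> \<rho>" using h by (intro x) auto
  then have \<rho>0: "0 \<le> \<rho>" by simp
  have "norm (delayed_value ip \<tau> \<psi> h u n - x s) \<le> e n + e (min n k) + e (min n (Suc k)) + \<delta> + \<rho>" (is ?goal)
  proof (rule delayed_value_cases[of h \<tau> n ip \<psi>, OF h \<tau>, folded s_def, folded ks])
    assume *: "s = real n * h" "\<And>u. delayed_value ip \<tau> \<psi> h u n = u n"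
    have "norm (u n - x s) \<le> norm (u n - y n) + e n"
      using norm_triangle_ineq[of "u n - y n" "y n - x s"] by (simp add: e_def *(1))
    then show ?goal unfolding *(2) using u[of n] e0[of "min n k"] e0[of "min n (Suc k)"] \<rho>0 by linarith
  next
    assume *: "s < 0" "\<And>u. delayed_value ip \<tau> \<psi> h u n = \<psi> s"
    show ?goal unfolding *(2) using \<psi> *(1) e0[of n] e0[of "min n k"] e0[of "min n (Suc k)"] \<delta>0 \<rho>0
      by (simp add: s_def)
  next
    fix \<mu> :: real
    assume s: "0 \<le> s" and k: "k < n" "real k * h \<le> s" "s < real (Suc k) * h" and \<mu>: "0 \<le> \<mu>" "\<mu> \<le> 1"
      and dv: "\<And>u. delayed_value ip \<tau> \<psi> h u n = \<mu> *\<^sub>R u (Suc k) + (1 - \<mu>) *\<^sub>R u k"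
    have Sk: "real (Suc k) * h \<le> real n * h" using k(1) h by (intro mult_right_mono) auto
    have near: "norm (u l - x s) \<le> \<delta> + e l + \<rho>" if "l = k \<or> l = Suc k" for l
    proof -
      have ln: "l \<le> n" "real l * h \<in> {0..real n * h}" "s \<in> {0..real n * h}" "\<bar>real l * h - s\<bar> \<le> h"
        using that k s Sk h by (auto simp: algebra_simps)
      have "norm (u l - x s) \<le> norm (u l - y l) + (norm (y l - x (real l * h)) + norm (x (real l * h) - x s))"
        using norm_triangle_ineq[of "u l - y l" "y l - x s"] norm_triangle_ineq[of "y l - x (real l * h)" "x (real l * h) - x s"] by simp
      then show ?thesis using u[OF ln(1)] x[OF ln(2-4)] by (simp add: e_def)
    qed
    have "delayed_value ip \<tau> \<psi> h u n - x s = \<mu> *\<^sub>R (u (Suc k) - x s) + (1 - \<mu>) *\<^sub>R (u k - x s)"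
      unfolding dv by (simp add: algebra_simps)
    also have "norm \<dots> \<le> \<mu> * (\<delta> + e (Suc k) + e k + \<rho>) + (1 - \<mu>) * (\<delta> + e (Suc k) + e k + \<rho>)"
      using near[of k] near[of "Suc k"] e0[of k] e0[of "Suc k"] by (intro norm_convex_le \<mu>) auto
    also have "\<dots> \<le> e n + e (min n k) + e (min n (Suc k)) + \<delta> + \<rho>"
    proof -
      have "min n k = k" "min n (Suc k) = Suc k" using k(1) by auto
      then show ?thesis using e0[of n] by (simp add: algebra_simps)
    qed
    finally show ?goal .
  qed
  then show ?thesis by (simp add: s_def)
qed

text \<open>6 = 2 + 4, from Cauchy-Schwarz for sums of two and of four terms.\<close>

lemma square_sum_bound:
  fixes a b c \<kappa> X Y :: real
  assumes "0 \<le> X" "0 \<le> Y" "0 \<le> a" "0 \<le> b" "0 \<le> c" "0 \<le> \<kappa>" "X \<le> a + \<kappa>" "Y \<le> a + b + c + \<kappa>"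
  shows "X\<^sup>2 + Y\<^sup>2 \<le> 6 * (a\<^sup>2 + b\<^sup>2 + c\<^sup>2 + \<kappa>\<^sup>2)"
proof -
  have "X\<^sup>2 \<le> (a + \<kappa>)\<^sup>2" "Y\<^sup>2 \<le> (a + b + c + \<kappa>)\<^sup>2" using assms by (auto intro!: power_mono)
  moreover have "(a + \<kappa>)\<^sup>2 \<le> 2 * (a\<^sup>2 + \<kappa>\<^sup>2)" using zero_le_power2[of "a - \<kappa>"] by (simp add: power2_eq_square algebra_simps)
  moreover have "(a + b + c + \<kappa>)\<^sup>2 \<le> 4 * (a\<^sup>2 + b\<^sup>2 + c\<^sup>2 + \<kappa>\<^sup>2)"
    using zero_le_power2[of "a - b"] zero_le_power2[of "a - c"] zero_le_power2[of "a - \<kappa>"]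
      zero_le_power2[of "b - c"] zero_le_power2[of "b - \<kappa>"] zero_le_power2[of "c - \<kappa>"]
    by (simp add: power2_eq_square algebra_simps)
  ultimately show ?thesis using zero_le_power2[of b] zero_le_power2[of c] unfolding distrib_left by linarith
qed

section \<open>Error of the split-step backward Euler method\<close>

lemma locally_lipschitz_continuous:
  fixes f :: "'b :: real_normed_vector \<Rightarrow> 'c :: real_normed_vector \<Rightarrow> 'e :: real_normed_vector"
  assumes "\<And>R. R > 0 \<Longrightarrow> \<exists>L. \<forall>x1 x2 y1 y2.
         norm x1 \<le> R \<and> norm x2 \<le> R \<and> norm y1 \<le> R \<and> norm y2 \<le> R \<longrightarrow>
         (norm (f x2 y2 - f x1 y1))\<^sup>2 \<le> L * ((norm (x2 - x1))\<^sup>2 + (norm (y2 - y1))\<^sup>2)"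
  shows "continuous_on UNIV (\<lambda>(a, b). f a b)"
proof -
  have "isCont (\<lambda>z. f (fst z) (snd z)) z0" for z0
  proof -
    define R where "R = norm z0 + 1"
    have "R > 0" by (simp add: R_def add_nonneg_pos)
    from assms[OF this] obtain L where L: "\<And>x1 x2 y1 y2. norm x1 \<le> R \<Longrightarrow> norm x2 \<le> R \<Longrightarrow> norm y1 \<le> R \<Longrightarrow> norm y2 \<le> R \<Longrightarrow>
         (norm (f x2 y2 - f x1 y1))\<^sup>2 \<le> L * ((norm (x2 - x1))\<^sup>2 + (norm (y2 - y1))\<^sup>2)" by metis
    have le: "norm (f (fst z) (snd z) - f (fst z0) (snd z0)) \<le> sqrt \<bar>L\<bar> * norm (z - z0)" if "dist z z0 < 1" for z
    proof -
      have nz: "norm z \<le> R" using that norm_triangle_ineq[of z0 "z - z0"] by (simp add: R_def dist_norm)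
      have "(norm (f (fst z) (snd z) - f (fst z0) (snd z0)))\<^sup>2 \<le> L * ((norm (fst z - fst z0))\<^sup>2 + (norm (snd z - snd z0))\<^sup>2)"
        using nz norm_fst_le[of "fst z" "snd z"] norm_snd_le[of "snd z" "fst z"] norm_fst_le[of "fst z0" "snd z0"] norm_snd_le[of "snd z0" "fst z0"]
        by (intro L) (auto simp: R_def)
      \<comment> \<open>The constant of the hypothesis carries no sign; its absolute value allows
        the square root.\<close>
      also have "\<dots> \<le> \<bar>L\<bar> * ((norm (fst z - fst z0))\<^sup>2 + (norm (snd z - snd z0))\<^sup>2)"
        by (intro mult_right_mono) auto
      also have "\<dots> = (sqrt \<bar>L\<bar> * norm (z - z0))\<^sup>2"
        by (simp add: norm_prod_def power_mult_distrib)
      finally show ?thesis by (rule power2_le_imp_le) simp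
    qed
    have "((\<lambda>z. f (fst z) (snd z) - f (fst z0) (snd z0)) \<longlongrightarrow> 0) (at z0)"
    proof (rule Lim_null_comparison)
      show "\<forall>\<^sub>F z in at z0. norm (f (fst z) (snd z) - f (fst z0) (snd z0)) \<le> sqrt \<bar>L\<bar> * norm (z - z0)"
        using le unfolding eventually_at by (intro exI[of _ 1]) auto
      show "((\<lambda>z. sqrt \<bar>L\<bar> * norm (z - z0)) \<longlongrightarrow> 0) (at z0)"
        by (intro tendsto_eq_intros | simp)+
    qed
    then show ?thesis unfolding isCont_def by (subst (asm) LIM_zero_iff)
  qed
  then show ?thesis by (simp add: continuous_on_eq_continuous_at case_prod_beta)
qed

section \<open>Error quantities on the grid and the local error estimate\<close>

locale ssbe_setting = wiener_basis M F w
  for M :: "'a measure" and F :: "real \<Rightarrow> 'a measure" and w :: "real \<Rightarrow> 'a \<Rightarrow> real ^ 'm" +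
  fixes f :: "real ^ 'd \<Rightarrow> real ^ 'd \<Rightarrow> real ^ 'd"
    and g :: "real ^ 'd \<Rightarrow> real ^ 'd \<Rightarrow> real ^ 'm ^ 'd"
    and \<tau> :: "real \<Rightarrow> real"
    and \<psi> x :: "real \<Rightarrow> 'a \<Rightarrow> real ^ 'd"
    and ip :: interpolation
    and y ys :: "real \<Rightarrow> nat \<Rightarrow> 'a \<Rightarrow> real ^ 'd"
    and T h0 :: real
  assumes delay_nonneg: "\<And>t. t \<ge> 0 \<Longrightarrow> \<tau> t \<ge> 0"
    and delay_bdd: "bdd_below ((\<lambda>t. t - \<tau> t) ` {0..})"
    and delay_continuous: "continuous_on {0..} \<tau>"
    and psi_measurable: "\<And>s. s \<in> {initial_time \<tau>..0} \<Longrightarrow> \<psi> s \<in> borel_measurable (F 0)"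
    and T_pos: "T > 0"
    and solution: "sdde_solution M F w f g \<tau> \<psi> T x"
    and locally_lipschitz:
      "\<And>R. R > 0 \<Longrightarrow> \<exists>L. \<forall>x1 x2 y1 y2.
         norm x1 \<le> R \<and> norm x2 \<le> R \<and> norm y1 \<le> R \<and> norm y2 \<le> R \<longrightarrow>
         max ((norm (f x2 y2 - f x1 y1))\<^sup>2) ((norm (g x2 y2 - g x1 y1))\<^sup>2)
           \<le> L * ((norm (x2 - x1))\<^sup>2 + (norm (y2 - y1))\<^sup>2)"
    and h0_pos: "h0 > 0"
    and scheme:
      "\<And>h \<omega>. 0 < h \<Longrightarrow> h < h0 \<Longrightarrow> \<omega> \<in> space M \<Longrightarrow>
         ssbe_scheme ip f g \<tau> (\<lambda>s. \<psi> s \<omega>) (\<lambda>t. w t \<omega>) h (\<lambda>n. y h n \<omega>) (\<lambda>n. ys h n \<omega>)"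
    and uniquely_solvable:
      "\<And>h \<omega> n. 0 < h \<Longrightarrow> h < h0 \<Longrightarrow> \<omega> \<in> space M \<Longrightarrow>
         \<exists>!z. implicit_step ip f \<tau> (\<lambda>s. \<psi> s \<omega>) h (\<lambda>n. y h n \<omega>) (\<lambda>n. ys h n \<omega>) n z"
    and scheme_adapted:
      "\<And>h n. 0 < h \<Longrightarrow> h < h0 \<Longrightarrow>
         y h n \<in> borel_measurable (F (real n * h)) \<and> ys h n \<in> borel_measurable (F (real n * h))"
begin

abbreviation "\<tau>0 \<equiv> initial_time \<tau>"

definition "lag s \<omega> = x (s - \<tau> s) \<omega>"
definition "dv h n \<omega> = delayed_value ip \<tau> (\<lambda>s. \<psi> s \<omega>) h (\<lambda>l. ys h l \<omega>) n"
definition "err h n \<omega> = y h n \<omega> - x (real n * h) \<omega>"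
definition "\<Phi> s \<omega> = f (x s \<omega>) (lag s \<omega>)"
definition "\<Gamma> s \<omega> = g (x s \<omega>) (lag s \<omega>)"
definition "ferr h n \<omega> = f (ys h n \<omega>) (dv h n \<omega>) - \<Phi> (real n * h) \<omega>"
definition "gerr h n \<omega> = g (ys h n \<omega>) (dv h n \<omega>) - \<Gamma> (real n * h) \<omega>"
definition "dw h n \<omega> = w (real (Suc n) * h) \<omega> - w (real n * h) \<omega>"
text \<open>What the exact solution lacks when both of its integrals are replaced by left-point
  sums. No quantity of the scheme occurs in it.\<close>

definition "res h n \<omega> = x (real n * h) \<omega> - \<psi> 0 \<omega> - (\<Sum>j<n. h *\<^sub>R \<Phi> (real j * h) \<omega> + \<Gamma> (real j * h) \<omega> *v dw h j \<omega>)"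
text \<open>The grid points on both sides of the delayed time; the minimum keeps them at most \<open>n\<close> when
  that time is negative or equal to \<open>t\<^sub>n\<close>, where they carry no information.\<close>

definition "kl h n = min n (nat \<lfloor>(real n * h - \<tau> (real n * h)) / h\<rfloor>)"
definition "kr h n = min n (Suc (nat \<lfloor>(real n * h - \<tau> (real n * h)) / h\<rfloor>))"
text \<open>\<kappa> absorbs the contributions that vanish with \<open>h\<close>: the gap between
  \<open>ys\<close> and \<open>y\<close>, and the modulus of continuity of \<open>x\<close> over one
  step.\<close>

definition "err_sq h \<kappa> n \<omega> = (norm (err h n \<omega>))\<^sup>2 + (norm (err h (kl h n) \<omega>))\<^sup>2 + (norm (err h (kr h n) \<omega>))\<^sup>2 + \<kappa>\<^sup>2"
definition "steps h = nat \<lfloor>T / h\<rfloor>"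
definition "exceeds X c h = {\<omega> \<in> space M. \<exists>n\<in>{..steps h}. c < norm (X h n \<omega> :: real ^ 'd)}"
definition "coeff_ok C \<kappa> h n \<omega> \<longleftrightarrow>
  (norm (ferr h n \<omega>))\<^sup>2 \<le> C * err_sq h \<kappa> n \<omega> \<and> (norm (gerr h n \<omega>))\<^sup>2 \<le> C * err_sq h \<kappa> n \<omega>"
text \<open>A failure counts only while all errors up to that step are small. Once the numerical
  solution has left the neighbourhood of \<open>x\<close>, the local Lipschitz condition gives no
  control, and the stopped recursion asks for none.\<close>

definition "coeff_fails \<epsilon> C \<kappa> h =
  {\<omega> \<in> space M. \<exists>n\<in>{..steps h}. (\<forall>i\<in>{..n}. norm (err h i \<omega>) \<le> \<epsilon>) \<and> \<not> coeff_ok C \<kappa> h n \<omega>}"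

lemma steps_iff: "0 < h \<Longrightarrow> n \<le> steps h \<longleftrightarrow> real n * h \<le> T"
  using T_pos unfolding steps_def by (simp add: le_nat_iff le_floor_iff pos_le_divide_eq)

lemma initial_time_le: "0 \<le> t \<Longrightarrow> \<tau>0 \<le> t - \<tau> t"
  unfolding initial_time_def by (rule cINF_lower[OF delay_bdd]) simp

lemma initial_time_nonpos: "\<tau>0 \<le> 0"
  using initial_time_le[of 0] delay_nonneg[of 0] by simp

lemma f_continuous: "continuous_on UNIV (\<lambda>(a, b). f a b)"
proof (rule locally_lipschitz_continuous)
  fix R :: real assume "R > 0"
  from locally_lipschitz[OF this] show "\<exists>L. \<forall>x1 x2 y1 y2.
         norm x1 \<le> R \<and> norm x2 \<le> R \<and> norm y1 \<le> R \<and> norm y2 \<le> R \<longrightarrow>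
         (norm (f x2 y2 - f x1 y1))\<^sup>2 \<le> L * ((norm (x2 - x1))\<^sup>2 + (norm (y2 - y1))\<^sup>2)"
    by (metis max.bounded_iff)
qed

lemma g_continuous: "continuous_on UNIV (\<lambda>(a, b). g a b)"
proof (rule locally_lipschitz_continuous)
  fix R :: real assume "R > 0"
  from locally_lipschitz[OF this] show "\<exists>L. \<forall>x1 x2 y1 y2.
         norm x1 \<le> R \<and> norm x2 \<le> R \<and> norm y1 \<le> R \<and> norm y2 \<le> R \<longrightarrow>
         (norm (g x2 y2 - g x1 y1))\<^sup>2 \<le> L * ((norm (x2 - x1))\<^sup>2 + (norm (y2 - y1))\<^sup>2)"
    by (metis max.bounded_iff)
qed

lemma f_measurable:
  assumes "X \<in> borel_measurable N" "Y \<in> borel_measurable N"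
  shows "(\<lambda>\<omega>. f (X \<omega>) (Y \<omega>)) \<in> borel_measurable N"
  using borel_measurable_continuous_Pair[OF assms, of f] f_continuous by (simp add: case_prod_beta)

lemma g_measurable:
  assumes "X \<in> borel_measurable N" "Y \<in> borel_measurable N"
  shows "(\<lambda>\<omega>. g (X \<omega>) (Y \<omega>)) \<in> borel_measurable N"
  using borel_measurable_continuous_Pair[OF assms, of g] g_continuous by (simp add: case_prod_beta)

lemma x_continuous: "\<omega> \<in> space M \<Longrightarrow> continuous_on {\<tau>0..T} (\<lambda>t. x t \<omega>)"
  using solution unfolding sdde_solution_def by blast

lemma x_continuous': "\<omega> \<in> space M \<Longrightarrow> continuous_on {0..T} (\<lambda>t. x t \<omega>)"
  by (rule continuous_on_subset[OF x_continuous]) (use initial_time_nonpos in auto)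

lemma x_initial: "\<omega> \<in> space M \<Longrightarrow> t \<in> {\<tau>0..0} \<Longrightarrow> x t \<omega> = \<psi> t \<omega>"
  using solution unfolding sdde_solution_def by blast

lemma lag_continuous:
  assumes "\<omega> \<in> space M"
  shows "continuous_on {0..T} (\<lambda>t. lag t \<omega>)"
  unfolding lag_def
proof (rule continuous_on_compose2[OF x_continuous[OF assms]])
  show "continuous_on {0..T} (\<lambda>t. t - \<tau> t)"
    by (intro continuous_intros continuous_on_subset[OF delay_continuous]) auto
  show "(\<lambda>t. t - \<tau> t) ` {0..T} \<subseteq> {\<tau>0..T}"
  proof safe
    fix t assume "t \<in> {0..T}"
    then show "t - \<tau> t \<in> {\<tau>0..T}" using initial_time_le[of t] delay_nonneg[of t] by simp
  qed
qed

lemma x_measurable: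
  assumes "t \<in> {\<tau>0..T}" "t \<le> s" "0 \<le> s"
  shows "x t \<in> borel_measurable (F s)"
proof (cases "0 \<le> t")
  case True
  then have "t \<in> {0..T}" using assms by simp
  then have "x t \<in> borel_measurable (F t)" using solution unfolding sdde_solution_def by blast
  then show ?thesis using assms(2) by (rule measurable_F_mono)
next
  case False
  have "\<psi> t \<in> borel_measurable (F s)" using psi_measurable[of t] False assms by (auto intro: measurable_F_mono)
  moreover have "x t \<omega> = \<psi> t \<omega>" if "\<omega> \<in> space (F s)" for \<omega>
    using x_initial[of \<omega> t] False assms that space_F by auto
  ultimately show ?thesis by (simp cong: measurable_cong)
qed

lemma lag_measurable: "s \<in> {0..T} \<Longrightarrow> lag s \<in> borel_measurable (F s)"
  using x_measurable[of "s - \<tau> s" s] initial_time_le[of s] delay_nonneg[of s] by (simp add: lag_def[abs_def])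

text \<open>The delay is deterministic, so the case distinction does not depend on \<omega>. A
  positive delay places both interpolation nodes at or before \<open>n\<close>, which is what makes
  the value adapted.\<close>

lemma dv_measurable:
  assumes h: "0 < h" "h < h0"
  shows "dv h n \<in> borel_measurable (F (real n * h))"
proof -
  define s where "s = real n * h - \<tau> (real n * h)"
  define k where "k = nat \<lfloor>s / h\<rfloor>"
  have t0: "0 \<le> real n * h" using h by simp
  have ysm: "ys h l \<in> borel_measurable (F (real n * h))" if "l \<le> n" for l
    using scheme_adapted[OF h, of l] that h by (auto intro: measurable_F_mono mult_right_mono)
  consider "\<tau> (real n * h) = 0" | "\<tau> (real n * h) \<noteq> 0" "s < 0" | "\<tau> (real n * h) \<noteq> 0" "0 \<le> s" by linarith
  then show ?thesis
  proof cases
    case 1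
    then show ?thesis using ysm[of n] unfolding dv_def[abs_def] delayed_value_def by simp
  next
    case 2
    have "\<psi> s \<in> borel_measurable (F (real n * h))"
      using psi_measurable[of s] initial_time_le[OF t0] 2 t0 by (auto simp: s_def intro: measurable_F_mono)
    then show ?thesis using 2 unfolding dv_def[abs_def] delayed_value_def by (simp add: s_def Let_def)
  next
    case 3
    have "real k * h \<le> s" using grid_index(1)[OF h(1) 3(2)] by (simp add: k_def)
    then have "real k * h < real n * h" using 3(1) delay_nonneg[OF t0] by (simp add: s_def)
    then have "Suc k \<le> n" using h by simp
    then have [measurable]: "ys h k \<in> borel_measurable (F (real n * h))" "ys h (Suc k) \<in> borel_measurable (F (real n * h))"
      using ysm by auto
    have eq: "dv h n = (\<lambda>\<omega>. interpolation_weight ip h s k *\<^sub>R ys h (Suc k) \<omega> + (1 - interpolation_weight ip h s k) *\<^sub>R ys h k \<omega>)"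
      using 3 unfolding dv_def[abs_def] delayed_value_def by (simp add: s_def[symmetric] k_def[symmetric] Let_def)
    show ?thesis unfolding eq by measurable
  qed
qed

text \<open>Inserting the implicit equation into the second half of the step collapses the
  splitting: \<open>y\<close> makes an Euler step whose coefficients are evaluated at the
  intermediate and delayed values. Subtracting the same sum along \<open>x\<close> leaves the
  residual.\<close>

lemma err_eq:
  assumes h: "0 < h" "h < h0" and \<omega>: "\<omega> \<in> space M"
  shows "err h n \<omega> = (\<Sum>j<n. h *\<^sub>R ferr h j \<omega> + gerr h j \<omega> *v dw h j \<omega>) - res h n \<omega>"
proof -
  note s = scheme[OF h \<omega>, unfolded ssbe_scheme_def implicit_step_def, folded dv_def]
  have "y h n \<omega> = \<psi> 0 \<omega> + (\<Sum>j<n. h *\<^sub>R f (ys h j \<omega>) (dv h j \<omega>) + g (ys h j \<omega>) (dv h j \<omega>) *v dw h j \<omega>)"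
  proof (induction n)
    case 0
    show ?case using s by simp
  next
    case (Suc n)
    have "ys h n \<omega> = y h n \<omega> + h *\<^sub>R f (ys h n \<omega>) (dv h n \<omega>)"
      using s by (simp add: dv_def fun_upd_idem)
    moreover have "y h (Suc n) \<omega> = ys h n \<omega> + g (ys h n \<omega>) (dv h n \<omega>) *v dw h n \<omega>"
      using s by (simp add: dw_def)
    ultimately show ?case using Suc by (simp add: add.assoc)
  qed
  then show ?thesis
    unfolding err_def res_def ferr_def gerr_def
    by (simp add: sum.distrib sum_subtractf scaleR_diff_right matrix_vector_mult_diff_rdistrib)
qed

lemma ball_bounds:
  assumes "0 < R"
  obtains K where "0 < K" "\<And>a b. norm a \<le> R \<Longrightarrow> norm b \<le> R \<Longrightarrow> norm (f a b) \<le> K \<and> norm (g a b) \<le> K"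
proof -
  have c: "compact (cball (0 :: real ^ 'd) R \<times> cball (0 :: real ^ 'd) R)" by (intro compact_Times compact_cball)
  have "compact ((\<lambda>(a, b). f a b) ` (cball 0 R \<times> cball 0 R))" "compact ((\<lambda>(a, b). g a b) ` (cball 0 R \<times> cball 0 R))"
    using continuous_on_subset[OF f_continuous] continuous_on_subset[OF g_continuous] c
    by (auto intro!: compact_continuous_image)
  then have "bounded ((\<lambda>(a, b). f a b) ` (cball 0 R \<times> cball 0 R))" "bounded ((\<lambda>(a, b). g a b) ` (cball 0 R \<times> cball 0 R))"
    by (auto intro: compact_imp_bounded)
  then obtain K1 K2 where K: "\<And>z. z \<in> cball 0 R \<times> cball 0 R \<Longrightarrow> norm ((\<lambda>(a, b). f a b) z) \<le> K1"
      "\<And>z. z \<in> cball 0 R \<times> cball 0 R \<Longrightarrow> norm ((\<lambda>(a, b). g a b) z) \<le> K2"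
    unfolding bounded_iff by (metis imageI)
  show thesis
  proof (rule that[of "max 1 (max K1 K2)"])
    fix a b :: "real ^ 'd" assume "norm a \<le> R" "norm b \<le> R"
    then have "(a, b) \<in> cball 0 R \<times> cball 0 R" by simp
    from K(1)[OF this] K(2)[OF this] show "norm (f a b) \<le> max 1 (max K1 K2) \<and> norm (g a b) \<le> max 1 (max K1 K2)" by auto
  qed simp
qed

text \<open>\<open>C\<close> and \<open>K\<close> depend on \<open>R\<close> alone, while the
  threshold for \<open>h\<close> may depend on \<omega> and \<kappa>; the later limit in \<kappa>
  with \<open>C\<close> fixed relies on this. The radius \<open>R + 2\<close> arises as follows:
  \<open>x\<close> stays within \<open>R\<close>, an error of at most 1 puts \<open>y\<close> within
  \<open>R + 1\<close>, and \<open>ys\<close> is at most 1 away from \<open>y\<close>.\<close>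

lemma local_error_estimate:
  assumes R: "0 < R"
  obtains C K where "0 \<le> C" "0 < K"
    "\<And>\<kappa> \<omega>. 0 < \<kappa> \<Longrightarrow> \<omega> \<in> space M \<Longrightarrow> (\<forall>s\<in>{\<tau>0..T}. norm (x s \<omega>) \<le> R) \<Longrightarrow>
      \<forall>\<^sub>F h in at_right 0. \<forall>n\<le>steps h. (\<forall>i\<le>n. norm (err h i \<omega>) \<le> 1) \<longrightarrow>
        coeff_ok C \<kappa> h n \<omega> \<and>
        norm (f (ys h n \<omega>) (dv h n \<omega>)) \<le> K \<and> norm (g (ys h n \<omega>) (dv h n \<omega>)) \<le> K"
proof -
  have R2: "0 < R + 2" using R by simp
  obtain K where K: "0 < K" "\<And>a b. norm a \<le> R + 2 \<Longrightarrow> norm b \<le> R + 2 \<Longrightarrow> norm (f a b) \<le> K \<and> norm (g a b) \<le> K"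
    using ball_bounds[OF R2] by blast
  obtain L where L: "\<And>x1 x2 y1 y2. norm x1 \<le> R + 2 \<Longrightarrow> norm x2 \<le> R + 2 \<Longrightarrow> norm y1 \<le> R + 2 \<Longrightarrow> norm y2 \<le> R + 2 \<Longrightarrow>
         max ((norm (f x2 y2 - f x1 y1))\<^sup>2) ((norm (g x2 y2 - g x1 y1))\<^sup>2)
           \<le> L * ((norm (x2 - x1))\<^sup>2 + (norm (y2 - y1))\<^sup>2)"
    using locally_lipschitz[OF R2] by metis
  show thesis
  proof (rule that[of "\<bar>L\<bar> * 6" K])
    fix \<kappa> :: real and \<omega> assume \<kappa>: "0 < \<kappa>" and \<omega>: "\<omega> \<in> space M" and xR': "\<forall>s\<in>{\<tau>0..T}. norm (x s \<omega>) \<le> R"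
    note xR = bspec[OF xR']
    \<comment> \<open>1/\<open>K\<close> gives \<open>h * K \<le> 1\<close>, as required for
      localising \<open>ys\<close>; the last entry lets the displacement \<open>h * K\<close> use
      one half of \<kappa>, and the modulus of \<open>x\<close> uses the other half.\<close>
    define hm where "hm = min h0 (min (1 / K) (\<kappa> / (2 * K)))"
    have "0 < hm" using h0_pos K(1) \<kappa> by (simp add: hm_def)
    then have "\<forall>\<^sub>F h in at_right 0. 0 < h \<and> h < hm" by (intro eventually_at_rightI[of 0 hm]) auto
    moreover have "\<forall>\<^sub>F h in at_right 0. \<forall>r\<in>{0..T}. \<forall>r'\<in>{0..T}. \<bar>r - r'\<bar> \<le> h \<longrightarrow> dist (x r \<omega>) (x r' \<omega>) \<le> \<kappa> / 2"
      using \<kappa> by (intro continuous_on_Icc_modulus x_continuous' \<omega>) auto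
    ultimately show "\<forall>\<^sub>F h in at_right 0. \<forall>n\<le>steps h. (\<forall>i\<le>n. norm (err h i \<omega>) \<le> 1) \<longrightarrow>
        coeff_ok (\<bar>L\<bar> * 6) \<kappa> h n \<omega> \<and>
        norm (f (ys h n \<omega>) (dv h n \<omega>)) \<le> K \<and> norm (g (ys h n \<omega>) (dv h n \<omega>)) \<le> K"
    proof eventually_elim
      case (elim h)
      then have h: "0 < h" "h < h0" "h * K \<le> 1" "h * K \<le> \<kappa> / 2"
        using K(1) by (auto simp: hm_def field_simps)
      show ?case
      proof (intro allI impI)
        fix n assume n: "n \<le> steps h" and e1: "\<forall>i\<le>n. norm (err h i \<omega>) \<le> 1"
        define t where "t = real n * h"
        have t: "0 \<le> t" "t \<le> T" using n h steps_iff by (auto simp: t_def)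
        have ti: "real i * h \<in> {\<tau>0..T}" if "i \<le> n" for i
        proof -
          have "real i * h \<le> t" unfolding t_def using that h by (intro mult_right_mono) auto
          moreover have "0 \<le> real i * h" using h by simp
          ultimately show ?thesis using t initial_time_nonpos by auto
        qed
        have yR: "norm (y h i \<omega>) \<le> R + 1" if "i \<le> n" for i
          using e1 that xR[OF ti[OF that]] norm_triangle_ineq[of "x (real i * h) \<omega>" "err h i \<omega>"]
          by (fastforce simp: err_def)
        have \<psi>x: "\<psi> (r - \<tau> r) \<omega> = x (r - \<tau> r) \<omega>" if "0 \<le> r" "r - \<tau> r \<le> 0" for r
          using x_initial[OF \<omega>, of "r - \<tau> r"] initial_time_le[of r] that by simp
        have close: "norm (ys h i \<omega> - y h i \<omega>) \<le> h * K" if "i \<le> n" for i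
        proof (rule implicit_solution_close[where R = "R + 1"])
          show "implicit_step ip f \<tau> (\<lambda>s. \<psi> s \<omega>) h (\<lambda>n. y h n \<omega>) (\<lambda>n. ys h n \<omega>) n (ys h n \<omega>)" for n
            using scheme[OF h(1,2) \<omega>] unfolding ssbe_scheme_def by blast
          show "\<exists>!z. implicit_step ip f \<tau> (\<lambda>s. \<psi> s \<omega>) h (\<lambda>n. y h n \<omega>) (\<lambda>n. ys h n \<omega>) n z" for n
            by (rule uniquely_solvable[OF h(1,2) \<omega>])
          show "norm (f a b) \<le> K" if "norm a \<le> R + 1 + 1" "norm b \<le> R + 1 + 1" for a b
            using K(2)[of a b] that by simp
          show "norm (\<psi> (t - \<tau> t) \<omega>) \<le> R + 1" if "0 \<le> t" "t - \<tau> t \<le> 0" for t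
            using \<psi>x[OF that] xR[of "t - \<tau> t"] initial_time_le[of t] that T_pos by auto
          show "norm (y h l \<omega>) \<le> R + 1" if "l \<le> i" for l using yR[of l] that \<open>i \<le> n\<close> by simp
        qed (use f_continuous h delay_nonneg in auto)
        have ysR: "norm (ys h i \<omega>) \<le> R + 2" if "i \<le> n" for i
          using close[OF that] yR[OF that] h(3) norm_triangle_ineq[of "y h i \<omega>" "ys h i \<omega> - y h i \<omega>"] by simp
        have lagT: "t - \<tau> t \<in> {\<tau>0..T}" using initial_time_le[OF t(1)] delay_nonneg[OF t(1)] t by auto
        have dR: "norm (dv h n \<omega>) \<le> R + 2"
          unfolding dv_def
        proof (rule delayed_value_norm_le[OF h(1)])
          show "norm (\<psi> (real n * h - \<tau> (real n * h)) \<omega>) \<le> R + 2" if "real n * h - \<tau> (real n * h) < 0"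
            using \<psi>x[OF t(1)] xR[OF lagT] that by (simp add: t_def)
        qed (use ysR delay_nonneg t in \<open>auto simp: t_def\<close>)
        have xlR: "norm (x t \<omega>) \<le> R + 2" "norm (lag t \<omega>) \<le> R + 2"
          using xR[of t] xR[OF lagT] t initial_time_nonpos by (auto simp: lag_def)
        have Y: "norm (dv h n \<omega> - lag t \<omega>) \<le> norm (err h n \<omega>) + norm (err h (kl h n) \<omega>) + norm (err h (kr h n) \<omega>) + h * K + \<kappa> / 2"
          unfolding dv_def lag_def err_def kl_def kr_def t_def
        proof (rule delayed_value_error[OF h(1)])
          show "\<psi> (real n * h - \<tau> (real n * h)) \<omega> = x (real n * h - \<tau> (real n * h)) \<omega>" if "real n * h - \<tau> (real n * h) < 0"
            using \<psi>x[of "real n * h"] t(1) that by (simp add: t_def)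
          show "norm (x r \<omega> - x r' \<omega>) \<le> \<kappa> / 2" if "r \<in> {0..real n * h}" "r' \<in> {0..real n * h}" "\<bar>r - r'\<bar> \<le> h" for r r'
            using elim that t unfolding t_def dist_norm by auto
        qed (use close delay_nonneg t in \<open>auto simp: t_def\<close>)
        have X: "norm (ys h n \<omega> - x t \<omega>) \<le> norm (err h n \<omega>) + h * K"
          using close[of n] norm_triangle_ineq[of "ys h n \<omega> - y h n \<omega>" "y h n \<omega> - x t \<omega>"]
          by (simp add: err_def t_def)
        have "(norm (ys h n \<omega> - x t \<omega>))\<^sup>2 + (norm (dv h n \<omega> - lag t \<omega>))\<^sup>2 \<le> 6 * err_sq h \<kappa> n \<omega>"
          unfolding err_sq_def using X Y h(4) \<kappa> by (intro square_sum_bound) auto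
        then have "\<bar>L\<bar> * ((norm (ys h n \<omega> - x t \<omega>))\<^sup>2 + (norm (dv h n \<omega> - lag t \<omega>))\<^sup>2) \<le> \<bar>L\<bar> * (6 * err_sq h \<kappa> n \<omega>)"
          by (intro mult_left_mono) auto
        moreover have "L * ((norm (ys h n \<omega> - x t \<omega>))\<^sup>2 + (norm (dv h n \<omega> - lag t \<omega>))\<^sup>2)
            \<le> \<bar>L\<bar> * ((norm (ys h n \<omega> - x t \<omega>))\<^sup>2 + (norm (dv h n \<omega> - lag t \<omega>))\<^sup>2)"
          by (intro mult_right_mono) auto
        moreover have "max ((norm (ferr h n \<omega>))\<^sup>2) ((norm (gerr h n \<omega>))\<^sup>2)
            \<le> L * ((norm (ys h n \<omega> - x t \<omega>))\<^sup>2 + (norm (dv h n \<omega> - lag t \<omega>))\<^sup>2)"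
          unfolding ferr_def gerr_def \<Phi>_def \<Gamma>_def t_def[symmetric]
          by (rule L) (use xlR ysR[of n] dR in auto)
        ultimately show "coeff_ok (\<bar>L\<bar> * 6) \<kappa> h n \<omega> \<and>
          norm (f (ys h n \<omega>) (dv h n \<omega>)) \<le> K \<and> norm (g (ys h n \<omega>) (dv h n \<omega>)) \<le> K"
          using K(2)[OF ysR[of n] dR] by (simp add: coeff_ok_def)
      qed
    qed
  qed (use K in auto)
qed

lemma path_continuous:
  assumes "\<omega> \<in> space M"
  shows "continuous_on {0..T} (\<lambda>s. \<Phi> s \<omega>)" "continuous_on {0..T} (\<lambda>s. \<Gamma> s \<omega>)"
proof -
  have c: "continuous_on {0..T} (\<lambda>s. (x s \<omega>, lag s \<omega>))"
    by (intro continuous_intros x_continuous' lag_continuous assms)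
  show "continuous_on {0..T} (\<lambda>s. \<Phi> s \<omega>)" "continuous_on {0..T} (\<lambda>s. \<Gamma> s \<omega>)"
    unfolding \<Phi>_def \<Gamma>_def
    using continuous_on_compose2[OF f_continuous c] continuous_on_compose2[OF g_continuous c] by auto
qed

lemma coeff_measurable:
  assumes "s \<in> {0..T}"
  shows "\<Phi> s \<in> borel_measurable (F s)" "\<Gamma> s \<in> borel_measurable (F s)"
  unfolding \<Phi>_def[abs_def] \<Gamma>_def[abs_def]
  using assms initial_time_nonpos by (auto intro!: f_measurable g_measurable x_measurable lag_measurable)

lemma grid_mem: "0 < h \<Longrightarrow> n \<le> steps h \<Longrightarrow> real n * h \<in> {0..T}"
  using steps_iff by auto

lemma adapted_measurable:
  assumes h: "0 < h" "h < h0" and n: "n \<le> steps h"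
  shows "err h n \<in> borel_measurable (F (real n * h))"
    and "ferr h n \<in> borel_measurable (F (real n * h))"
    and "gerr h n \<in> borel_measurable (F (real n * h))"
    and "res h n \<in> borel_measurable (F (real n * h))"
proof -
  have t: "real n * h \<in> {0..T}" using grid_mem h n by blast
  have [measurable]: "x (real n * h) \<in> borel_measurable (F (real n * h))"
    "y h n \<in> borel_measurable (F (real n * h))" "ys h n \<in> borel_measurable (F (real n * h))"
    "dv h n \<in> borel_measurable (F (real n * h))"
    using x_measurable[of "real n * h" "real n * h"] t initial_time_nonpos scheme_adapted[OF h, of n] dv_measurable[OF h, of n] by auto
  have [measurable]: "\<Phi> (real n * h) \<in> borel_measurable (F (real n * h))" "\<Gamma> (real n * h) \<in> borel_measurable (F (real n * h))"
    using coeff_measurable[OF t] by auto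
  show "err h n \<in> borel_measurable (F (real n * h))"
    unfolding err_def[abs_def] by measurable
  show "ferr h n \<in> borel_measurable (F (real n * h))"
    unfolding ferr_def[abs_def] by (intro borel_measurable_diff f_measurable) measurable
  show "gerr h n \<in> borel_measurable (F (real n * h))"
    unfolding gerr_def[abs_def] by (intro borel_measurable_diff g_measurable) measurable
  have [measurable]: "\<psi> 0 \<in> borel_measurable (F (real n * h))"
    using psi_measurable[of 0] initial_time_nonpos t by (auto intro: measurable_F_mono)
  have "(\<lambda>\<omega>. \<Sum>j<n. h *\<^sub>R \<Phi> (real j * h) \<omega> + \<Gamma> (real j * h) \<omega> *v dw h j \<omega>) \<in> borel_measurable (F (real n * h))"
  proof (rule measurable_F_sum)
    fix j assume j: "j < n"
    have le: "real j * h \<le> real n * h" "real (Suc j) * h \<le> real n * h" using j h by (auto intro!: mult_right_mono)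
    have jT: "real j * h \<in> {0..T}" using order_trans[OF le(1), of T] t h by simp
    have [measurable]: "\<Phi> (real j * h) \<in> borel_measurable (F (real n * h))" "\<Gamma> (real j * h) \<in> borel_measurable (F (real n * h))"
      "w (real (Suc j) * h) \<in> borel_measurable (F (real n * h))" "w (real j * h) \<in> borel_measurable (F (real n * h))"
      using measurable_F_mono[OF coeff_measurable(1)[OF jT] le(1)] measurable_F_mono[OF coeff_measurable(2)[OF jT] le(1)]
        w_measurable le h by auto
    show "(\<lambda>\<omega>. h *\<^sub>R \<Phi> (real j * h) \<omega> + \<Gamma> (real j * h) \<omega> *v dw h j \<omega>) \<in> borel_measurable (F (real n * h))"
      unfolding dw_def by measurable
  qed
  then show "res h n \<in> borel_measurable (F (real n * h))"
    unfolding res_def[abs_def] by measurable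
qed

lemma adapted_measurable_M:
  assumes "0 < h" "h < h0" "n \<in> {..steps h}"
  shows "err h n \<in> borel_measurable M" "ferr h n \<in> borel_measurable M"
    "gerr h n \<in> borel_measurable M" "res h n \<in> borel_measurable M"
  using assms by (auto intro!: measurable_F_M adapted_measurable)

section \<open>The residual of the exact solution\<close>

lemma drift_integral_measurable:
  assumes t: "t \<in> {0<..T}"
  shows "(\<lambda>\<omega>. LINT s:{0..t}|lborel. \<Phi> s \<omega>) \<in> borel_measurable M"
proof (rule borel_measurable_LIMSEQ_metric)
  \<comment> \<open>Measurability in \<omega> is inherited from Riemann sums, which converge for
    every path. These step sizes make \<open>t\<close> itself a grid point, so the sum over
    \<open>Suc k\<close> cells ends exactly there.\<close>
  let ?h = "\<lambda>k. t / real (Suc k)"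
  fix \<omega> assume \<omega>: "\<omega> \<in> space M"
  have fl: "filterlim ?h (at_right 0) sequentially"
    unfolding filterlim_at
  proof
    show "?h \<longlonglongrightarrow> 0" by (rule LIMSEQ_Suc[OF lim_const_over_n])
    show "\<forall>\<^sub>F k in sequentially. ?h k \<in> {0<..} \<and> ?h k \<noteq> 0"
      using t by (intro always_eventually) (simp add: zero_less_divide_iff)
  qed
  show "(\<lambda>k. \<Sum>j<Suc k. ?h k *\<^sub>R \<Phi> (real j * ?h k) \<omega>) \<longlonglongrightarrow> (LINT s:{0..t}|lborel. \<Phi> s \<omega>)"
  proof (rule tendstoI)
    fix e :: real assume "0 < e"
    have eq: "real (Suc k) * ?h k = t" for k by (simp del: of_nat_Suc)
    have "\<forall>\<^sub>F k in sequentially. \<forall>n. real n * ?h k \<le> T \<longrightarrow>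
      norm ((LINT s:{0..real n * ?h k}|lborel. \<Phi> s \<omega>) - (\<Sum>j<n. ?h k *\<^sub>R \<Phi> (real j * ?h k) \<omega>)) \<le> e / 2"
      by (rule eventually_compose_filterlim[OF riemann_sum_eventually[OF path_continuous(1)[OF \<omega>]] fl])
         (use \<open>0 < e\<close> T_pos in auto)
    then show "\<forall>\<^sub>F k in sequentially. dist (\<Sum>j<Suc k. ?h k *\<^sub>R \<Phi> (real j * ?h k) \<omega>) (LINT s:{0..t}|lborel. \<Phi> s \<omega>) < e"
    proof eventually_elim
      case (elim k)
      have "norm ((LINT s:{0..t}|lborel. \<Phi> s \<omega>) - (\<Sum>j<Suc k. ?h k *\<^sub>R \<Phi> (real j * ?h k) \<omega>)) \<le> e / 2"
        using elim[rule_format, of "Suc k", unfolded eq] t by simp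
      then show ?case using \<open>0 < e\<close> unfolding dist_norm by (subst norm_minus_commute) linarith
    qed
  qed
next
  fix k :: nat
  let ?h = "t / real (Suc k)"
  have "\<Phi> (real j * ?h) \<in> borel_measurable M" if "j < Suc k" for j
  proof -
    have "real j * ?h \<le> real (Suc k) * ?h" using that t by (intro mult_right_mono) auto
    then have "real j * ?h \<in> {0..T}" using t by (simp del: of_nat_Suc)
    then show ?thesis using coeff_measurable(1) measurable_F_M by (metis atLeastAtMost_iff)
  qed
  then show "(\<lambda>\<omega>. \<Sum>j<Suc k. ?h *\<^sub>R \<Phi> (real j * ?h) \<omega>) \<in> borel_measurable M"
    by (intro borel_measurable_sum borel_measurable_scaleR borel_measurable_const) (simp del: of_nat_Suc)
qed

lemma elem_integral_grid:
  assumes "0 < h" "n \<le> N"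
  shows "elem_integral w N (\<lambda>j. real j * h) D (real n * h) \<omega> = (\<Sum>j<n. D j \<omega> *v dw h j \<omega>)"
proof -
  have "elem_integral w N (\<lambda>j. real j * h) D (real n * h) \<omega> = (\<Sum>j<N. if j < n then D j \<omega> *v dw h j \<omega> else 0)"
    unfolding elem_integral_def
  proof (rule sum.cong[OF refl])
    fix j
    show "D j \<omega> *v (w (min (real (Suc j) * h) (real n * h)) \<omega> - w (min (real j * h) (real n * h)) \<omega>)
      = (if j < n then D j \<omega> *v dw h j \<omega> else 0)"
    proof (cases "j < n")
      case True
      then have "real (Suc j) * h \<le> real n * h" "real j * h \<le> real n * h" using assms by (auto intro!: mult_right_mono)
      then show ?thesis using True by (simp add: dw_def min_absorb1 del: of_nat_Suc)
    next
      case False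
      then have "real n * h \<le> real (Suc j) * h" "real n * h \<le> real j * h" using assms by (auto intro!: mult_right_mono)
      then show ?thesis using False by (simp add: min_absorb2 del: of_nat_Suc)
    qed
  qed
  also have "\<dots> = (\<Sum>j\<in>{..<N} \<inter> {..<n}. D j \<omega> *v dw h j \<omega>)"
    by (subst sum.inter_restrict) auto
  also have "{..<N} \<inter> {..<n} = {..<n}" using assms by auto
  finally show ?thesis .
qed

text \<open>Pathwise convergence is available for the Riemann sums (\<open>A\<close>) and for the
  square distance between \<Gamma> and its samples (\<open>S\<close>), but not for the stochastic
  integrals (\<open>B\<close>). The maximal inequality reduces \<open>B\<close> to \<open>S\<close>
  with an error governed by \<delta>, uniformly over a grid whose size is unbounded as
  \<open>h\<close> tends to 0.\<close>

lemma residual_tendsto_0: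
  assumes \<kappa>: "0 < \<kappa>"
  shows "((\<lambda>h. prob (exceeds res \<kappa> h)) \<longlongrightarrow> 0) (at_right 0)"
proof -
  have "\<forall>t\<in>{0..T}. \<exists>I. has_ito_integral M F w t \<Gamma> I \<and>
      (AE \<omega> in M. x t \<omega> = \<psi> 0 \<omega> + (LINT s:{0..t}|lborel. \<Phi> s \<omega>) + I \<omega>)"
    using solution unfolding sdde_solution_def \<Phi>_def[abs_def] \<Gamma>_def[abs_def] lag_def by blast
  from bchoice[OF this] obtain I where I0: "\<forall>t\<in>{0..T}. has_ito_integral M F w t \<Gamma> (I t) \<and>
      (AE \<omega> in M. x t \<omega> = \<psi> 0 \<omega> + (LINT s:{0..t}|lborel. \<Phi> s \<omega>) + I t \<omega>)" ..
  have I: "has_ito_integral M F w t \<Gamma> (I t)"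
    and xI: "AE \<omega> in M. x t \<omega> = \<psi> 0 \<omega> + (LINT s:{0..t}|lborel. \<Phi> s \<omega>) + I t \<omega>" if "t \<in> {0..T}" for t
    using bspec[OF I0 that] by (rule conjunct1, rule conjunct2)
  define J where "J = (\<lambda>t \<omega>. LINT s:{0..t}|lborel. \<Phi> s \<omega>)"
  define P where "P = (\<lambda>h. (\<lambda>j. real j * h) ` {1..steps h})"
  define E where "E = (\<lambda>h. elem_integral w (Suc (steps h)) (\<lambda>j. real j * h) (\<lambda>j. \<Gamma> (real j * h)))"
  define Z where "Z = (\<lambda>h. step_process (Suc (steps h)) (\<lambda>j. real j * h) (\<lambda>j. \<Gamma> (real j * h)))"
  define A where "A = (\<lambda>h. {\<omega> \<in> space M. \<exists>n\<in>{1..steps h}. \<kappa> / 2 < norm (J (real n * h) \<omega> - (\<Sum>j<n. h *\<^sub>R \<Phi> (real j * h) \<omega>))})"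
  define B where "B = (\<lambda>h. {\<omega> \<in> space M. \<exists>t\<in>P h. \<kappa> / 2 < norm (I t \<omega> - E h t \<omega>)})"
  define S where "S = (\<lambda>\<delta> h. {\<omega> \<in> space M. ennreal \<delta> < sq_dist T (Z h) \<Gamma> \<omega>})"
  have ad: "adapted_step F (Suc (steps h)) (\<lambda>j. real j * h) (\<lambda>j. \<Gamma> (real j * h))" if h: "0 < h" for h
    unfolding adapted_step_def
    using h coeff_measurable(2)[OF grid_mem[OF h]] by (auto simp: less_Suc_eq_le)
  have j\<Gamma>: "jointly T \<Gamma>" using I[of T] T_pos unfolding has_ito_integral_def jointly_def by auto
  have PT: "P h \<subseteq> {0<..T}" "finite (P h)" if h: "0 < h" for h
    using grid_mem[OF h] h by (fastforce simp: P_def)+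
  have mA: "A h \<in> events" if h: "0 < h" for h
  proof -
    have [measurable]: "(\<lambda>\<omega>. J (real n * h) \<omega>) \<in> borel_measurable M"
      "(\<lambda>\<omega>. \<Sum>j<n. h *\<^sub>R \<Phi> (real j * h) \<omega>) \<in> borel_measurable M" if "n \<in> {1..steps h}" for n
    proof -
      have "real n * h \<in> {0<..T}" using that h by (auto simp flip: steps_iff)
      then show "(\<lambda>\<omega>. J (real n * h) \<omega>) \<in> borel_measurable M" unfolding J_def by (rule drift_integral_measurable)
      have "\<Phi> (real j * h) \<in> borel_measurable M" if "j < n" for j
        using measurable_F_M[OF coeff_measurable(1)[OF grid_mem[OF h, of j]]] h that \<open>n \<in> {1..steps h}\<close> by simp
      then show "(\<lambda>\<omega>. \<Sum>j<n. h *\<^sub>R \<Phi> (real j * h) \<omega>) \<in> borel_measurable M" by simp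
    qed
    show ?thesis unfolding A_def by measurable
  qed
  have mB: "B h \<in> events" if h: "0 < h" for h
    unfolding B_def
  proof (rule sets.sets_Collect_finite_Ex[OF _ PT(2)[OF h]])
    fix t assume "t \<in> P h"
    then have t: "0 \<le> t" "t \<in> {0..T}" using PT(1)[OF h] by auto
    have [measurable]: "I t \<in> borel_measurable M" using I[OF t(2)] unfolding has_ito_integral_def by blast
    have [measurable]: "E h t \<in> borel_measurable M" unfolding E_def by (rule elem_integral_measurable[OF ad[OF h] t(1)])
    show "{\<omega> \<in> space M. \<kappa> / 2 < norm (I t \<omega> - E h t \<omega>)} \<in> events" by measurable
  qed
  have hpos: "\<forall>\<^sub>F h in at_right 0. 0 < h \<and> h < h0" using h0_pos by (intro eventually_at_rightI[of 0 h0]) auto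
  have limA: "((\<lambda>h. prob (A h)) \<longlongrightarrow> 0) (at_right 0)"
  proof (rule prob_tendsto_0_at_right)
    show "\<forall>\<^sub>F h in at_right 0. A h \<in> events" using hpos by eventually_elim (simp add: mA)
    show "AE \<omega> in M. \<forall>\<^sub>F h in at_right 0. \<omega> \<notin> A h"
    proof (rule AE_I2)
      fix \<omega> assume \<omega>: "\<omega> \<in> space M"
      have "\<forall>\<^sub>F h in at_right 0. \<forall>n. real n * h \<le> T \<longrightarrow>
        norm (J (real n * h) \<omega> - (\<Sum>j<n. h *\<^sub>R \<Phi> (real j * h) \<omega>)) \<le> \<kappa> / 2"
        unfolding J_def using \<kappa> T_pos by (intro riemann_sum_eventually path_continuous \<omega>) auto
      with hpos show "\<forall>\<^sub>F h in at_right 0. \<omega> \<notin> A h"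
        by eventually_elim (auto simp: A_def steps_iff not_less)
    qed
  qed
  have limS: "((\<lambda>h. prob (S \<delta> h)) \<longlongrightarrow> 0) (at_right 0)" if "0 < \<delta>" for \<delta>
  proof (rule prob_tendsto_0_at_right)
    show "\<forall>\<^sub>F h in at_right 0. S \<delta> h \<in> events" using hpos
    proof eventually_elim
      case (elim h)
      have [measurable]: "sq_dist T (Z h) \<Gamma> \<in> borel_measurable M"
        unfolding Z_def using elim by (intro sq_dist_measurable jointly_step_process ad j\<Gamma>) auto
      show ?case unfolding S_def by measurable
    qed
    show "AE \<omega> in M. \<forall>\<^sub>F h in at_right 0. \<omega> \<notin> S \<delta> h"
    proof (rule AE_I2)
      fix \<omega> assume \<omega>: "\<omega> \<in> space M"
      have "\<forall>\<^sub>F h in at_right 0. sq_dist T (Z h) \<Gamma> \<omega> \<le> ennreal \<delta>"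
        unfolding Z_def steps_def using that T_pos by (intro sq_dist_step_eventually path_continuous \<omega>) auto
      then show "\<forall>\<^sub>F h in at_right 0. \<omega> \<notin> S \<delta> h" by eventually_elim (auto simp: S_def)
    qed
  qed
  have bound: "prob (exceeds res \<kappa> h)
      \<le> 4 * CARD('m) * \<delta> / (\<kappa> / 2)\<^sup>2 + prob (S (\<delta> / 4) h) + prob (A h)" if h: "0 < h" "h < h0" and \<delta>: "0 < \<delta>" for h \<delta> :: real
  proof -
    \<comment> \<open>The integral equation holds outside a null set that depends on the time. For
      each \<open>h\<close> only finitely many times occur, so these null sets can be
      united.\<close>
    have AEx: "AE \<omega> in M. \<forall>n\<in>{..steps h}. x (real n * h) \<omega> = \<psi> 0 \<omega> + J (real n * h) \<omega> + I (real n * h) \<omega>"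
      unfolding J_def using xI grid_mem[OF h(1)] by (intro AE_finite_allI) auto
    have "prob (exceeds res \<kappa> h) \<le> prob (B h \<union> A h)"
    proof (rule finite_measure_mono_AE)
      show "AE \<omega> in M. \<omega> \<in> exceeds res \<kappa> h \<longrightarrow> \<omega> \<in> B h \<union> A h"
        using AEx
      proof eventually_elim
        case (elim \<omega>)
        show ?case
        proof
          assume "\<omega> \<in> exceeds res \<kappa> h"
          then obtain n where \<omega>: "\<omega> \<in> space M" and n: "n \<le> steps h" "\<kappa> < norm (res h n \<omega>)" by (auto simp: exceeds_def)
          \<comment> \<open>\<open>P h\<close> leaves out time 0, where the comparison of Ito
            integrals is not set up; there the residual vanishes because \<open>x\<close> starts at
            \<psi>.\<close>
          have n0: "n \<noteq> 0"
          proof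
            assume "n = 0"
            then have "res h n \<omega> = 0" using x_initial[OF \<omega>, of 0] initial_time_nonpos by (simp add: res_def)
            then show False using n \<kappa> by simp
          qed
          have Eeq: "E h (real n * h) \<omega> = (\<Sum>j<n. \<Gamma> (real j * h) \<omega> *v dw h j \<omega>)"
            unfolding E_def using n(1) by (intro elem_integral_grid h) simp
          have "res h n \<omega> = (J (real n * h) \<omega> - (\<Sum>j<n. h *\<^sub>R \<Phi> (real j * h) \<omega>)) + (I (real n * h) \<omega> - E h (real n * h) \<omega>)"
            using elim n(1) unfolding res_def Eeq by (simp add: sum.distrib)
          then have "norm (res h n \<omega>) \<le> norm (J (real n * h) \<omega> - (\<Sum>j<n. h *\<^sub>R \<Phi> (real j * h) \<omega>)) + norm (I (real n * h) \<omega> - E h (real n * h) \<omega>)"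
            by (simp add: norm_triangle_ineq)
          then have "\<kappa> / 2 < norm (J (real n * h) \<omega> - (\<Sum>j<n. h *\<^sub>R \<Phi> (real j * h) \<omega>)) \<or> \<kappa> / 2 < norm (I (real n * h) \<omega> - E h (real n * h) \<omega>)"
            using n(2) by linarith
          moreover have "n \<in> {1..steps h}" using n n0 by auto
          ultimately show "\<omega> \<in> B h \<union> A h" unfolding A_def B_def P_def using \<omega> by auto
        qed
      qed
    qed (use mA mB h in auto)
    also have "\<dots> \<le> prob (B h) + prob (A h)" using mA mB h by (intro measure_Un_le) auto
    also have "prob (B h) \<le> 4 * CARD('m) * \<delta> / (\<kappa> / 2)\<^sup>2 + prob (S (\<delta> / 4) h)"
      unfolding B_def S_def E_def Z_def
      by (rule ito_integral_step_maximal[OF I T_pos PT(2,1)[OF h(1)] I ad]) (use T_pos PT[OF h(1)] h \<kappa> \<delta> in auto)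
    finally show ?thesis by simp
  qed
  show ?thesis
  proof (rule tendstoI)
    fix \<eta> :: real assume \<eta>: "0 < \<eta>"
    define \<delta> where "\<delta> = \<eta> * (\<kappa> / 2)\<^sup>2 / (16 * CARD('m))"
    have \<delta>: "0 < \<delta>" "4 * CARD('m) * \<delta> / (\<kappa> / 2)\<^sup>2 = \<eta> / 4" using \<eta> \<kappa> by (auto simp: \<delta>_def)
    have "\<forall>\<^sub>F h in at_right 0. prob (S (\<delta> / 4) h) < \<eta> / 4" "\<forall>\<^sub>F h in at_right 0. prob (A h) < \<eta> / 4"
      using order_tendstoD(2)[OF limS[of "\<delta> / 4"], of "\<eta> / 4"] order_tendstoD(2)[OF limA, of "\<eta> / 4"] \<delta>(1) \<eta> by simp_all
    with hpos show "\<forall>\<^sub>F h in at_right 0. dist (prob (exceeds res \<kappa> h)) 0 < \<eta>"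
    proof eventually_elim
      case (elim h)
      then have "prob (exceeds res \<kappa> h) < \<eta>"
        using bound[of h \<delta>, unfolded \<delta>(2)] \<delta>(1) \<eta> by linarith
      then show ?case by simp
    qed
  qed
qed

section \<open>Grid error: the stopped recursion and convergence in probability\<close>

lemma kl_le: "kl h n \<le> n" and kr_le: "kr h n \<le> n"
  by (simp_all add: kl_def kr_def)

lemma exceeds_measurable:
  assumes "0 < h" "h < h0"
  shows "exceeds err c h \<in> events" "exceeds res c h \<in> events"
  using adapted_measurable_M(1,4)[OF assms] unfolding exceeds_def by measurable

lemma coeff_fails_measurable:
  assumes h: "0 < h" "h < h0"
  shows "coeff_fails \<epsilon> C \<kappa> h \<in> events"
proof -
  note [measurable] = adapted_measurable_M[OF h]
  have [measurable]: "kl h i \<in> {..steps h}" "kr h i \<in> {..steps h}" if "i \<in> {..steps h}" for i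
    using kl_le[of h i] kr_le[of h i] that by auto
  have [measurable]: "(\<lambda>\<omega>. err_sq h \<kappa> i \<omega>) \<in> borel_measurable M" if "i \<in> {..steps h}" for i
    unfolding err_sq_def using that by measurable
  have [measurable]: "i \<in> {..steps h}" if "i \<in> {..n}" "n \<in> {..steps h}" for i n using that by auto
  show ?thesis unfolding coeff_fails_def coeff_ok_def by measurable
qed

text \<open>At the first exceedance the stopped sum equals error plus residual, so off the two bad
  events its norm is at least \<epsilon> - \<kappa>. The last term is Chebyshev at this level,
  applied to the Gronwall bound.\<close>

lemma grid_error_bound:
  fixes \<epsilon> \<kappa> C h :: real
  assumes h: "0 < h" "h < h0" "h \<le> 1" and \<kappa>: "0 < \<kappa>" "\<kappa> < \<epsilon>" "\<epsilon> \<le> 1" and C: "0 \<le> C"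
  shows "prob (exceeds err \<epsilon> h) \<le>
    prob (exceeds res \<kappa> h) +
    prob (coeff_fails \<epsilon> C \<kappa> h) +
    \<kappa>\<^sup>2 * exp ((1 + 4 * (2 + CARD('m)) * (7 * C)) * T) / (\<epsilon> - \<kappa>)\<^sup>2"
proof -
  define N where "N = steps h"
  note m [measurable] = adapted_measurable_M[OF h(1,2)]
  \<comment> \<open>All conditions range over every index up to \<open>n\<close>: a step that fails
    therefore stops all later ones, and \<open>ok n\<close> is decided by what is known at time
    \<open>n * h\<close>.\<close>
  define ok where "ok = (\<lambda>n \<omega>. \<forall>i\<in>{..n}. norm (err h i \<omega>) \<le> \<epsilon> \<and> norm (res h i \<omega>) \<le> \<kappa> \<and> coeff_ok C \<kappa> h i \<omega>)"
  define \<alpha> where "\<alpha> = (\<lambda>n \<omega>. if ok n \<omega> then ferr h n \<omega> else 0)"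
  define \<beta> where "\<beta> = (\<lambda>n \<omega>. if ok n \<omega> then gerr h n \<omega> else 0)"
  define mm where "mm = (\<lambda>n \<omega>. \<Sum>j<n. h *\<^sub>R \<alpha> j \<omega> + \<beta> j \<omega> *v (w (real (Suc j) * h) \<omega> - w (real j * h) \<omega>))"
  define MM where "MM = (\<lambda>n \<omega>. (norm (mm n \<omega>))\<^sup>2 + (norm (mm (kl h n) \<omega>))\<^sup>2 + (norm (mm (kr h n) \<omega>))\<^sup>2 + \<kappa>\<^sup>2)"
  \<comment> \<open>While \<open>ok\<close> holds, three errors of size at most 1 and
    \<open>\<kappa> \<le> 1\<close> give \<open>err_sq\<close> at most 4.\<close>
  define B where "B = sqrt (C * 4)"
  have okm: "ok i \<omega>" if "ok n \<omega>" "i \<le> n" for i n \<omega> using that by (auto simp: ok_def)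
  \<comment> \<open>This identity closes the recursion: as long as nothing has stopped, errors in
    the coefficient bounds can be exchanged for values of \<open>mm\<close>, up to the
    residual.\<close>
  have mm_ok: "mm n \<omega> = err h n \<omega> + res h n \<omega>" if "\<omega> \<in> space M" "\<And>j. j < n \<Longrightarrow> ok j \<omega>" for n \<omega>
    using err_eq[OF h(1,2) that(1), of n] that(2) unfolding mm_def \<alpha>_def \<beta>_def dw_def by simp
  have F1: "err h i \<in> borel_measurable (F (real n * h))" "ferr h i \<in> borel_measurable (F (real n * h))"
    "gerr h i \<in> borel_measurable (F (real n * h))" "res h i \<in> borel_measurable (F (real n * h))"
    if "n < N" "i \<in> {..n}" for i n
  proof -
    have le: "real i * h \<le> real n * h" using that h by (auto intro!: mult_right_mono)
    have "i \<le> steps h" using that by (simp add: N_def)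
    note a = adapted_measurable[OF h(1,2) this]
    show "err h i \<in> borel_measurable (F (real n * h))" "ferr h i \<in> borel_measurable (F (real n * h))"
      "gerr h i \<in> borel_measurable (F (real n * h))" "res h i \<in> borel_measurable (F (real n * h))"
      by (rule measurable_F_mono[OF _ le], rule a)+
  qed
  have okF: "Measurable.pred (F (real n * h)) (ok n)" if n: "n < N" for n
  proof -
    note [measurable] = F1[OF n]
    have [measurable]: "kl h i \<in> {..n}" "kr h i \<in> {..n}" if "i \<in> {..n}" for i
      using kl_le[of h i] kr_le[of h i] that by auto
    have "(\<lambda>\<omega>. err_sq h \<kappa> i \<omega>) \<in> borel_measurable (F (real n * h))" if "i \<in> {..n}" for i
      unfolding err_sq_def using that by measurable
    note [measurable] = this
    show ?thesis unfolding ok_def coeff_ok_def by measurable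
  qed
  have \<alpha>F: "\<alpha> n \<in> borel_measurable (F (real n * h))" and \<beta>F: "\<beta> n \<in> borel_measurable (F (real n * h))" if n: "n < N" for n
    unfolding \<alpha>_def \<beta>_def using okF[OF n] F1[OF n, of n] by (auto intro!: measurable_If)
  have sq4: "C * err_sq h \<kappa> n \<omega> \<le> C * 4" if "ok n \<omega>" for n \<omega>
  proof -
    have "(norm (err h i \<omega>))\<^sup>2 \<le> 1" if "i \<le> n" for i
    proof -
      have "norm (err h i \<omega>) \<le> 1" using \<open>ok n \<omega>\<close> that \<kappa> by (force simp: ok_def)
      then show ?thesis by (simp add: power_le_one)
    qed
    then have "(norm (err h n \<omega>))\<^sup>2 \<le> 1" "(norm (err h (kl h n) \<omega>))\<^sup>2 \<le> 1" "(norm (err h (kr h n) \<omega>))\<^sup>2 \<le> 1"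
      using kl_le kr_le by auto
    moreover have "\<kappa>\<^sup>2 \<le> 1" using \<kappa> by (simp add: power_le_one)
    ultimately show ?thesis using C unfolding err_sq_def by (intro mult_left_mono) auto
  qed
  have sqm: "C * err_sq h \<kappa> n \<omega> \<le> 7 * C * MM n \<omega>"
    if "ok n \<omega>" "\<omega> \<in> space M" for n \<omega>
  proof -
    have e: "(norm (err h i \<omega>))\<^sup>2 \<le> 2 * (norm (mm i \<omega>))\<^sup>2 + 2 * \<kappa>\<^sup>2" if "i \<le> n" for i
    proof -
      have "mm i \<omega> = err h i \<omega> + res h i \<omega>" using okm[OF \<open>ok n \<omega>\<close>] that by (intro mm_ok \<open>\<omega> \<in> space M\<close>) auto
      then have "(norm (err h i \<omega>))\<^sup>2 \<le> 2 * (norm (mm i \<omega>))\<^sup>2 + 2 * (norm (res h i \<omega>))\<^sup>2"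
        using norm_diff_sq_le[of "mm i \<omega>" "res h i \<omega>" 0] by simp
      moreover have "(norm (res h i \<omega>))\<^sup>2 \<le> \<kappa>\<^sup>2" using \<open>ok n \<omega>\<close> that by (intro power_mono) (auto simp: ok_def)
      ultimately show ?thesis by linarith
    qed
    \<comment> \<open>Each of the three squared errors contributes 2 \<kappa>^2, and
      \<open>err_sq\<close> has one \<kappa>^2 of its own; this is the 7.\<close>
    have "err_sq h \<kappa> n \<omega> \<le> 7 * MM n \<omega>"
      using e[of n] e[OF kl_le[of h n]] e[OF kr_le[of h n]] zero_le_power2[of "norm (mm n \<omega>)"] zero_le_power2[of "norm (mm (kl h n) \<omega>)"] zero_le_power2[of "norm (mm (kr h n) \<omega>)"]
      unfolding err_sq_def MM_def distrib_left by linarith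
    from mult_left_mono[OF this C] show ?thesis by (simp add: mult_ac)
  qed
  have ab: "norm (\<alpha> n \<omega>) \<le> B" "norm (\<beta> n \<omega>) \<le> B"
    "(norm (\<alpha> n \<omega>))\<^sup>2 \<le> 7 * C * MM n \<omega>"
    "(norm (\<beta> n \<omega>))\<^sup>2 \<le> 7 * C * MM n \<omega>"
    if "\<omega> \<in> space M" for n \<omega>
  proof -
    have "norm (\<alpha> n \<omega>) \<le> B \<and> norm (\<beta> n \<omega>) \<le> B \<and> (norm (\<alpha> n \<omega>))\<^sup>2 \<le> 7 * C * MM n \<omega>
      \<and> (norm (\<beta> n \<omega>))\<^sup>2 \<le> 7 * C * MM n \<omega>"
    proof (cases "ok n \<omega>")
      case True
      then have "coeff_ok C \<kappa> h n \<omega>" by (auto simp: ok_def)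
      then have "(norm (ferr h n \<omega>))\<^sup>2 \<le> C * err_sq h \<kappa> n \<omega>" "(norm (gerr h n \<omega>))\<^sup>2 \<le> C * err_sq h \<kappa> n \<omega>" by (auto simp: coeff_ok_def)
      then show ?thesis using True sq4[OF True] sqm[OF True that]
        by (auto simp: \<alpha>_def \<beta>_def B_def intro!: real_le_rsqrt)
    next
      case False
      then show ?thesis using C by (simp add: \<alpha>_def \<beta>_def B_def MM_def)
    qed
    then show "norm (\<alpha> n \<omega>) \<le> B" "norm (\<beta> n \<omega>) \<le> B"
    "(norm (\<alpha> n \<omega>))\<^sup>2 \<le> 7 * C * MM n \<omega>"
    "(norm (\<beta> n \<omega>))\<^sup>2 \<le> 7 * C * MM n \<omega>" by auto
  qed
  define c where "c = 1 + 4 * (2 + CARD('m)) * (7 * C)"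
  have mom: "mm N \<in> borel_measurable (F (real N * h))" "integrable M (\<lambda>\<omega>. (norm (mm N \<omega>))\<^sup>2)"
    "second_moment (mm N) \<le> \<kappa>\<^sup>2 * (1 + c * h) ^ N"
    unfolding mm_def c_def
    by (rule discrete_gronwall_second_moment[where N = N and \<alpha> = \<alpha> and \<beta> = \<beta> and C = "7 * C" and k = "kl h" and k' = "kr h" and B = B,
        OF h(1,3) _ kl_le kr_le \<alpha>F ab(1) ab(3)[unfolded MM_def mm_def] \<beta>F ab(2) ab(4)[unfolded MM_def mm_def] order_refl]; use C in simp)+
  have [measurable]: "mm N \<in> borel_measurable M" using mom(1) h by (intro measurable_F_M) auto
  have c0: "1 \<le> c" using C by (simp add: c_def)
  have "(1 + c * h) ^ N \<le> exp (c * h) ^ N" using c0 h by (intro power_mono) auto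
  also have "\<dots> = exp (c * (real N * h))" by (simp add: exp_of_nat_mult[symmetric] mult_ac)
  also have "\<dots> \<le> exp (c * T)" using steps_iff[OF h(1), of N] c0 by (simp add: N_def)
  finally have "second_moment (mm N) \<le> \<kappa>\<^sup>2 * exp (c * T)"
    using mom(3) by (meson mult_left_mono order_trans zero_le_power2)
  then have p3: "prob {\<omega> \<in> space M. \<epsilon> - \<kappa> \<le> norm (mm N \<omega>)} \<le> \<kappa>\<^sup>2 * exp (c * T) / (\<epsilon> - \<kappa>)\<^sup>2"
    using prob_norm_le_second_moment[of "mm N" "\<epsilon> - \<kappa>"] mom(2) \<kappa> divide_right_mono[of _ _ "(\<epsilon> - \<kappa>)\<^sup>2"]
    by (smt (verit) \<open>mm N \<in> borel_measurable M\<close> zero_le_power2)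
  define A1 where "A1 = exceeds res \<kappa> h"
  define A2 where "A2 = coeff_fails \<epsilon> C \<kappa> h"
  define A3 where "A3 = {\<omega> \<in> space M. \<epsilon> - \<kappa> \<le> norm (mm N \<omega>)}"
  have mA1: "A1 \<in> events" and mA2: "A2 \<in> events"
    unfolding A1_def A2_def using exceeds_measurable(2) coeff_fails_measurable h by auto
  have mA3: "A3 \<in> events" unfolding A3_def by measurable
  have "exceeds err \<epsilon> h \<subseteq> A1 \<union> A2 \<union> A3"
  proof
    fix \<omega> assume "\<omega> \<in> exceeds err \<epsilon> h"
    then obtain n0 where \<omega>: "\<omega> \<in> space M" and n0: "n0 \<le> N" "\<epsilon> < norm (err h n0 \<omega>)" by (auto simp: N_def exceeds_def)
    define n where "n = (LEAST n. \<epsilon> < norm (err h n \<omega>))"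
    have n: "\<epsilon> < norm (err h n \<omega>)" "n \<le> N"
      using LeastI[of "\<lambda>n. \<epsilon> < norm (err h n \<omega>)", OF n0(2)] Least_le[of "\<lambda>n. \<epsilon> < norm (err h n \<omega>)", OF n0(2)] n0(1)
      by (auto simp: n_def)
    have before: "norm (err h i \<omega>) \<le> \<epsilon>" if "i < n" for i
      using not_less_Least[of i "\<lambda>n. \<epsilon> < norm (err h n \<omega>)"] that by (auto simp: n_def)
    show "\<omega> \<in> A1 \<union> A2 \<union> A3"
    proof (rule ccontr)
      assume not: "\<omega> \<notin> A1 \<union> A2 \<union> A3"
      have r: "norm (res h i \<omega>) \<le> \<kappa>" if "i \<le> N" for i
        using not \<omega> that by (auto simp: A1_def exceeds_def N_def not_less)
      have gd: "coeff_ok C \<kappa> h i \<omega>" if "i < n" for i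
      proof -
        have "\<forall>l\<in>{..i}. norm (err h l \<omega>) \<le> \<epsilon>" using before that by simp
        moreover have "i \<in> {..steps h}" using that n(2) by (simp add: N_def)
        ultimately show ?thesis using not \<omega> unfolding A2_def coeff_fails_def by blast
      qed
      \<comment> \<open>No condition is violated before \<open>n\<close>, and at \<open>n\<close>
        the clause on the error is. Hence the coefficients vanish from \<open>n\<close> on, and the
        sum over all \<open>N\<close> steps retains the value at \<open>n\<close>.\<close>
      have okj: "ok j \<omega>" if "j < n" for j using that before r gd n(2) by (auto simp: ok_def)
      have nok: "\<not> ok j \<omega>" if "n \<le> j" for j using n(1) that by (auto simp: ok_def not_le)
      have "mm N \<omega> = (\<Sum>j<N. if j < n then h *\<^sub>R \<alpha> j \<omega> + \<beta> j \<omega> *v (w (real (Suc j) * h) \<omega> - w (real j * h) \<omega>) else 0)"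
        unfolding mm_def using nok by (intro sum.cong) (auto simp: \<alpha>_def \<beta>_def not_less)
      also have "\<dots> = (\<Sum>j\<in>{..<N} \<inter> {..<n}. h *\<^sub>R \<alpha> j \<omega> + \<beta> j \<omega> *v (w (real (Suc j) * h) \<omega> - w (real j * h) \<omega>))"
        by (subst sum.inter_restrict) auto
      also have "{..<N} \<inter> {..<n} = {..<n}" using n(2) by auto
      finally have "mm N \<omega> = mm n \<omega>" by (simp add: mm_def)
      also have "\<dots> = err h n \<omega> + res h n \<omega>" using okj by (intro mm_ok \<omega>) auto
      finally have "norm (mm N \<omega>) \<ge> norm (err h n \<omega>) - norm (res h n \<omega>)"
        using norm_diff_ineq[of "err h n \<omega>" "res h n \<omega>"] by simp
      then have "\<epsilon> - \<kappa> \<le> norm (mm N \<omega>)" using n r[OF n(2)] by linarith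
      then show False using not \<omega> by (simp add: A3_def)
    qed
  qed
  then have "prob (exceeds err \<epsilon> h) \<le> prob (A1 \<union> A2 \<union> A3)"
    using mA1 mA2 mA3 by (intro finite_measure_mono) auto
  also have "\<dots> \<le> prob A1 + prob A2 + prob A3"
    using measure_Un_le[of "A1 \<union> A2" M A3] measure_Un_le[of A1 M A2] mA1 mA2 mA3 by auto
  finally show ?thesis using p3 unfolding A1_def A2_def A3_def c_def by linarith
qed

text \<open>Continuity bounds each path on the whole interval, initial segment included. A countable
  dense set of times makes the exceptional event measurable, and continuity carries the bound to the
  remaining times.\<close>

lemma path_bound:
  assumes "0 < \<eta>"
  obtains R B where "0 < R" "B \<in> events" "prob B < \<eta>"
    "\<And>\<omega>. \<omega> \<in> space M - B \<Longrightarrow> \<forall>s\<in>{\<tau>0..T}. norm (x s \<omega>) \<le> R"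
proof -
  obtain D where D: "countable D" "D \<subseteq> {\<tau>0..T}" "{\<tau>0..T} \<subseteq> closure D"
    using separable[of "{\<tau>0..T}"] by blast
  have cl: "closure D = {\<tau>0..T}" using D(2,3) closure_minimal[of D "{\<tau>0..T}"] by auto
  define B where "B = (\<lambda>R. {\<omega> \<in> space M. \<exists>s\<in>D. R < norm (x s \<omega>)})"
  have mB: "B R \<in> events" for R
  proof -
    have [measurable]: "x s \<in> borel_measurable M" if "s \<in> D" for s
    proof (rule measurable_F_M[OF x_measurable[of s "max s 0"]])
      show "s \<in> {\<tau>0..T}" using that D(2) by blast
    qed auto
    show ?thesis unfolding B_def using D(1) by measurable
  qed
  have le: "norm (x s \<omega>) \<le> R" if \<omega>: "\<omega> \<in> space M - B R" and s: "s \<in> {\<tau>0..T}" for R \<omega> s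
  proof (rule continuous_le_on_closure[where S = D and f = "\<lambda>s. norm (x s \<omega>)"])
    show "continuous_on (closure D) (\<lambda>s. norm (x s \<omega>))"
      unfolding cl using \<omega> by (intro continuous_intros x_continuous) auto
    show "s \<in> closure D" using s cl by simp
    show "norm (x s' \<omega>) \<le> R" if "s' \<in> D" for s' using that \<omega> by (auto simp: B_def not_less)
  qed
  \<comment> \<open>The substitution \<open>R = 1 / h\<close> turns large radii into small
    \<open>h\<close>, so that the same limit lemma applies.\<close>
  have "((\<lambda>h. prob (B (1 / h))) \<longlongrightarrow> 0) (at_right 0)"
  proof (rule prob_tendsto_0_at_right)
    show "AE \<omega> in M. \<forall>\<^sub>F h in at_right 0. \<omega> \<notin> B (1 / h)"
    proof (rule AE_I2)
      fix \<omega> assume \<omega>: "\<omega> \<in> space M"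
      have "bounded ((\<lambda>s. x s \<omega>) ` {\<tau>0..T})"
        by (intro compact_imp_bounded compact_continuous_image x_continuous \<omega>) auto
      then obtain b where b: "0 < b" "\<And>s. s \<in> {\<tau>0..T} \<Longrightarrow> norm (x s \<omega>) \<le> b"
        unfolding bounded_pos by auto
      have "\<forall>\<^sub>F h in at_right 0. 0 < h \<and> h < 1 / b" using b by (intro eventually_at_rightI[of 0 "1 / b"]) auto
      then show "\<forall>\<^sub>F h in at_right 0. \<omega> \<notin> B (1 / h)"
      proof eventually_elim
        case (elim h)
        then have "b \<le> 1 / h" using b(1) by (simp add: field_simps)
        then show ?case using b(2) D(2) by (fastforce simp: B_def not_less)
      qed
    qed
  qed (use mB in simp)
  then have "\<forall>\<^sub>F h in at_right 0. prob (B (1 / h)) < \<eta>" using assms by (intro order_tendstoD(2)[where y = 0]) auto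
  from eventually_happens'[OF _ eventually_conj[OF this eventually_at_right_less]]
  obtain h where "prob (B (1 / h)) < \<eta>" "0 < h" by (auto simp: trivial_limit_at_right_real)
  then show thesis using mB le that[of "1 / h" "B (1 / h)"] by auto
qed

text \<open>The tolerance \<eta> fixes \<open>R\<close>, \<open>R\<close> fixes \<open>C\<close>,
  and only then \<kappa> is taken so small that the Gronwall term, whose exponential involves
  \<open>C\<close> but not \<kappa>, falls below \<eta>/4. Off \<open>B\<close> every path
  eventually avoids the coefficient failures, and the residual at level \<kappa> is already known to
  vanish.\<close>

lemma grid_error_tendsto_0:
  assumes \<epsilon>: "0 < \<epsilon>" "\<epsilon> \<le> 1"
  shows "((\<lambda>h. prob (exceeds err \<epsilon> h)) \<longlongrightarrow> 0) (at_right 0)"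
proof (rule tendstoI)
  fix \<eta> :: real assume \<eta>: "0 < \<eta>"
  have "0 < \<eta> / 4" using \<eta> by simp
  from path_bound[OF this] obtain R B where R: "0 < R" "prob B < \<eta> / 4" and mB: "B \<in> events"
    and Bx: "\<And>\<omega>. \<omega> \<in> space M - B \<Longrightarrow> \<forall>s\<in>{\<tau>0..T}. norm (x s \<omega>) \<le> R"
    by metis
  have hpos: "\<forall>\<^sub>F h in at_right 0. 0 < h \<and> h < h0 \<and> h \<le> 1"
    using h0_pos by (intro eventually_at_rightI[of 0 "min h0 1"]) auto
  obtain C K where C: "0 \<le> C" and CK:
    "\<And>\<kappa> \<omega>. 0 < \<kappa> \<Longrightarrow> \<omega> \<in> space M \<Longrightarrow> (\<forall>s\<in>{\<tau>0..T}. norm (x s \<omega>) \<le> R) \<Longrightarrow>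
      \<forall>\<^sub>F h in at_right 0. \<forall>n\<le>steps h. (\<forall>i\<le>n. norm (err h i \<omega>) \<le> 1) \<longrightarrow>
        coeff_ok C \<kappa> h n \<omega> \<and>
        norm (f (ys h n \<omega>) (dv h n \<omega>)) \<le> K \<and> norm (g (ys h n \<omega>) (dv h n \<omega>)) \<le> K"
    by (rule local_error_estimate[OF R(1)]) blast
  define E where "E = exp ((1 + 4 * (2 + CARD('m)) * (7 * C)) * T)"
  have "((\<lambda>\<kappa>. \<kappa>\<^sup>2 * E / (\<epsilon> - \<kappa>)\<^sup>2) \<longlongrightarrow> 0\<^sup>2 * E / (\<epsilon> - 0)\<^sup>2) (at_right 0)"
    using \<epsilon> by (intro tendsto_intros) auto
  then have "\<forall>\<^sub>F \<kappa> in at_right 0. \<kappa>\<^sup>2 * E / (\<epsilon> - \<kappa>)\<^sup>2 < \<eta> / 4"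
    using \<eta> by (intro order_tendstoD(2)) auto
  moreover have "\<forall>\<^sub>F \<kappa> in at_right 0. 0 < \<kappa> \<and> \<kappa> < \<epsilon>" using \<epsilon> by (intro eventually_at_rightI[of 0 \<epsilon>]) auto
  ultimately have "\<forall>\<^sub>F \<kappa> in at_right 0. \<kappa>\<^sup>2 * E / (\<epsilon> - \<kappa>)\<^sup>2 < \<eta> / 4 \<and> 0 < \<kappa> \<and> \<kappa> < \<epsilon>" by (rule eventually_conj)
  from eventually_happens'[OF _ this]
  obtain \<kappa> where \<kappa>: "\<kappa>\<^sup>2 * E / (\<epsilon> - \<kappa>)\<^sup>2 < \<eta> / 4" "0 < \<kappa>" "\<kappa> < \<epsilon>" by (auto simp: trivial_limit_at_right_real)
  have limA: "((\<lambda>h. prob (coeff_fails \<epsilon> C \<kappa> h - B)) \<longlongrightarrow> 0) (at_right 0)"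
  proof (rule prob_tendsto_0_at_right)
    show "\<forall>\<^sub>F h in at_right 0. coeff_fails \<epsilon> C \<kappa> h - B \<in> events" using hpos by eventually_elim (auto intro: coeff_fails_measurable mB)
    show "AE \<omega> in M. \<forall>\<^sub>F h in at_right 0. \<omega> \<notin> coeff_fails \<epsilon> C \<kappa> h - B"
    proof (rule AE_I2)
      fix \<omega> assume \<omega>: "\<omega> \<in> space M"
      show "\<forall>\<^sub>F h in at_right 0. \<omega> \<notin> coeff_fails \<epsilon> C \<kappa> h - B"
      proof (cases "\<omega> \<in> B")
        case False
        have "\<forall>s\<in>{\<tau>0..T}. norm (x s \<omega>) \<le> R" using Bx[of \<omega>] \<omega> False by blast
        from CK[OF \<kappa>(2) \<omega> this] show ?thesis
        proof eventually_elim
          case (elim h)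
          show ?case
          proof
            assume "\<omega> \<in> coeff_fails \<epsilon> C \<kappa> h - B"
            then obtain n where n: "n \<le> steps h" "\<forall>i\<in>{..n}. norm (err h i \<omega>) \<le> \<epsilon>"
              "\<not> (coeff_ok C \<kappa> h n \<omega>)"
              by (auto simp: coeff_fails_def)
            have "\<forall>i\<le>n. norm (err h i \<omega>) \<le> 1" using n(2) \<epsilon>(2) by force
            then show False using elim n(1,3) by blast
          qed
        qed
      qed simp
    qed
  qed
  have "\<forall>\<^sub>F h in at_right 0. prob (coeff_fails \<epsilon> C \<kappa> h - B) < \<eta> / 4"
    using limA \<eta> by (intro order_tendstoD(2)[where y = 0]) auto
  moreover have "\<forall>\<^sub>F h in at_right 0. prob (exceeds res \<kappa> h) < \<eta> / 4"
    using residual_tendsto_0[OF \<kappa>(2)] \<eta> by (intro order_tendstoD(2)[where y = 0]) auto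
  ultimately show "\<forall>\<^sub>F h in at_right 0. dist (prob (exceeds err \<epsilon> h)) 0 < \<eta>"
    using hpos
  proof eventually_elim
    case (elim h)
    then have h: "0 < h" "h < h0" "h \<le> 1" by auto
    have gb: "prob (exceeds err \<epsilon> h) \<le>
      prob (exceeds res \<kappa> h) + prob (coeff_fails \<epsilon> C \<kappa> h) + \<kappa>\<^sup>2 * E / (\<epsilon> - \<kappa>)\<^sup>2"
      unfolding E_def by (rule grid_error_bound[OF h \<kappa>(2,3) \<epsilon>(2) C])
    have "prob (coeff_fails \<epsilon> C \<kappa> h) \<le> prob ((coeff_fails \<epsilon> C \<kappa> h - B) \<union> B)" using coeff_fails_measurable[OF h(1,2)] mB by (intro finite_measure_mono) auto
    also have "\<dots> \<le> prob (coeff_fails \<epsilon> C \<kappa> h - B) + prob (B)" using coeff_fails_measurable[OF h(1,2)] mB by (intro measure_Un_le) auto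
    finally have "prob (exceeds err \<epsilon> h) < \<eta>"
      using gb elim(1,2) R(2) \<kappa>(1) by linarith
    then show ?case by simp
  qed
qed

section \<open>From the grid to continuous time\<close>

definition "yc h t \<omega> =
  ssbe_continuous ip f g \<tau> (\<lambda>s. \<psi> s \<omega>) (\<lambda>r. w r \<omega>) h (\<lambda>n. y h n \<omega>) (\<lambda>n. ys h n \<omega>) t"

lemma yc_grid:
  assumes h: "0 < h" "h < h0" and \<omega>: "\<omega> \<in> space M" and t: "real n * h \<le> t" "t < real (Suc n) * h"
  shows "yc h t \<omega> = y h n \<omega> + (t - real n * h) *\<^sub>R f (ys h n \<omega>) (dv h n \<omega>) +
    g (ys h n \<omega>) (dv h n \<omega>) *v (w t \<omega> - w (real n * h) \<omega>)"
proof (cases "t \<le> 0")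
  \<comment> \<open>Time 0 belongs to the first cell, but the interpolant is defined there by its
    initial branch; both agree since \<open>y\<close> starts at \<psi>.\<close>
  case True
  moreover have n0: "0 \<le> real n * h" using h by simp
  ultimately have "t = 0" "real n * h = 0" using t(1) by linarith+
  then have "n = 0" "t = 0" using h by auto
  then show ?thesis using scheme[OF h \<omega>] by (simp add: yc_def ssbe_continuous_def ssbe_scheme_def)
next
  case False
  then show ?thesis using grid_index_eqI[OF h(1) t] by (simp add: yc_def ssbe_continuous_def Let_def dv_def)
qed

lemma yc_measurable:
  assumes h: "0 < h" "h < h0" and t: "t \<in> {0..T}"
  shows "yc h t \<in> borel_measurable M"
proof -
  define n where "n = nat \<lfloor>t / h\<rfloor>"
  have n: "real n * h \<le> t" "t < real (Suc n) * h" unfolding n_def using grid_index[OF h(1), of t] t by auto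
  have n0: "0 \<le> real n * h" using h by simp
  have [measurable]: "y h n \<in> borel_measurable M" "ys h n \<in> borel_measurable M" "dv h n \<in> borel_measurable M"
    using scheme_adapted[OF h, of n] dv_measurable[OF h, of n] measurable_F_M n0 by auto
  have [measurable]: "w t \<in> borel_measurable M" "w (real n * h) \<in> borel_measurable M" using n0 t by auto
  note [measurable] = f_measurable[of "ys h n" M "dv h n"] g_measurable[of "ys h n" M "dv h n"]
  have "(\<lambda>\<omega>. y h n \<omega> + (t - real n * h) *\<^sub>R f (ys h n \<omega>) (dv h n \<omega>) +
    g (ys h n \<omega>) (dv h n \<omega>) *v (w t \<omega> - w (real n * h) \<omega>)) \<in> borel_measurable M" by measurable
  then show ?thesis using yc_grid[OF h _ n] by (simp cong: measurable_cong)
qed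

lemma x_measurable_M: "t \<in> {0..T} \<Longrightarrow> x t \<in> borel_measurable M"
  using measurable_F_M[OF x_measurable[of t t]] initial_time_nonpos by simp

lemma w_continuous_AE: "AE \<omega> in M. continuous_on {0..T} (\<lambda>t. w t \<omega>)"
proof -
  have "AE \<omega> in M. continuous_on {0..} (\<lambda>t. w t \<omega>)" using wiener unfolding wiener_process_def by blast
  then show ?thesis by eventually_elim (auto intro: continuous_on_subset)
qed

text \<open>One \<epsilon> is spent on the grid error and another on the last incomplete step. In
  that step the coefficients are bounded by \<open>K\<close>, because the grid error is at most 1,
  so its drift is small with \<open>h\<close> and its noise term with the modulus of
  \<open>w\<close>.\<close>

lemma uniform_error_tendsto_0:
  assumes \<epsilon>: "0 < \<epsilon>" "\<epsilon> \<le> 1" and D: "countable D" "D \<subseteq> {0..T}"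
  shows "((\<lambda>h. prob {\<omega> \<in> space M. \<exists>t\<in>D. 2 * \<epsilon> < norm (yc h t \<omega> - x t \<omega>)}) \<longlongrightarrow> 0) (at_right 0)"
proof (rule tendstoI)
  fix \<eta> :: real assume \<eta>: "0 < \<eta>"
  have "0 < \<eta> / 4" using \<eta> by simp
  from path_bound[OF this] obtain R B where R: "0 < R" "prob B < \<eta> / 4" and mB: "B \<in> events"
    and Bx: "\<And>\<omega>. \<omega> \<in> space M - B \<Longrightarrow> \<forall>s\<in>{\<tau>0..T}. norm (x s \<omega>) \<le> R"
    by metis
  have hpos: "\<forall>\<^sub>F h in at_right 0. 0 < h \<and> h < h0"
    using h0_pos by (intro eventually_at_rightI[of 0 h0]) auto
  obtain C K where K: "0 < K" and CK:
    "\<And>\<kappa> \<omega>. 0 < \<kappa> \<Longrightarrow> \<omega> \<in> space M \<Longrightarrow> (\<forall>s\<in>{\<tau>0..T}. norm (x s \<omega>) \<le> R) \<Longrightarrow>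
      \<forall>\<^sub>F h in at_right 0. \<forall>n\<le>steps h. (\<forall>i\<le>n. norm (err h i \<omega>) \<le> 1) \<longrightarrow>
        coeff_ok C \<kappa> h n \<omega> \<and>
        norm (f (ys h n \<omega>) (dv h n \<omega>)) \<le> K \<and> norm (g (ys h n \<omega>) (dv h n \<omega>)) \<le> K"
    by (rule local_error_estimate[OF R(1)]) blast
  define G where "G = (\<lambda>h. {\<omega> \<in> space M. \<exists>t\<in>D. 2 * \<epsilon> < norm (yc h t \<omega> - x t \<omega>)})"
  have mG: "G h \<in> events" if h: "0 < h" "h < h0" for h
  proof -
    have [measurable]: "yc h t \<in> borel_measurable M" "x t \<in> borel_measurable M" if "t \<in> D" for t
      using yc_measurable[OF h] x_measurable_M D(2) that by auto
    show ?thesis unfolding G_def using D(1) by measurable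
  qed
  have lim: "((\<lambda>h. prob (G h - exceeds err \<epsilon> h - B)) \<longlongrightarrow> 0) (at_right 0)"
  proof (rule prob_tendsto_0_at_right)
    show "\<forall>\<^sub>F h in at_right 0. G h - exceeds err \<epsilon> h - B \<in> events" using hpos by eventually_elim (auto intro: exceeds_measurable mG mB)
    have "AE \<omega> in M. \<omega> \<in> space M" by (rule AE_space)
    with w_continuous_AE show "AE \<omega> in M. \<forall>\<^sub>F h in at_right 0. \<omega> \<notin> G h - exceeds err \<epsilon> h - B"
    proof eventually_elim
      case (elim \<omega>)
      note cw = elim(1) and \<omega> = elim(2)
      show ?case
      proof (cases "\<omega> \<in> B")
        case False
        have xR: "\<forall>s\<in>{\<tau>0..T}. norm (x s \<omega>) \<le> R" using Bx[of \<omega>] \<omega> False by blast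
        \<comment> \<open>A third each for the drift term, the noise term and the modulus of
          \<open>x\<close>.\<close>
        define \<theta> where "\<theta> = \<epsilon> / 3"
        have \<theta>: "0 < \<theta>" using \<epsilon> by (simp add: \<theta>_def)
        have "\<forall>\<^sub>F h in at_right 0. \<forall>r\<in>{0..T}. \<forall>r'\<in>{0..T}. \<bar>r - r'\<bar> \<le> h \<longrightarrow> dist (w r \<omega>) (w r' \<omega>) \<le> \<theta> / K"
          using \<theta> K by (intro continuous_on_Icc_modulus cw) auto
        moreover have "\<forall>\<^sub>F h in at_right 0. \<forall>r\<in>{0..T}. \<forall>r'\<in>{0..T}. \<bar>r - r'\<bar> \<le> h \<longrightarrow> dist (x r \<omega>) (x r' \<omega>) \<le> \<theta>"
          using \<theta> by (intro continuous_on_Icc_modulus x_continuous' \<omega>) auto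
        moreover have "\<forall>\<^sub>F h in at_right 0. 0 < h \<and> h < \<theta> / K"
          using \<theta> K by (intro eventually_at_rightI[of 0 "\<theta> / K"]) auto
        \<comment> \<open>Only the bound \<open>K\<close> is wanted from the local estimate at this
          point, so its tolerance may be any positive number, here 1.\<close>
        ultimately show ?thesis using hpos CK[OF zero_less_one \<omega> xR]
        proof eventually_elim
          case (elim h)
          have h: "0 < h" "h < h0" using elim by auto
          show ?case
          proof
            assume a: "\<omega> \<in> G h - exceeds err \<epsilon> h - B"
            then obtain t where t: "t \<in> D" "2 * \<epsilon> < norm (yc h t \<omega> - x t \<omega>)" by (auto simp: G_def)
            have eE: "norm (err h n \<omega>) \<le> \<epsilon>" if "n \<le> steps h" for n using a \<omega> that by (auto simp: exceeds_def not_less)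
            have tT: "t \<in> {0..T}" using t D by auto
            define n where "n = nat \<lfloor>t / h\<rfloor>"
            have n: "real n * h \<le> t" "t < real (Suc n) * h" unfolding n_def using grid_index[OF h(1), of t] tT by auto
            have nT: "n \<le> steps h" using n(1) tT h by (auto simp: steps_iff)
            have rn: "real n * h \<in> {0..T}" using grid_mem[OF h(1) nT] .
            have dt: "\<bar>t - real n * h\<bar> \<le> h" "0 \<le> t - real n * h" "t - real n * h \<le> h" "\<bar>real n * h - t\<bar> \<le> h"
              using n by (auto simp: algebra_simps)
            have "\<forall>i\<le>n. norm (err h i \<omega>) \<le> 1" using eE nT \<epsilon>(2) by (meson le_trans order_trans)
            then have fK: "norm (f (ys h n \<omega>) (dv h n \<omega>)) \<le> K" and gK: "norm (g (ys h n \<omega>) (dv h n \<omega>)) \<le> K"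
              using elim(5) nT by auto
            define u1 where "u1 = (t - real n * h) *\<^sub>R f (ys h n \<omega>) (dv h n \<omega>)"
            define u2 where "u2 = g (ys h n \<omega>) (dv h n \<omega>) *v (w t \<omega> - w (real n * h) \<omega>)"
            define u3 where "u3 = x (real n * h) \<omega> - x t \<omega>"
            have "norm u1 \<le> h * K"
              unfolding u1_def using fK dt h by (auto intro!: mult_mono)
            also have "\<dots> \<le> \<theta>" using elim(3) K by (simp add: field_simps)
            finally have 1: "norm u1 \<le> \<theta>" .
            have "norm u2 \<le> K * (\<theta> / K)"
            proof -
              have "norm (w t \<omega> - w (real n * h) \<omega>) \<le> \<theta> / K"
                using elim(1) tT rn dt(1) unfolding dist_norm by blast
              then show ?thesis unfolding u2_def using gK K
                by (intro order_trans[OF norm_matrix_vector_mult_le] mult_mono) auto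
            qed
            then have 2: "norm u2 \<le> \<theta>" using K by simp
            have 3: "norm u3 \<le> \<theta>"
              using elim(2) tT rn dt(4) unfolding dist_norm u3_def by blast
            have "yc h t \<omega> - x t \<omega> = err h n \<omega> + (u1 + (u2 + u3))"
              unfolding yc_grid[OF h \<omega> n] err_def u1_def u2_def u3_def by simp
            also have "norm \<dots> \<le> \<epsilon> + (\<theta> + (\<theta> + \<theta>))"
              using eE[OF nT] 1 2 3 by (intro norm_triangle_mono)
            finally show False using t(2) by (simp add: \<theta>_def)
          qed
        qed
      qed simp
    qed
  qed
  have "\<forall>\<^sub>F h in at_right 0. prob (G h - exceeds err \<epsilon> h - B) < \<eta> / 4"
    using lim \<eta> by (intro order_tendstoD(2)[where y = 0]) auto
  moreover have "\<forall>\<^sub>F h in at_right 0. prob (exceeds err \<epsilon> h) < \<eta> / 4"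
    using grid_error_tendsto_0[OF \<epsilon>] \<eta> by (intro order_tendstoD(2)[where y = 0]) auto
  ultimately have "\<forall>\<^sub>F h in at_right 0. dist (prob (G h)) 0 < \<eta>"
    using hpos
  proof eventually_elim
    case (elim h)
    then have m: "exceeds err \<epsilon> h \<in> events" "G h \<in> events" using exceeds_measurable mG by auto
    have "prob (G h) \<le> prob ((G h - exceeds err \<epsilon> h - B) \<union> exceeds err \<epsilon> h \<union> B)"
      using m mB by (intro finite_measure_mono) auto
    also have "\<dots> \<le> prob (G h - exceeds err \<epsilon> h - B) + prob (exceeds err \<epsilon> h) + prob (B)"
      using measure_Un_le[of "(G h - exceeds err \<epsilon> h - B) \<union> exceeds err \<epsilon> h" M "B"] measure_Un_le[of "G h - exceeds err \<epsilon> h - B" M "exceeds err \<epsilon> h"] m mB by auto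
    also have "\<dots> < \<eta>" using elim R(2) \<eta> by linarith
    finally show ?case by simp
  qed
  then show "\<forall>\<^sub>F h in at_right 0. dist (prob {\<omega> \<in> space M. \<exists>t\<in>D. 2 * \<epsilon> < norm (yc h t \<omega> - x t \<omega>)}) 0 < \<eta>"
    unfolding G_def .
qed

end

section \<open>Mean-square convergence\<close>

text \<open>A value above the right-hand side would persist on a small interval to the right, which
  contains a rational. \<open>T\<close> has no such interval and is added to the index set. With
  right continuity as hypothesis, the pieces of the interpolant need not be glued at the grid
  points.\<close>

lemma SUP_Icc_right_continuous:
  fixes u :: "real \<Rightarrow> ennreal"
  assumes u: "\<And>t. 0 \<le> t \<Longrightarrow> t < T \<Longrightarrow> (u \<longlongrightarrow> u t) (at_right t)"
  shows "(SUP t\<in>{0..T}. u t) \<le> (SUP t\<in>insert T (\<rat> \<inter> {0..T}). u t)" (is "_ \<le> ?S")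
proof (rule SUP_least)
  fix t assume t: "t \<in> {0..T}"
  show "u t \<le> ?S"
  proof (cases "t = T")
    case False
    then have tT: "t < T" "0 \<le> t" using t by auto
    show ?thesis
    proof (rule ccontr)
      assume "\<not> u t \<le> ?S"
      then have "\<forall>\<^sub>F s in at_right t. ?S < u s" using order_tendstoD(1)[OF u[OF tT(2,1)]] by auto
      moreover have "\<forall>\<^sub>F s in at_right t. s < T" using tT(1) by (intro eventually_at_rightI[of t T]) auto
      ultimately have "\<forall>\<^sub>F s in at_right t. ?S < u s \<and> s < T" by (rule eventually_conj)
      then obtain b where b: "t < b" "\<And>s. t < s \<Longrightarrow> s < b \<Longrightarrow> ?S < u s \<and> s < T"
        unfolding eventually_at_right_field by blast
      obtain q where q: "q \<in> \<rat>" "t < q" "q < b" using Rats_dense_in_real[OF b(1)] by auto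
      then have "q \<in> insert T (\<rat> \<inter> {0..T})" using b(2) tT by (auto simp: less_imp_le)
      then have "u q \<le> ?S" by (rule SUP_upper)
      then show False using b(2)[OF q(2,3)] by (metis leD)
    qed
  qed (auto intro: SUP_upper)
qed

lemma continuous_on_Icc_at_right:
  fixes v :: "real \<Rightarrow> 'b :: topological_space"
  assumes "continuous_on {a..b} v" "a \<le> t" "t < b"
  shows "(v \<longlongrightarrow> v t) (at_right t)"
proof -
  have "continuous_on {t..b} v" using assms by (auto intro: continuous_on_subset)
  then have "(v \<longlongrightarrow> v t) (at t within {t..b})" using assms unfolding continuous_on by (rule_tac bspec) auto
  then show ?thesis unfolding at_within_Icc_at_right[OF assms(3)] .
qed

lemma norm_diff_powr_le:
  assumes "0 < p"
  shows "norm (a - b :: 'b :: real_normed_vector) powr p \<le> 2 powr p * (norm a powr p + norm b powr p)"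
proof -
  define m where "m = max (norm a) (norm b)"
  have "norm (a - b) \<le> 2 * m" using norm_triangle_ineq4[of a b] by (simp add: m_def)
  then have "norm (a - b) powr p \<le> (2 * m) powr p" using assms by (intro powr_mono2) auto
  also have "\<dots> = 2 powr p * m powr p" by (simp add: powr_mult m_def)
  also have "m powr p \<le> norm a powr p + norm b powr p"
    by (auto simp: m_def max_def)
  finally show ?thesis by simp
qed

context ssbe_setting
begin

text \<open>Times slightly to the right of \<open>t\<close> lie in the same grid cell, so one and
  the same formula applies.\<close>

lemma yc_right_continuous:
  assumes h: "0 < h" "h < h0" and \<omega>: "\<omega> \<in> space M" and w: "continuous_on {0..T} (\<lambda>t. w t \<omega>)"
    and t: "0 \<le> t" "t < T"
  shows "((\<lambda>s. yc h s \<omega>) \<longlongrightarrow> yc h t \<omega>) (at_right t)"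
proof -
  define n where "n = nat \<lfloor>t / h\<rfloor>"
  have n: "real n * h \<le> t" "t < real (Suc n) * h" unfolding n_def using grid_index[OF h(1), of t] t by auto
  have w': "((\<lambda>s. w s \<omega>) \<longlongrightarrow> w t \<omega>) (at_right t)" by (rule continuous_on_Icc_at_right[OF w t])
  define \<phi> where "\<phi> = (\<lambda>s. y h n \<omega> + (s - real n * h) *\<^sub>R f (ys h n \<omega>) (dv h n \<omega>) +
    g (ys h n \<omega>) (dv h n \<omega>) *v (w s \<omega> - w (real n * h) \<omega>))"
  have "(\<phi> \<longlongrightarrow> \<phi> t) (at_right t)"
    unfolding \<phi>_def
    by (intro tendsto_add tendsto_scaleR tendsto_diff tendsto_const tendsto_ident_at w'
        bounded_linear.tendsto[OF matrix_vector_mul_bounded_linear])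
  moreover have "\<forall>\<^sub>F s in at_right t. s < real (Suc n) * h"
    using n(2) by (intro eventually_at_rightI[of t "real (Suc n) * h"]) (simp_all del: of_nat_Suc)
  then have "\<forall>\<^sub>F s in at_right t. \<phi> s = yc h s \<omega>"
    using eventually_at_right_less[of t]
  proof eventually_elim
    case (elim s)
    then have "real n * h \<le> s" using n(1) by linarith
    from yc_grid[OF h \<omega> this elim(1)] show ?case unfolding \<phi>_def by (rule sym)
  qed
  moreover have "\<phi> t = yc h t \<omega>" using yc_grid[OF h \<omega> n] by (simp add: \<phi>_def)
  ultimately show ?thesis using Lim_transform_eventually by fastforce
qed

lemma x_right_continuous:
  assumes "\<omega> \<in> space M" "0 \<le> t" "t < T"
  shows "((\<lambda>s. x s \<omega>) \<longlongrightarrow> x t \<omega>) (at_right t)"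
  by (rule continuous_on_Icc_at_right[OF x_continuous'[OF assms(1)] assms(2,3)])

text \<open>Uniform convergence in probability is upgraded to mean-square convergence by the
  \<open>p\<close>-th moments: \<open>e\<^sup>2 \<le> 4 \<epsilon>\<^sup>2 + \<rho>\<^sup>2 1\<^bsub>e > 2 \<epsilon>\<^esub> + \<rho> powr (2 - p) * e powr p\<close>.\<close>

lemma mean_square_error_bound:
  fixes p A \<epsilon> \<rho> h :: real
  assumes p: "p > 2" and A: "0 < A" and \<epsilon>: "0 < \<epsilon>" and \<rho>: "0 < \<rho>" and h: "0 < h" "h < h0"
    and mx: "(\<integral>\<^sup>+\<omega>. (SUP t\<in>{0..T}. ennreal (norm (x t \<omega>) powr p)) \<partial>M) \<le> ennreal A"
    and my: "(\<integral>\<^sup>+\<omega>. (SUP t\<in>{0..T}. ennreal (norm (yc h t \<omega>) powr p)) \<partial>M) \<le> ennreal A"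
  defines "D \<equiv> insert T (\<rat> \<inter> {0..T})"
  shows "(\<integral>\<^sup>+\<omega>. (SUP t\<in>{0..T}. ennreal ((norm (yc h t \<omega> - x t \<omega>))\<^sup>2)) \<partial>M) \<le>
    ennreal (4 * \<epsilon>\<^sup>2 + \<rho>\<^sup>2 * prob {\<omega> \<in> space M. \<exists>t\<in>D. 2 * \<epsilon> < norm (yc h t \<omega> - x t \<omega>)}
      + \<rho> powr (2 - p) * 2 powr p * (2 * A))"
proof -
  have D: "countable D" "D \<subseteq> {0..T}" using T_pos by (auto simp: D_def countable_Int1 countable_rat)
  define G where "G = {\<omega> \<in> space M. \<exists>t\<in>D. 2 * \<epsilon> < norm (yc h t \<omega> - x t \<omega>)}"
  define c where "c = \<rho> powr (2 - p) * 2 powr p"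
  have c: "0 \<le> c" by (simp add: c_def)
  define Sx where "Sx = (\<lambda>\<omega>. SUP t\<in>D. ennreal (norm (x t \<omega>) powr p))"
  define Sy where "Sy = (\<lambda>\<omega>. SUP t\<in>D. ennreal (norm (yc h t \<omega>) powr p))"
  have [measurable]: "yc h t \<in> borel_measurable M" "x t \<in> borel_measurable M" if "t \<in> D" for t
    using yc_measurable[OF h] x_measurable_M D(2) that by auto
  have [measurable]: "G \<in> events" unfolding G_def using D(1) by measurable
  have [measurable]: "Sx \<in> borel_measurable M" "Sy \<in> borel_measurable M"
    unfolding Sx_def Sy_def using D(1) by (intro borel_measurable_SUP; measurable)+
  have pt: "ennreal ((norm (yc h t \<omega> - x t \<omega>))\<^sup>2) \<le> ennreal (4 * \<epsilon>\<^sup>2) + ennreal (\<rho>\<^sup>2) * indicator G \<omega> + ennreal c * (Sy \<omega> + Sx \<omega>)"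
    if \<omega>: "\<omega> \<in> space M" and t: "t \<in> D" for \<omega> t
  proof -
    define e where "e = norm (yc h t \<omega> - x t \<omega>)"
    consider "e \<le> 2 * \<epsilon>" | "2 * \<epsilon> < e" "e \<le> \<rho>" | "\<rho> < e" by linarith
    then show ?thesis unfolding e_def[symmetric]
    proof cases
      case 1
      then have "e\<^sup>2 \<le> (2 * \<epsilon>)\<^sup>2" by (intro power_mono) (auto simp: e_def)
      then have "ennreal (e\<^sup>2) \<le> ennreal (4 * \<epsilon>\<^sup>2)" by (intro ennreal_leI) (simp add: power_mult_distrib)
      then show "ennreal (e\<^sup>2) \<le> ennreal (4 * \<epsilon>\<^sup>2) + ennreal (\<rho>\<^sup>2) * indicator G \<omega> + ennreal c * (Sy \<omega> + Sx \<omega>)"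
        by (simp add: add_increasing2 add.assoc)
    next
      case 2
      then have "\<omega> \<in> G" using \<omega> t by (auto simp: G_def e_def)
      moreover have "ennreal (e\<^sup>2) \<le> ennreal (\<rho>\<^sup>2)" using 2 by (intro ennreal_leI power_mono) (auto simp: e_def)
      ultimately show "ennreal (e\<^sup>2) \<le> ennreal (4 * \<epsilon>\<^sup>2) + ennreal (\<rho>\<^sup>2) * indicator G \<omega> + ennreal c * (Sy \<omega> + Sx \<omega>)"
        by (simp add: add_increasing add_increasing2)
    next
      case 3
      then have e: "0 < e" using \<rho> by simp
      \<comment> \<open>The exponent \<open>2 - p\<close> is negative, so \<open>e > \<rho>\<close>
        bounds the first factor by its value at \<rho>; here \<open>p > 2\<close> is
        decisive.\<close>
      have "e\<^sup>2 = e powr (2 - p) * e powr p" using e by (simp flip: powr_add)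
      also have "\<dots> \<le> \<rho> powr (2 - p) * e powr p"
        using 3 \<rho> p by (intro mult_right_mono powr_mono2') auto
      also have "\<dots> \<le> \<rho> powr (2 - p) * (2 powr p * (norm (yc h t \<omega>) powr p + norm (x t \<omega>) powr p))"
        unfolding e_def using p by (intro mult_left_mono norm_diff_powr_le) auto
      finally have "ennreal (e\<^sup>2) \<le> ennreal (c * (norm (yc h t \<omega>) powr p + norm (x t \<omega>) powr p))"
        by (intro ennreal_leI) (simp add: c_def mult.assoc)
      also have "\<dots> = ennreal c * (ennreal (norm (yc h t \<omega>) powr p) + ennreal (norm (x t \<omega>) powr p))"
        using c by (simp add: ennreal_mult ennreal_plus)
      also have "\<dots> \<le> ennreal c * (Sy \<omega> + Sx \<omega>)"
        unfolding Sx_def Sy_def using t by (intro mult_left_mono add_mono SUP_upper) auto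
      finally show "ennreal (e\<^sup>2) \<le> ennreal (4 * \<epsilon>\<^sup>2) + ennreal (\<rho>\<^sup>2) * indicator G \<omega> + ennreal c * (Sy \<omega> + Sx \<omega>)"
        by (simp add: add_increasing)
    qed
  qed
  have "AE \<omega> in M. \<omega> \<in> space M" by (rule AE_space)
  \<comment> \<open>The supremum over the uncountable interval is dominated almost surely by a
    measurable function, and monotonicity of the upper integral asks for no more.\<close>
  with w_continuous_AE have sup: "AE \<omega> in M. (SUP t\<in>{0..T}. ennreal ((norm (yc h t \<omega> - x t \<omega>))\<^sup>2))
      \<le> ennreal (4 * \<epsilon>\<^sup>2) + ennreal (\<rho>\<^sup>2) * indicator G \<omega> + ennreal c * (Sy \<omega> + Sx \<omega>)"
  proof eventually_elim
    case (elim \<omega>)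
    have "(SUP t\<in>{0..T}. ennreal ((norm (yc h t \<omega> - x t \<omega>))\<^sup>2)) \<le> (SUP t\<in>D. ennreal ((norm (yc h t \<omega> - x t \<omega>))\<^sup>2))"
      unfolding D_def
      by (intro SUP_Icc_right_continuous tendsto_ennrealI tendsto_intros yc_right_continuous x_right_continuous h elim)
    also have "\<dots> \<le> ennreal (4 * \<epsilon>\<^sup>2) + ennreal (\<rho>\<^sup>2) * indicator G \<omega> + ennreal c * (Sy \<omega> + Sx \<omega>)"
      using pt[OF elim(2)] by (intro SUP_least) auto
    finally show ?case .
  qed
  have "(\<integral>\<^sup>+\<omega>. (SUP t\<in>{0..T}. ennreal ((norm (yc h t \<omega> - x t \<omega>))\<^sup>2)) \<partial>M)
    \<le> (\<integral>\<^sup>+\<omega>. ennreal (4 * \<epsilon>\<^sup>2) + ennreal (\<rho>\<^sup>2) * indicator G \<omega> + ennreal c * (Sy \<omega> + Sx \<omega>) \<partial>M)"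
    by (rule nn_integral_mono_AE[OF sup])
  also have "\<dots> = ennreal (4 * \<epsilon>\<^sup>2) + ennreal (\<rho>\<^sup>2) * emeasure M G + ennreal c * ((\<integral>\<^sup>+\<omega>. Sy \<omega> \<partial>M) + (\<integral>\<^sup>+\<omega>. Sx \<omega> \<partial>M))"
    by (simp add: nn_integral_add nn_integral_cmult nn_integral_cmult_indicator emeasure_space_1)
  also have "\<dots> \<le> ennreal (4 * \<epsilon>\<^sup>2) + ennreal (\<rho>\<^sup>2) * emeasure M G + ennreal c * (ennreal A + ennreal A)"
  proof (intro add_mono mult_left_mono order_refl)
    show "(\<integral>\<^sup>+\<omega>. Sy \<omega> \<partial>M) \<le> ennreal A"
      by (rule order_trans[OF nn_integral_mono my]) (unfold Sy_def, intro SUP_subset_mono D order_refl)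
    show "(\<integral>\<^sup>+\<omega>. Sx \<omega> \<partial>M) \<le> ennreal A"
      by (rule order_trans[OF nn_integral_mono mx]) (unfold Sx_def, intro SUP_subset_mono D order_refl)
  qed simp_all
  also have "\<dots> = ennreal (4 * \<epsilon>\<^sup>2 + \<rho>\<^sup>2 * prob G + c * (2 * A))"
    using A c by (simp add: emeasure_eq_measure ennreal_plus[symmetric] ennreal_mult[symmetric] del: ennreal_plus)
  finally show ?thesis unfolding G_def c_def .
qed

lemma mean_square_convergence:
  fixes p A :: real
  assumes p: "p > 2" and A: "0 < A"
    and mx: "(\<integral>\<^sup>+\<omega>. (SUP t\<in>{0..T}. ennreal (norm (x t \<omega>) powr p)) \<partial>M) \<le> ennreal A"
    and my: "\<And>h. 0 < h \<Longrightarrow> h < h0 \<Longrightarrow>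
      (\<integral>\<^sup>+\<omega>. (SUP t\<in>{0..T}. ennreal (norm (yc h t \<omega>) powr p)) \<partial>M) \<le> ennreal A"
  shows "((\<lambda>h. \<integral>\<^sup>+\<omega>. (SUP t\<in>{0..T}. ennreal ((norm (yc h t \<omega> - x t \<omega>))\<^sup>2)) \<partial>M) \<longlongrightarrow> 0) (at_right 0)"
proof (rule order_tendstoI)
  fix a :: ennreal assume "0 < a"
  \<comment> \<open>\<open>a\<close> may be infinite; a value strictly between 0 and
    \<open>a\<close> is finite and can serve as a real tolerance.\<close>
  then obtain b where b: "0 < b" "b < a" using dense by blast
  define \<eta> where "\<eta> = enn2real b"
  have "b < top" using b(2) by (rule less_le_trans) simp
  then have \<eta>: "0 < \<eta>" "ennreal \<eta> = b" using b(1) by (simp_all add: \<eta>_def enn2real_positive_iff)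
  define \<epsilon> where "\<epsilon> = min 1 (sqrt \<eta> / 4)"
  have \<epsilon>: "0 < \<epsilon>" "\<epsilon> \<le> 1" using \<eta> by (auto simp: \<epsilon>_def)
  have "\<epsilon>\<^sup>2 \<le> (sqrt \<eta> / 4)\<^sup>2" using \<epsilon> by (intro power_mono) (auto simp: \<epsilon>_def)
  then have \<epsilon>2: "4 * \<epsilon>\<^sup>2 \<le> \<eta> / 4" using \<eta> by (simp add: power_divide)
  define r where "r = \<eta> / (4 * (2 powr p * (2 * A)))"
  have r: "0 < r" using \<eta> A by (simp add: r_def)
  \<comment> \<open>Chosen so that the moment term is exactly \<eta>/4. \<rho> depends on \<eta>,
    \<open>p\<close> and \<open>A\<close> but not on \<open>h\<close>, so \<rho>^2 times the
    probability still tends to 0.\<close>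
  define \<rho> where "\<rho> = r powr (1 / (2 - p))"
  have \<rho>: "0 < \<rho>" using r by (simp add: \<rho>_def)
  have "\<rho> powr (2 - p) = r" using r p by (simp add: \<rho>_def powr_powr)
  then have \<rho>2: "\<rho> powr (2 - p) * 2 powr p * (2 * A) = \<eta> / 4" using A by (simp add: r_def)
  define D where "D = insert T (\<rat> \<inter> {0..T})"
  define G where "G = (\<lambda>h. {\<omega> \<in> space M. \<exists>t\<in>D. 2 * \<epsilon> < norm (yc h t \<omega> - x t \<omega>)})"
  have D: "countable D" "D \<subseteq> {0..T}" using T_pos by (auto simp: D_def countable_Int1 countable_rat)
  have "((\<lambda>h. prob (G h)) \<longlongrightarrow> 0) (at_right 0)" unfolding G_def by (rule uniform_error_tendsto_0[OF \<epsilon> D])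
  moreover have "0 < \<eta> / (4 * \<rho>\<^sup>2)" using \<eta> \<rho> by simp
  ultimately have "\<forall>\<^sub>F h in at_right 0. prob (G h) < \<eta> / (4 * \<rho>\<^sup>2)" by (rule order_tendstoD(2))
  moreover have "\<forall>\<^sub>F h in at_right 0. 0 < h \<and> h < h0" using h0_pos by (intro eventually_at_rightI[of 0 h0]) auto
  ultimately show "\<forall>\<^sub>F h in at_right 0. (\<integral>\<^sup>+\<omega>. (SUP t\<in>{0..T}. ennreal ((norm (yc h t \<omega> - x t \<omega>))\<^sup>2)) \<partial>M) < a"
  proof eventually_elim
    case (elim h)
    then have h: "0 < h" "h < h0" by auto
    have "\<rho>\<^sup>2 * prob (G h) \<le> \<eta> / 4" using elim \<rho> by (simp add: field_simps)
    then have le: "4 * \<epsilon>\<^sup>2 + \<rho>\<^sup>2 * prob (G h) + \<rho> powr (2 - p) * 2 powr p * (2 * A) \<le> \<eta>"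
      using \<epsilon>2 \<rho>2 \<eta>(1) by linarith
    have "(\<integral>\<^sup>+\<omega>. (SUP t\<in>{0..T}. ennreal ((norm (yc h t \<omega> - x t \<omega>))\<^sup>2)) \<partial>M)
      \<le> ennreal (4 * \<epsilon>\<^sup>2 + \<rho>\<^sup>2 * prob (G h) + \<rho> powr (2 - p) * 2 powr p * (2 * A))"
      unfolding G_def D_def by (rule mean_square_error_bound[OF p A \<epsilon>(1) \<rho> h mx my[OF h]])
    also have "\<dots> \<le> ennreal \<eta>" using le by (rule ennreal_leI)
    also have "\<dots> < a" using \<eta>(2) b(2) by simp
    finally show ?case .
  qed
qed simp

end

theorem theorem2p4:
  fixes M :: "'a measure" and F :: "real \<Rightarrow> 'a measure"
    and w :: "real \<Rightarrow> 'a \<Rightarrow> real ^ 'm"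
    and f :: "real ^ 'd \<Rightarrow> real ^ 'd \<Rightarrow> real ^ 'd"
    and g :: "real ^ 'd \<Rightarrow> real ^ 'd \<Rightarrow> real ^ 'm ^ 'd"
    and \<tau> :: "real \<Rightarrow> real"
    and \<psi> x :: "real \<Rightarrow> 'a \<Rightarrow> real ^ 'd"
    and ip :: interpolation
    and y ys :: "real \<Rightarrow> nat \<Rightarrow> 'a \<Rightarrow> real ^ 'd"
    and ybar :: "real \<Rightarrow> real \<Rightarrow> 'a \<Rightarrow> real ^ 'd"
    and T h0 \<eta>1 \<eta>2 p A :: real
  assumes basis: "usual_stochastic_basis M F"
    and wiener: "wiener_process M F w"
    and delay_nonneg: "\<And>t. t \<ge> 0 \<Longrightarrow> \<tau> t \<ge> 0"
    and delay_bdd: "bdd_below ((\<lambda>t. t - \<tau> t) ` {0..})"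
    and psi_measurable: "\<And>s. s \<in> {initial_time \<tau>..0} \<Longrightarrow> \<psi> s \<in> borel_measurable (F 0)"
    and psi_continuous:
      "\<And>\<omega>. \<omega> \<in> space M \<Longrightarrow> continuous_on {initial_time \<tau>..0} (\<lambda>s. \<psi> s \<omega>)"
    and psi_indep:
      "prob_space.indep_set M (path_events M {initial_time \<tau>..0} \<psi>) (path_events M {0..} w)"
    and T_pos: "T > 0"
    and solution: "unique_sdde_solution M F w f g \<tau> \<psi> T x"
    and locally_lipschitz:
      "\<And>R. R > 0 \<Longrightarrow> \<exists>L. \<forall>x1 x2 y1 y2.
         norm x1 \<le> R \<and> norm x2 \<le> R \<and> norm y1 \<le> R \<and> norm y2 \<le> R \<longrightarrow>
         max ((norm (f x2 y2 - f x1 y1))\<^sup>2) ((norm (g x2 y2 - g x1 y1))\<^sup>2)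
           \<le> L * ((norm (x2 - x1))\<^sup>2 + (norm (y2 - y1))\<^sup>2)"
    and psi_holder:
      "\<And>s t. s \<in> {initial_time \<tau>..0} \<Longrightarrow> t \<in> {initial_time \<tau>..0} \<Longrightarrow>
         (\<integral>\<^sup>+\<omega>. ennreal ((norm (\<psi> t \<omega> - \<psi> s \<omega>))\<^sup>2) \<partial>M) \<le> ennreal (\<eta>1 * \<bar>t - s\<bar>)"
    and delay_continuous: "continuous_on {0..} \<tau>"
    and delay_lipschitz:
      "\<And>s t. s \<ge> 0 \<Longrightarrow> t \<ge> 0 \<Longrightarrow> \<bar>\<tau> t - \<tau> s\<bar> \<le> \<eta>2 * \<bar>t - s\<bar>"
    and h0_pos: "h0 > 0"
    and scheme:
      "\<And>h \<omega>. 0 < h \<Longrightarrow> h < h0 \<Longrightarrow> \<omega> \<in> space M \<Longrightarrow>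
         ssbe_scheme ip f g \<tau> (\<lambda>s. \<psi> s \<omega>) (\<lambda>t. w t \<omega>) h (\<lambda>n. y h n \<omega>) (\<lambda>n. ys h n \<omega>)"
    and uniquely_solvable:
      "\<And>h \<omega> n. 0 < h \<Longrightarrow> h < h0 \<Longrightarrow> \<omega> \<in> space M \<Longrightarrow>
         \<exists>!z. implicit_step ip f \<tau> (\<lambda>s. \<psi> s \<omega>) h (\<lambda>n. y h n \<omega>) (\<lambda>n. ys h n \<omega>) n z"
    and scheme_adapted:
      "\<And>h n. 0 < h \<Longrightarrow> h < h0 \<Longrightarrow>
         y h n \<in> borel_measurable (F (real n * h)) \<and> ys h n \<in> borel_measurable (F (real n * h))"
    and ybar_eq:
      "\<And>h t \<omega>. ybar h t \<omega> =
         ssbe_continuous ip f g \<tau> (\<lambda>s. \<psi> s \<omega>) (\<lambda>r. w r \<omega>) h (\<lambda>n. y h n \<omega>) (\<lambda>n. ys h n \<omega>) t"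
    and p_gt_2: "p > 2"
    and A_pos: "A > 0"
    and moment_x: "(\<integral>\<^sup>+\<omega>. (SUP t\<in>{0..T}. ennreal (norm (x t \<omega>) powr p)) \<partial>M) \<le> ennreal A"
    and moment_ybar:
      "\<And>h. 0 < h \<Longrightarrow> h < h0 \<Longrightarrow>
         (\<integral>\<^sup>+\<omega>. (SUP t\<in>{0..T}. ennreal (norm (ybar h t \<omega>) powr p)) \<partial>M) \<le> ennreal A"
  shows "((\<lambda>h. \<integral>\<^sup>+\<omega>. (SUP t\<in>{0..T}. ennreal ((norm (ybar h t \<omega> - x t \<omega>))\<^sup>2)) \<partial>M)
           \<longlongrightarrow> 0) (at_right 0)"
proof -
  interpret b: usual_stochastic_basis M F by (rule basis)
  interpret ssbe_setting M F w f g \<tau> \<psi> x ip y ys T h0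
  proof unfold_locales
    show "wiener_process M F w" by (rule wiener)
    show "sdde_solution M F w f g \<tau> \<psi> T x"
      using solution unfolding unique_sdde_solution_def by blast
  qed (rule delay_nonneg delay_bdd delay_continuous psi_measurable T_pos locally_lipschitz h0_pos
      scheme uniquely_solvable scheme_adapted; assumption)+
  have eq: "ybar h t \<omega> = yc h t \<omega>" for h t \<omega>
    by (simp add: ybar_eq yc_def)
  show ?thesis
    unfolding eq
    by (rule mean_square_convergence[OF p_gt_2 A_pos moment_x moment_ybar[unfolded eq]])
qed

end
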